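(* Let $\varepsilon=(\varepsilon_1,\varepsilon_2),\delta=(\delta_1,\delta_2)\in\{\pm\}^2$ and $\lambda=(\lambda_1,\lambda_2),\nu=(\nu_1,\nu_2)\in\mathbb C^2$. Then, regarding operators on $C^\infty(\mathbb R^3)$ via restriction to the open Bruhat cell, $$\mathrm{Diff}_G\big(I(\lambda_1,\lambda_2)^{(\varepsilon_1,\varepsilon_2)},I(\nu_1,\nu_2)^{(\delta_1,\delta_2)}\big)=\begin{cases}\mathbb C\,\mathrm{id}&\text{if }(\delta;\nu)=(\varepsilon;\lambda),\\ \mathbb C\,\mathcal D_1^{\,1-\lambda_1}&\text{if }(\varepsilon,\delta;\lambda,\nu)\in\Xi_a,\\ \mathbb C\,\mathcal D_2^{\,1-\lambda_2}&\text{if }(\varepsilon,\delta;\lambda,\nu)\in\Xi_a',\\ \mathbb C\,\mathcal D_+^{(1-\lambda_1,\,2-\lambda_1-\lambda_2)}&\text{if }(\varepsilon,\delta;\lambda,\nu)\in\Xi_b,\\ \mathbb C\,\mathcal D_-^{(2-\lambda_1-\lambda_2,\,1-\lambda_2)}&\text{if }(\varepsilon,\delta;\lambda,\nu)\in\Xi_b',\\ \mathbb C\,\mathcal D_c^{(\lambda_2-\lambda_1;\,2-\lambda_1-\lambda_2)}&\text{if }(\varepsilon,\delta;\lambda,\nu)\in\Xi_c,\\ \{0\}&\text{otherwise.}\end{cases}$$ In particular in each of the nonzero cases the displayed operator is a $G$-intertwining differential operator and the space is one-dimensional.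
   Context: $G=SL(3,\mathbb R)$. $E_{i,j}$ are matrix units; $N_1^+=E_{1,2},N_2^+=E_{2,3},N_3^+=E_{1,3}$, $N_1^-=E_{2,1},N_2^-=E_{3,2},N_3^-=E_{3,1}$; $H_1=\mathrm{diag}(1,-1,0)$, $H_2=\mathrm{diag}(0,1,-1)$. $A=\exp(\mathbb RH_1+\mathbb RH_2)$, $N_+$ = upper unitriangular matrices, $N_-=\exp(\mathrm{span}_{\mathbb R}\{N_1^-,N_2^-,N_3^-\})$, $M$ = diagonal matrices in $G$ with entries $\pm1$, $B=MAN_+$. For $\lambda\in\mathbb C^2$, $\chi_A^{\lambda}(\exp(t_1H_1+t_2H_2))=e^{\lambda_1t_1+\lambda_2t_2}$; for $\varepsilon\in\{\pm\}^2$, $\chi_M^{\varepsilon}(\mathrm{diag}(b_1,b_2,b_3))=|b_1|_{\varepsilon_1}|b_3|_{\varepsilon_2}$ with $|b|_+=|b|$, $|b|_-=b$. $I(\lambda_1,\lambda_2)^{(\varepsilon_1,\varepsilon_2)}=\{f\in C^\infty(G): f(gman)=\chi_M^\varepsilon(m)^{-1}\chi_A^\lambda(a)^{-1}f(g)\ (m\in M,a\in A,n\in N_+)\}$ with $G$ acting by left translation. $f\mapsto F$, $F(x)=f(\exp(x_1N_1^-+x_2N_2^-+x_3N_3^-))$, embeds it into $C^\infty(\mathbb R^3)$; a differential operator $\mathcal D$ on $C^\infty(\mathbb R^3)$ belongs to $\mathrm{Diff}_G(I(\lambda)^{(\varepsilon)},I(\nu)^{(\delta)})$ if it maps (restrictions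 of) $I(\lambda)^{(\varepsilon)}$ into $I(\nu)^{(\delta)}$ and the induced map commutes with the $G$-actions. $\mathcal D_1=\partial_{x_1}+\frac{x_2}{2}\partial_{x_3}$, $\mathcal D_2=\partial_{x_2}-\frac{x_1}{2}\partial_{x_3}$, $\mathcal D_3=\partial_{x_3}$. Symmetrization: $\mathbf s(a_1^{p}a_2^{q}a_3^{r})$ = average over all orderings of the product containing $a_1$ $p$ times, $a_2$ $q$ times, $a_3$ $r$ times. Cayley continuants: $\mathrm{Cay}_m(x;y)=\sum_{j=0}^m\binom mj\big(\frac{x+y}2\big)^{\underline j}\big(\frac{x-y}2\big)^{\overline{m-j}}$ with $r^{\underline j}=r(r-1)\cdots(r-j+1)$, $r^{\overline j}=r(r+1)\cdots(r+j-1)$ (equivalently the $m\times m$ tridiagonal determinant with diagonal $x$, superdiagonal $1,2,\dots,m-1$, subdiagonal $y,y-1,\dots,y-m+2$; $\mathrm{Cay}_0=1$). For $k,\ell\in\mathbb Z_{\ge0}$, $s\in\mathbb C$: $\mathcal D_\pm^{(k,\ell)}=\sum_{m=0}^{\min(k,\ell)}\frac{(\pm1)^m}{2^m}m!\binom km\binom\ell m\mathbf s(\mathcal D_1^{k-m}\mathcal D_2^{\ell-m}\mathcal D_3^m)$, $\mathcal D_c^{(s;k)}=\sum_{m=0}^k\frac1{2^m}\binom km\mathrm{Cay}_m(s;k)\mathbf s(\mathcal D_1^{k-m}\mathcal D_2^{k-m}\mathcal D_3^m)$. Signs: for $n\in\mathbb Z$, $(-)^n$ is $+$ if $n$ even and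 $-$ if $n$ odd; signs multiply in $\{\pm\}$. Parameter sets: $\Xi_a$: $\lambda_1\in\mathbb Z_{\le0}$, $\lambda_2\in\mathbb C$, $\nu=(2-\lambda_1,\lambda_1+\lambda_2-1)$, $\delta=(\varepsilon_1,\varepsilon_2(-)^{1-\lambda_1})$. $\Xi_a'$: $\lambda_2\in\mathbb Z_{\le0}$, $\lambda_1\in\mathbb C$, $\nu=(\lambda_1+\lambda_2-1,2-\lambda_2)$, $\delta=(\varepsilon_1(-)^{1-\lambda_2},\varepsilon_2)$. $\Xi_b$: $\lambda=(1-k,1-\ell+k)$ with $k,\ell\in\mathbb Z_{\ge1}$, $\nu=(\lambda_2,3-\lambda_1-\lambda_2)$, $\delta=(\varepsilon_1(-)^{2-\lambda_1-\lambda_2},\varepsilon_2(-)^{1-\lambda_1})$. $\Xi_b'$: $\lambda=(1-k+\ell,1-\ell)$ with $k,\ell\in\mathbb Z_{\ge1}$, $\nu=(3-\lambda_1-\lambda_2,\lambda_1)$, $\delta=(\varepsilon_1(-)^{1-\lambda_2},\varepsilon_2(-)^{2-\lambda_1-\lambda_2})$. $\Xi_c$: $\lambda=(\frac{2-k-s}2,\frac{2-k+s}2)$ with $k\in\mathbb Z_{\ge1}$, $s\in\mathbb C$, $\nu=(2-\lambda_2,2-\lambda_1)$, $\delta=(\varepsilon_1(-)^{2-\lambda_1-\lambda_2},\varepsilon_2(-)^{2-\lambda_1-\lambda_2})$. *)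

theory Defs
  imports "HOL-Analysis.Analysis"
begin

fun Ck :: "nat \<Rightarrow> 'a::real_normed_vector set \<Rightarrow> ('a \<Rightarrow> 'b::real_normed_vector) \<Rightarrow> bool" where
  "Ck 0 U f = continuous_on U f"
| "Ck (Suc k) U f = (f differentiable_on U \<and>
      (\<forall>v. Ck k U (\<lambda>x. frechet_derivative f (at x) v)))"

definition smooth_on :: "'a::real_normed_vector set \<Rightarrow> ('a \<Rightarrow> 'b::real_normed_vector) \<Rightarrow> bool" where
  "smooth_on U f \<longleftrightarrow> (\<forall>k. Ck k U f)"

type_synonym mat3 = "real^3^3"

definition SL3 :: "mat3 set" where
  "SL3 = {g. det g = 1}"

definition mk3 :: "real \<Rightarrow> real \<Rightarrow> real \<Rightarrow> real \<Rightarrow> real \<Rightarrow> real \<Rightarrow> real \<Rightarrow> real \<Rightarrow> real \<Rightarrow> mat3" where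
  "mk3 a11 a12 a13 a21 a22 a23 a31 a32 a33 =
     (\<chi> i j. if i = 1 then (if j = 1 then a11 else if j = 2 then a12 else a13)
             else if i = 2 then (if j = 1 then a21 else if j = 2 then a22 else a23)
             else (if j = 1 then a31 else if j = 2 then a32 else a33))"

definition diag3 :: "real \<Rightarrow> real \<Rightarrow> real \<Rightarrow> mat3" where
  "diag3 a b c = mk3 a 0 0 0 b 0 0 0 c"

text \<open>exp(t1 H1 + t2 H2) = diag(e^t1, e^(t2-t1), e^(-t2)).\<close>
definition Aelt :: "real \<Rightarrow> real \<Rightarrow> mat3" where
  "Aelt t1 t2 = diag3 (exp t1) (exp (t2 - t1)) (exp (- t2))"

definition Nplus :: "real \<Rightarrow> real \<Rightarrow> real \<Rightarrow> mat3" where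
  "Nplus a b c = mk3 1 a c 0 1 b 0 0 1"

text \<open>exp(x1 N1^- + x2 N2^- + x3 N3^-) written out (the exponential series terminates:
  X^2 = x1 x2 E_31, X^3 = 0).\<close>
definition nbar :: "real^3 \<Rightarrow> mat3" where
  "nbar x = mk3 1 0 0 (x$1) 1 0 (x$3 + x$1 * x$2 / 2) (x$2) 1"

datatype pm = Pos | Neg

fun pm_mult :: "pm \<Rightarrow> pm \<Rightarrow> pm" where
  "pm_mult Pos s = s"
| "pm_mult Neg Pos = Neg"
| "pm_mult Neg Neg = Pos"

definition sgn_pow :: "int \<Rightarrow> pm" where
  "sgn_pow n = (if even n then Pos else Neg)"

fun abs_pm :: "pm \<Rightarrow> real \<Rightarrow> real" where
  "abs_pm Pos b = \<bar>b\<bar>"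
| "abs_pm Neg b = b"

text \<open>chi_M^eps(diag(b1,b2,b3)) = |b1|_eps1 |b3|_eps2\<close>
definition chiM :: "pm \<times> pm \<Rightarrow> real \<Rightarrow> real \<Rightarrow> complex" where
  "chiM eps b1 b3 = complex_of_real (abs_pm (fst eps) b1 * abs_pm (snd eps) b3)"

text \<open>chi_A^lambda(exp(t1 H1 + t2 H2)) = e^(lambda1 t1 + lambda2 t2)\<close>
definition chiA :: "complex \<times> complex \<Rightarrow> real \<Rightarrow> real \<Rightarrow> complex" where
  "chiA lam t1 t2 = exp (fst lam * complex_of_real t1 + snd lam * complex_of_real t2)"

definition smooth_on_G :: "(mat3 \<Rightarrow> complex) \<Rightarrow> bool" where
  "smooth_on_G f \<longleftrightarrow> (\<exists>U F. open U \<and> SL3 \<subseteq> U \<and> smooth_on U F \<and> (\<forall>g\<in>SL3. F g = f g))"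

definition Ind :: "complex \<times> complex \<Rightarrow> pm \<times> pm \<Rightarrow> (mat3 \<Rightarrow> complex) set" where
  "Ind lam eps = {f. smooth_on_G f \<and>
     (\<forall>g\<in>SL3. \<forall>b1 b2 b3 t1 t2 a b c.
        b1 \<in> {-1, 1} \<and> b2 \<in> {-1, 1} \<and> b3 \<in> {-1, 1} \<and> b1 * b2 * b3 = 1 \<longrightarrow>
        f (g ** diag3 b1 b2 b3 ** Aelt t1 t2 ** Nplus a b c)
          = inverse (chiM eps b1 b3) * inverse (chiA lam t1 t2) * f g)}"

definition Lact :: "mat3 \<Rightarrow> (mat3 \<Rightarrow> complex) \<Rightarrow> (mat3 \<Rightarrow> complex)" where
  "Lact g f = (\<lambda>h. f (matrix_inv g ** h))"

text \<open>Restriction to the open Bruhat cell, in coordinates.\<close>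
definition res :: "(mat3 \<Rightarrow> complex) \<Rightarrow> (real^3 \<Rightarrow> complex)" where
  "res f = (\<lambda>x. f (nbar x))"

type_synonym op3 = "(real^3 \<Rightarrow> complex) \<Rightarrow> (real^3 \<Rightarrow> complex)"

definition pd :: "3 \<Rightarrow> op3" where
  "pd i F = (\<lambda>x. frechet_derivative F (at x) (axis i 1))"

fun pds :: "3 list \<Rightarrow> op3" where
  "pds [] F = F"
| "pds (i # w) F = pd i (pds w F)"

definition is_diffop :: "op3 \<Rightarrow> bool" where
  "is_diffop D \<longleftrightarrow> (\<exists>terms :: ((real^3 \<Rightarrow> complex) \<times> 3 list) list.
     (\<forall>p\<in>set terms. smooth_on UNIV (fst p)) \<and>
     (\<forall>F. smooth_on UNIV F \<longrightarrow> D F = (\<lambda>x. \<Sum>p\<leftarrow>terms. fst p x * pds (snd p) F x)))"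

definition DiffG :: "complex \<times> complex \<Rightarrow> pm \<times> pm \<Rightarrow> complex \<times> complex \<Rightarrow> pm \<times> pm \<Rightarrow> op3 set" where
  "DiffG lam eps nu del = {D. is_diffop D \<and>
     (\<forall>f\<in>Ind lam eps. \<exists>h\<in>Ind nu del. D (res f) = res h \<and>
        (\<forall>g\<in>SL3. D (res (Lact g f)) = res (Lact g h)))}"

definition Cline :: "op3 \<Rightarrow> op3 set" where
  "Cline Op = {D. is_diffop D \<and> (\<exists>c. \<forall>F. smooth_on UNIV F \<longrightarrow> D F = (\<lambda>x. c * Op F x))}"

definition Dop1 :: op3 where
  "Dop1 F = (\<lambda>x. pd 1 F x + complex_of_real (x$2 / 2) * pd 3 F x)"

definition Dop2 :: op3 where
  "Dop2 F = (\<lambda>x. pd 2 F x - complex_of_real (x$1 / 2) * pd 3 F x)"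

definition Dop3 :: op3 where
  "Dop3 F = pd 3 F"

definition Dop :: "nat \<Rightarrow> op3" where
  "Dop i = (if i = 1 then Dop1 else if i = 2 then Dop2 else Dop3)"

fun word_op :: "nat list \<Rightarrow> op3" where
  "word_op [] F = F"
| "word_op (i # w) F = Dop i (word_op w F)"

definition words :: "nat \<Rightarrow> nat \<Rightarrow> nat \<Rightarrow> nat list set" where
  "words p q r = {w. set w \<subseteq> {1, 2, 3} \<and> length (filter (\<lambda>i. i = 1) w) = p
      \<and> length (filter (\<lambda>i. i = 2) w) = q \<and> length (filter (\<lambda>i. i = 3) w) = r}"

definition symm :: "nat \<Rightarrow> nat \<Rightarrow> nat \<Rightarrow> op3" where
  "symm p q r F = (\<lambda>x. (\<Sum>w\<in>words p q r. word_op w F x) / of_nat (card (words p q r)))"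

definition Dpow :: "nat \<Rightarrow> nat \<Rightarrow> op3" where
  "Dpow i k = word_op (replicate k i)"

definition falling :: "complex \<Rightarrow> nat \<Rightarrow> complex" where
  "falling r j = (\<Prod>i<j. r - of_nat i)"

definition rising :: "complex \<Rightarrow> nat \<Rightarrow> complex" where
  "rising r j = (\<Prod>i<j. r + of_nat i)"

definition Cay :: "nat \<Rightarrow> complex \<Rightarrow> complex \<Rightarrow> complex" where
  "Cay m x y = (\<Sum>j=0..m. of_nat (m choose j) * falling ((x + y) / 2) j * rising ((x - y) / 2) (m - j))"

definition Dpm :: "bool \<Rightarrow> nat \<Rightarrow> nat \<Rightarrow> op3" where
  "Dpm pos k l F = (\<lambda>x. \<Sum>m=0..min k l.
      ((if pos then 1 else -1) ^ m / 2 ^ m) * of_nat (fact m * (k choose m) * (l choose m))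
      * symm (k - m) (l - m) m F x)"

definition Dc :: "complex \<Rightarrow> nat \<Rightarrow> op3" where
  "Dc s k F = (\<lambda>x. \<Sum>m=0..k. (1 / 2 ^ m) * of_nat (k choose m) * Cay m s (of_nat k)
      * symm (k - m) (k - m) m F x)"

definition cond_a :: "pm \<times> pm \<Rightarrow> pm \<times> pm \<Rightarrow> complex \<times> complex \<Rightarrow> complex \<times> complex \<Rightarrow> int \<Rightarrow> bool" where
  "cond_a eps del lam nu n1 \<longleftrightarrow> n1 \<le> 0 \<and> fst lam = of_int n1 \<and>
     nu = (2 - fst lam, fst lam + snd lam - 1) \<and>
     del = (fst eps, pm_mult (snd eps) (sgn_pow (1 - n1)))"

definition cond_a' :: "pm \<times> pm \<Rightarrow> pm \<times> pm \<Rightarrow> complex \<times> complex \<Rightarrow> complex \<times> complex \<Rightarrow> int \<Rightarrow> bool" where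
  "cond_a' eps del lam nu n2 \<longleftrightarrow> n2 \<le> 0 \<and> snd lam = of_int n2 \<and>
     nu = (fst lam + snd lam - 1, 2 - snd lam) \<and>
     del = (pm_mult (fst eps) (sgn_pow (1 - n2)), snd eps)"

definition cond_b :: "pm \<times> pm \<Rightarrow> pm \<times> pm \<Rightarrow> complex \<times> complex \<Rightarrow> complex \<times> complex \<Rightarrow> nat \<Rightarrow> nat \<Rightarrow> bool" where
  "cond_b eps del lam nu k l \<longleftrightarrow> k \<ge> 1 \<and> l \<ge> 1 \<and>
     (let n1 = 1 - int k; n2 = 1 - int l + int k in
      lam = (of_int n1, of_int n2) \<and>
      nu = (snd lam, 3 - fst lam - snd lam) \<and>
      del = (pm_mult (fst eps) (sgn_pow (2 - n1 - n2)), pm_mult (snd eps) (sgn_pow (1 - n1))))"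

definition cond_b' :: "pm \<times> pm \<Rightarrow> pm \<times> pm \<Rightarrow> complex \<times> complex \<Rightarrow> complex \<times> complex \<Rightarrow> nat \<Rightarrow> nat \<Rightarrow> bool" where
  "cond_b' eps del lam nu k l \<longleftrightarrow> k \<ge> 1 \<and> l \<ge> 1 \<and>
     (let n1 = 1 - int k + int l; n2 = 1 - int l in
      lam = (of_int n1, of_int n2) \<and>
      nu = (3 - fst lam - snd lam, fst lam) \<and>
      del = (pm_mult (fst eps) (sgn_pow (1 - n2)), pm_mult (snd eps) (sgn_pow (2 - n1 - n2))))"

text \<open>For Xi_c, 2 - lambda1 - lambda2 = k.\<close>
definition cond_c :: "pm \<times> pm \<Rightarrow> pm \<times> pm \<Rightarrow> complex \<times> complex \<Rightarrow> complex \<times> complex \<Rightarrow> nat \<Rightarrow> complex \<Rightarrow> bool" where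
  "cond_c eps del lam nu k s \<longleftrightarrow> k \<ge> 1 \<and>
     lam = ((2 - of_nat k - s) / 2, (2 - of_nat k + s) / 2) \<and>
     nu = (2 - snd lam, 2 - fst lam) \<and>
     del = (pm_mult (fst eps) (sgn_pow (int k)), pm_mult (snd eps) (sgn_pow (int k)))"

end

theory Submission
  imports Defs "HOL-Library.Function_Algebras"
begin

text \<open>A $G$-equivariant differential operator commutes in particular with the left translations by
  the lower unitriangular group, so on the big cell it is a polynomial with constant coefficients in
  the left-invariant fields $X = D_1$, $Y = D_2$ and $Z = D_3$.  Principal series contain functions with
  arbitrary jets at the identity; equivariance under the torus therefore singles out one weight space,
  spanned by the $X^{k-n} Y^{l-n} Z^n$ with $n \<le> \min(k, l)$, and invariance under the upper
  unitriangular group says that the operator is a singular vector of a Verma module.  In this ordered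
  basis each of the two simple root vectors gives a two-term recursion for the coefficients: the first
  one determines them up to a scalar as $\binom{k}{n}$ times a falling factorial, and compatibility with
  the second one leaves exactly the listed parameters.  Reordering turns the symmetrized operators of
  the statement into this basis, where the Cayley continuants become a falling factorial by Vandermonde
  summation.\<close>

section \<open>Smooth functions and brackets of vector fields\<close>

text \<open>The two recursions are compatible at step m exactly when the m-th coefficient times (k -
  m)(\<tau> - m) + (l - m)(m + 1 - l - \<open>snd lam\<close>) vanishes, where \<tau> = 1 -
  \<open>fst lam\<close> + l - k. The squares of m cancel, so this factor is linear in m: it
  vanishes identically (families b and c), or the coefficients with positive m vanish and only m = 0
  counts (family b'), or k or l is zero. The finite support of the coefficients adds a condition,
  which decides the cases where too few steps are available: \<tau> = 0 if l = 0 < k, and \<tau> in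
  {0, 1} if l = 1 < k. Two obstacles shape the development. Arbitrary jets must come from functions
  that are covariant on the whole group; these are written down explicitly, as monomials in the
  first column and in the minors of the first two columns, times complex powers of positive square
  norms. And functions on the group are arbitrary off \<open>SL3\<close>, so they are set to zero
  there before operators are compared.\<close>

lemma differentiable_on_openD:
  "f differentiable_on U \<Longrightarrow> open U \<Longrightarrow> x \<in> U \<Longrightarrow> f differentiable at x"
  by (simp add: differentiable_on_eq_differentiable_at)

text \<open>Beyond order zero \<open>Ck\<close> takes \<open>frechet_derivative\<close> at points of
  \<open>U\<close>, not within \<open>U\<close>; openness is what makes it depend on the values on
  \<open>U\<close> alone.\<close>

lemma Ck_cong:
  assumes "open U" "\<And>x. x \<in> U \<Longrightarrow> f x = g x"
  shows "Ck k U f \<longleftrightarrow> Ck k U g"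
  using assms(2)
proof (induction k arbitrary: f g)
  case 0
  then show ?case by (simp cong: continuous_on_cong)
next
  case (Suc k)
  have imp: "Ck (Suc k) U g" if fg: "\<And>x. x \<in> U \<Longrightarrow> f x = g x" and f: "Ck (Suc k) U f"
    for f g :: "'a \<Rightarrow> 'b"
  proof -
    have d: "f differentiable_on U" using f by simp
    have d': "g differentiable_on U"
      using d fg unfolding differentiable_on_def
      by (auto intro: differentiable_transform_within[OF _ zero_less_one])
    have "frechet_derivative f (at x) = frechet_derivative g (at x)" if "x \<in> U" for x
      using frechet_derivative_transform_within_open[OF differentiable_on_openD[OF d assms(1) that] assms(1) that]
        fg by blast
    then have "Ck k U (\<lambda>x. frechet_derivative g (at x) v)" for v
      using Suc.IH[of "\<lambda>x. frechet_derivative f (at x) v" "\<lambda>x. frechet_derivative g (at x) v"] f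
      by simp
    with d' show ?thesis by simp
  qed
  show ?case
  proof
    show "Ck (Suc k) U g" if "Ck (Suc k) U f"
      using that by (rule imp[rotated]) (simp add: Suc.prems)
    show "Ck (Suc k) U f" if "Ck (Suc k) U g"
      using that by (rule imp[rotated]) (simp add: Suc.prems)
  qed
qed

text \<open>\<open>frechet_derivative\<close> is a choice operator. The closure properties below
  exhibit some derivative, and uniqueness identifies it with the chosen one.\<close>

lemma Ck_SucI:
  assumes U: "open U" and d: "\<And>x. x \<in> U \<Longrightarrow> (f has_derivative f' x) (at x)"
    and k: "\<And>v. Ck k U (\<lambda>x. f' x v)"
  shows "Ck (Suc k) U f"
proof -
  have "frechet_derivative f (at x) v = f' x v" if "x \<in> U" for x v
    using frechet_derivative_at[OF d[OF that]] by simp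
  then have "Ck k U (\<lambda>x. frechet_derivative f (at x) v)" for v
    using Ck_cong[OF U, of "\<lambda>x. frechet_derivative f (at x) v" "\<lambda>x. f' x v"] k by blast
  moreover have "f differentiable_on U"
    using d U by (auto simp: differentiable_on_eq_differentiable_at differentiable_def)
  ultimately show ?thesis by simp
qed

lemma Ck_SucD: "Ck (Suc k) U f \<Longrightarrow> Ck k U f"
proof (induction k arbitrary: f)
  case 0
  then show ?case by (simp add: differentiable_imp_continuous_on)
next
  case (Suc k)
  then show ?case by (metis Ck.simps(2))
qed

lemma Ck_derivative:
  assumes "open U" "Ck (Suc k) U f" "x \<in> U"
  shows "(f has_derivative frechet_derivative f (at x)) (at x)"
  using assms differentiable_on_openD frechet_derivative_works by (metis Ck.simps(2))

lemma Ck_const: "open U \<Longrightarrow> Ck k U (\<lambda>x. c)"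
  by (induction k arbitrary: c) auto

lemma Ck_add:
  assumes "open U" shows "Ck k U f \<Longrightarrow> Ck k U g \<Longrightarrow> Ck k U (\<lambda>x. f x + g x)"
proof (induction k arbitrary: f g)
  case 0
  then show ?case by (simp add: continuous_on_add)
next
  case (Suc k)
  show ?case
  proof (rule Ck_SucI[OF assms])
    show "((\<lambda>x. f x + g x) has_derivative
      (\<lambda>v. frechet_derivative f (at x) v + frechet_derivative g (at x) v)) (at x)" if "x \<in> U" for x
      using Ck_derivative[OF assms Suc.prems(1) that] Ck_derivative[OF assms Suc.prems(2) that]
      by (rule has_derivative_add)
  qed (use Suc in auto)
qed

lemma Ck_sum:
  assumes "open U" "finite I" "\<And>i. i \<in> I \<Longrightarrow> Ck k U (f i)"
  shows "Ck k U (\<lambda>x. \<Sum>i\<in>I. f i x)"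
  using assms(2,3) by (induction I rule: finite_induct) (auto simp: Ck_const Ck_add assms(1))

lemma (in bounded_linear) Ck:
  assumes "open U" shows "Ck k U g \<Longrightarrow> Ck k U (\<lambda>x. f (g x))"
proof (induction k arbitrary: g)
  case 0
  then show ?case by (simp add: continuous_on)
next
  case (Suc k)
  show ?case
  proof (rule Ck_SucI[OF assms])
    show "((\<lambda>x. f (g x)) has_derivative (\<lambda>v. f (frechet_derivative g (at x) v))) (at x)" if "x \<in> U" for x
      using has_derivative[OF Ck_derivative[OF assms Suc.prems that]] .
  qed (use Suc in auto)
qed

lemma (in bounded_bilinear) Ck:
  assumes "open U" shows "Ck k U f \<Longrightarrow> Ck k U g \<Longrightarrow> Ck k U (\<lambda>x. prod (f x) (g x))"
proof (induction k arbitrary: f g)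
  case 0
  then show ?case by (simp add: continuous_on)
next
  case (Suc k)
  show ?case
  proof (rule Ck_SucI[OF assms])
    show "((\<lambda>x. prod (f x) (g x)) has_derivative
       (\<lambda>v. prod (f x) (frechet_derivative g (at x) v) + prod (frechet_derivative f (at x) v) (g x))) (at x)"
      if "x \<in> U" for x
      using FDERIV[OF Ck_derivative[OF assms Suc.prems(1) that] Ck_derivative[OF assms Suc.prems(2) that]] .
    show "Ck k U (\<lambda>x. prod (f x) (frechet_derivative g (at x) v) + prod (frechet_derivative f (at x) v) (g x))"
      for v
      \<comment> \<open>The undifferentiated factors of the Leibniz rule have one order of
        smoothness to spare.\<close>
      using Suc.prems Ck_SucD[OF Suc.prems(1)] Ck_SucD[OF Suc.prems(2)]
      by (intro Ck_add[OF assms] Suc.IH) auto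
  qed
qed

lemma smooth_onD: "smooth_on U f \<Longrightarrow> Ck k U f"
  by (simp add: smooth_on_def)

lemma smooth_onI: "(\<And>k. Ck k U f) \<Longrightarrow> smooth_on U f"
  by (simp add: smooth_on_def)

lemma smooth_on_derivative:
  "open U \<Longrightarrow> smooth_on U f \<Longrightarrow> x \<in> U \<Longrightarrow> (f has_derivative frechet_derivative f (at x)) (at x)"
  using Ck_derivative smooth_onD by metis

lemma smooth_on_differentiable:
  "open U \<Longrightarrow> smooth_on U f \<Longrightarrow> x \<in> U \<Longrightarrow> f differentiable at x"
  using smooth_on_derivative differentiable_def by metis

lemma smooth_on_frechet: "smooth_on U f \<Longrightarrow> smooth_on U (\<lambda>x. frechet_derivative f (at x) v)"
  by (metis Ck.simps(2) smooth_on_def)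

lemma smooth_on_cong: "open U \<Longrightarrow> (\<And>x. x \<in> U \<Longrightarrow> f x = g x) \<Longrightarrow> smooth_on U f \<longleftrightarrow> smooth_on U g"
  unfolding smooth_on_def using Ck_cong by metis

lemma smooth_on_continuous: "smooth_on U f \<Longrightarrow> continuous_on U f"
  using smooth_onD[of U f 0] by simp

lemma smooth_on_const: "open U \<Longrightarrow> smooth_on U (\<lambda>x. c)"
  by (simp add: smooth_on_def Ck_const)

lemma smooth_on_add: "open U \<Longrightarrow> smooth_on U f \<Longrightarrow> smooth_on U g \<Longrightarrow> smooth_on U (\<lambda>x. f x + g x)"
  by (simp add: smooth_on_def Ck_add)

lemma smooth_on_sum:
  "open U \<Longrightarrow> finite I \<Longrightarrow> (\<And>i. i \<in> I \<Longrightarrow> smooth_on U (f i)) \<Longrightarrow> smooth_on U (\<lambda>x. \<Sum>i\<in>I. f i x)"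
  by (simp add: smooth_on_def Ck_sum)

lemma (in bounded_linear) smooth_on: "open U \<Longrightarrow> smooth_on U g \<Longrightarrow> smooth_on U (\<lambda>x. f (g x))"
  by (simp add: smooth_on_def Ck)

lemma (in bounded_bilinear) smooth_on:
  "open U \<Longrightarrow> smooth_on U f \<Longrightarrow> smooth_on U g \<Longrightarrow> smooth_on U (\<lambda>x. prod (f x) (g x))"
  by (simp add: smooth_on_def Ck)

lemmas smooth_on_mult = bounded_bilinear.smooth_on[OF bounded_bilinear_mult]
lemmas smooth_on_scaleR = bounded_bilinear.smooth_on[OF bounded_bilinear_scaleR]
lemmas smooth_on_of_real = bounded_linear.smooth_on[OF bounded_linear_of_real]

lemma smooth_on_minus: "open U \<Longrightarrow> smooth_on U f \<Longrightarrow> smooth_on U (\<lambda>x. - f x)"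
  using bounded_linear.smooth_on[OF bounded_linear_minus[OF bounded_linear_ident]] .

lemma smooth_on_diff:
  "open U \<Longrightarrow> smooth_on U f \<Longrightarrow> smooth_on U g \<Longrightarrow> smooth_on U (\<lambda>x. f x - g x)"
  using smooth_on_add[of U f "\<lambda>x. - g x"] smooth_on_minus by force

lemma smooth_on_power:
  fixes f :: "'a::real_normed_vector \<Rightarrow> 'b::real_normed_algebra_1"
  shows "open U \<Longrightarrow> smooth_on U f \<Longrightarrow> smooth_on U (\<lambda>x. f x ^ n)"
  by (induction n) (auto intro: smooth_on_const smooth_on_mult)

lemma smooth_on_ident: "open U \<Longrightarrow> smooth_on U (\<lambda>x. x)"
  unfolding smooth_on_def
proof
  fix k assume U: "open U"
  show "Ck k U (\<lambda>x. x)"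
  proof (cases k)
    case (Suc n)
    show ?thesis unfolding Suc
      by (rule Ck_SucI[OF U, where f' = "\<lambda>x v. v"]) (auto intro: Ck_const[OF U])
  qed (simp add: continuous_on_id)
qed

lemma smooth_on_linear: "open U \<Longrightarrow> bounded_linear f \<Longrightarrow> smooth_on U f"
  using bounded_linear.smooth_on[OF _ _ smooth_on_ident] by blast

lemma smooth_on_subset:
  assumes "smooth_on U f" "open U" "open V" "V \<subseteq> U"
  shows "smooth_on V f"
proof -
  have "Ck k U f \<Longrightarrow> Ck k V f" for k and f :: "'a \<Rightarrow> 'b"
    by (induction k arbitrary: f)
       (use assms in \<open>auto intro: continuous_on_subset differentiable_on_subset\<close>)
  with assms show ?thesis by (auto simp: smooth_on_def)
qed

text \<open>The induction varies \<open>F\<close> and keeps \<open>\<phi>\<close>: expanding the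
  chain rule in a basis of the middle space leaves scalar functions built from
  \<open>\<phi>\<close>, times first derivatives of \<open>F\<close> taken along
  \<open>\<phi>\<close>, which are one order lower. This is why the middle space is
  Euclidean.\<close>

lemma Ck_compose:
  fixes \<phi> :: "'a::real_normed_vector \<Rightarrow> 'c::euclidean_space" and F :: "'c \<Rightarrow> 'b::real_normed_vector"
  assumes V: "open V" and W: "open W" and \<phi>: "smooth_on V \<phi>" "\<phi> ` V \<subseteq> W"
  shows "Ck k W F \<Longrightarrow> Ck k V (\<lambda>x. F (\<phi> x))"
proof (induction k arbitrary: F)
  case 0
  then show ?case
    using continuous_on_compose2[of W F V \<phi>] smooth_on_continuous[OF \<phi>(1)] \<phi>(2) by simp
next
  case (Suc k)
  let ?g = "\<lambda>x v. \<Sum>b\<in>Basis. (frechet_derivative \<phi> (at x) v \<bullet> b) *\<^sub>R frechet_derivative F (at (\<phi> x)) b"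
  show ?case
  proof (rule Ck_SucI[OF V, where f' = ?g])
    fix x assume x: "x \<in> V"
    then have x': "\<phi> x \<in> W" using \<phi>(2) by blast
    have dF: "(F has_derivative frechet_derivative F (at (\<phi> x))) (at (\<phi> x))"
      by (rule Ck_derivative[OF W Suc.prems x'])
    have lin: "linear (frechet_derivative F (at (\<phi> x)))"
      using dF by (rule has_derivative_linear)
    have "frechet_derivative F (at (\<phi> x)) w
        = (\<Sum>b\<in>Basis. (w \<bullet> b) *\<^sub>R frechet_derivative F (at (\<phi> x)) b)" for w
    proof -
      have "frechet_derivative F (at (\<phi> x)) w
          = frechet_derivative F (at (\<phi> x)) (\<Sum>b\<in>Basis. (w \<bullet> b) *\<^sub>R b)"
        by (simp only: euclidean_representation)
      also have "\<dots> = (\<Sum>b\<in>Basis. (w \<bullet> b) *\<^sub>R frechet_derivative F (at (\<phi> x)) b)"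
        by (simp only: linear_sum[OF lin] linear_scale[OF lin])
      finally show ?thesis .
    qed
    then have eq: "(\<lambda>v. frechet_derivative F (at (\<phi> x)) (frechet_derivative \<phi> (at x) v)) = ?g x"
      by (rule ext)
    show "((\<lambda>x. F (\<phi> x)) has_derivative ?g x) (at x)"
      using has_derivative_compose[OF smooth_on_derivative[OF V \<phi>(1) x] dF] unfolding eq .
  next
    fix v
    have 1: "smooth_on V (\<lambda>x. frechet_derivative \<phi> (at x) v \<bullet> b)" for b
      by (rule bounded_linear.smooth_on[OF bounded_linear_inner_left V smooth_on_frechet[OF \<phi>(1)]])
    show "Ck k V (\<lambda>x. ?g x v)"
      using Suc.prems
      by (intro Ck_sum[OF V] bounded_bilinear.Ck[OF bounded_bilinear_scaleR V] Suc.IH smooth_onD[OF 1]) auto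
  qed
qed

lemma smooth_on_compose:
  fixes \<phi> :: "'a::real_normed_vector \<Rightarrow> 'c::euclidean_space"
  assumes "open V" "open W" "smooth_on V \<phi>" "\<phi> ` V \<subseteq> W" "smooth_on W F"
  shows "smooth_on V (\<lambda>x. F (\<phi> x))"
  using Ck_compose[OF assms(1-4), of _ F] assms(5) by (simp add: smooth_on_def)

lemma smooth_on_componentwise:
  fixes \<phi> :: "'a::real_normed_vector \<Rightarrow> 'c::euclidean_space"
  assumes "open V" "\<And>b. b \<in> Basis \<Longrightarrow> smooth_on V (\<lambda>x. \<phi> x \<bullet> b)"
  shows "smooth_on V \<phi>"
proof -
  have "smooth_on V (\<lambda>x. \<Sum>b\<in>Basis. (\<phi> x \<bullet> b) *\<^sub>R b)"
    using assms by (intro smooth_on_sum smooth_on_scaleR smooth_on_const) auto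
  then show ?thesis by (simp add: euclidean_representation)
qed

text \<open>The second difference quotient is a value of either iterated derivative near \<open>x\<close>.\<close>

lemma second_difference_mvt:
  fixes f :: "'a::real_normed_vector \<Rightarrow> real"
  assumes U: "open U" and f: "smooth_on U f" and h: "0 < h"
    and inU: "\<And>s t. 0 \<le> s \<Longrightarrow> s \<le> h \<Longrightarrow> 0 \<le> t \<Longrightarrow> t \<le> h \<Longrightarrow> x + s *\<^sub>R u + t *\<^sub>R v \<in> U"
  shows "\<exists>s t. 0 \<le> s \<and> s \<le> h \<and> 0 \<le> t \<and> t \<le> h \<and>
    f (x + h *\<^sub>R u + h *\<^sub>R v) - f (x + h *\<^sub>R u) - f (x + h *\<^sub>R v) + f x =
     h * h * frechet_derivative (\<lambda>y. frechet_derivative f (at y) u) (at (x + s *\<^sub>R u + t *\<^sub>R v)) v"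
proof -
  let ?fu = "\<lambda>y. frechet_derivative f (at y) u"
  have lin: "linear (frechet_derivative g (at y))" if "smooth_on U g" "y \<in> U" for g :: "'a \<Rightarrow> real" and y
    using smooth_on_derivative[OF U that] by (rule has_derivative_linear)
  have du: "((\<lambda>s. f (x + s *\<^sub>R u + t *\<^sub>R v)) has_derivative
      (\<lambda>r. r * ?fu (x + s *\<^sub>R u + t *\<^sub>R v))) (at s within {0..h})"
    if "0 \<le> s" "s \<le> h" "0 \<le> t" "t \<le> h" for s t
  proof -
    have "((\<lambda>s. f (x + s *\<^sub>R u + t *\<^sub>R v)) has_derivative
      (\<lambda>r. frechet_derivative f (at (x + s *\<^sub>R u + t *\<^sub>R v)) (r *\<^sub>R u))) (at s within {0..h})"
      by (rule has_derivative_compose[where f = "\<lambda>s. x + s *\<^sub>R u + t *\<^sub>R v",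
            OF _ smooth_on_derivative[OF U f inU[OF that]]])
         (auto intro!: derivative_eq_intros)
    then show ?thesis using linear_scale[OF lin[OF f inU[OF that]]] by simp
  qed
  \<comment> \<open>The mean value theorem in \<open>s\<close>, applied to the difference of
    \<open>f\<close> on the two segments \<open>t = h\<close> and \<open>t = 0\<close>. Afterwards
    it is applied once more, in \<open>t\<close>, to the derivative along \<open>u\<close>.\<close>
  have "\<exists>s\<in>{0<..<h}. (f (x + h *\<^sub>R u + h *\<^sub>R v) - f (x + h *\<^sub>R u + 0 *\<^sub>R v)) - (f (x + 0 *\<^sub>R u + h *\<^sub>R v) - f (x + 0 *\<^sub>R u + 0 *\<^sub>R v))
     = (h - 0) * ?fu (x + s *\<^sub>R u + h *\<^sub>R v) - (h - 0) * ?fu (x + s *\<^sub>R u + 0 *\<^sub>R v)"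
    using h by (intro mvt_simple[OF h] has_derivative_diff du) auto
  then obtain s where s: "0 < s" "s < h" and s_eq:
    "f (x + h *\<^sub>R u + h *\<^sub>R v) - f (x + h *\<^sub>R u) - f (x + h *\<^sub>R v) + f x
     = h * (?fu (x + s *\<^sub>R u + h *\<^sub>R v) - ?fu (x + s *\<^sub>R u))"
    by (auto simp: algebra_simps)
  have dv: "((\<lambda>t. ?fu (x + s *\<^sub>R u + t *\<^sub>R v)) has_derivative
      (\<lambda>r. r * frechet_derivative ?fu (at (x + s *\<^sub>R u + t *\<^sub>R v)) v)) (at t within {0..h})"
    if "0 \<le> t" "t \<le> h" for t
  proof -
    have s': "0 \<le> s" "s \<le> h" using s by auto
    have "((\<lambda>t. ?fu (x + s *\<^sub>R u + t *\<^sub>R v)) has_derivative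
      (\<lambda>r. frechet_derivative ?fu (at (x + s *\<^sub>R u + t *\<^sub>R v)) (r *\<^sub>R v))) (at t within {0..h})"
      by (rule has_derivative_compose[where f = "\<lambda>t. x + s *\<^sub>R u + t *\<^sub>R v",
            OF _ smooth_on_derivative[OF U smooth_on_frechet[OF f] inU[OF s' that]]])
         (auto intro!: derivative_eq_intros)
    then show ?thesis using linear_scale[OF lin[OF smooth_on_frechet[OF f] inU[OF s' that]]] by simp
  qed
  obtain t where "0 < t" "t < h" "?fu (x + s *\<^sub>R u + h *\<^sub>R v) - ?fu (x + s *\<^sub>R u + 0 *\<^sub>R v)
     = (h - 0) * frechet_derivative ?fu (at (x + s *\<^sub>R u + t *\<^sub>R v)) v"
    using mvt_simple[OF h dv] by auto
  with s s_eq show ?thesis by (intro exI[of _ s] exI[of _ t]) auto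
qed

text \<open>The second difference is symmetric in \<open>u\<close> and \<open>v\<close>, so both
  iterated derivatives take a common value at points arbitrarily near \<open>x\<close>; continuity
  brings this to \<open>x\<close>.\<close>

lemma second_derivative_symmetric_real:
  fixes f :: "'a::real_normed_vector \<Rightarrow> real"
  assumes U: "open U" and f: "smooth_on U f" and x: "x \<in> U"
  shows "frechet_derivative (\<lambda>y. frechet_derivative f (at y) u) (at x) v
       = frechet_derivative (\<lambda>y. frechet_derivative f (at y) v) (at x) u"
proof -
  let ?fuv = "\<lambda>y. frechet_derivative (\<lambda>y. frechet_derivative f (at y) u) (at y) v"
  let ?fvu = "\<lambda>y. frechet_derivative (\<lambda>y. frechet_derivative f (at y) v) (at y) u"
  have cont: "isCont ?fuv x" "isCont ?fvu x"
    using smooth_on_continuous[OF smooth_on_frechet[OF smooth_on_frechet[OF f]]] U x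
    by (simp_all add: continuous_on_eq_continuous_at)
  have "\<bar>?fuv x - ?fvu x\<bar> < e" if e: "0 < e" for e
  proof -
    obtain d1 where d1: "0 < d1" "\<And>y. dist y x < d1 \<Longrightarrow> dist (?fuv y) (?fuv x) < e / 2"
      using cont(1) e unfolding continuous_at_eps_delta by (metis half_gt_zero)
    obtain d2 where d2: "0 < d2" "\<And>y. dist y x < d2 \<Longrightarrow> dist (?fvu y) (?fvu x) < e / 2"
      using cont(2) e unfolding continuous_at_eps_delta by (metis half_gt_zero)
    obtain d3 where d3: "0 < d3" "\<And>y. dist y x < d3 \<Longrightarrow> y \<in> U"
      using U x by (metis open_dist)
    define d where "d = min d1 (min d2 d3)"
    have d: "0 < d" using d1 d2 d3 by (simp add: d_def)
    \<comment> \<open>Chosen so that the whole parallelogram with sides \<open>h u\<close> and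
      \<open>h v\<close> lies within distance \<open>d\<close> of \<open>x\<close>; the summand 1
      keeps the denominator positive when both vectors are zero.\<close>
    define h where "h = d / (2 * (norm u + norm v + 1))"
    have pos: "0 < norm u + norm v + 1" using norm_ge_zero[of u] norm_ge_zero[of v] by linarith
    have h: "0 < h" using d pos by (simp add: h_def)
    have close: "dist (x + s *\<^sub>R u + t *\<^sub>R v) x < d" if "0 \<le> s" "s \<le> h" "0 \<le> t" "t \<le> h" for s t
    proof -
      have "dist (x + s *\<^sub>R u + t *\<^sub>R v) x = norm (s *\<^sub>R u + t *\<^sub>R v)"
        by (simp add: dist_norm algebra_simps)
      also have "\<dots> \<le> s * norm u + t * norm v"
        using norm_triangle_ineq[of "s *\<^sub>R u" "t *\<^sub>R v"] that by simp
      also have "\<dots> \<le> h * norm u + h * norm v"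
        using that by (intro add_mono mult_right_mono) auto
      also have "\<dots> \<le> h * (norm u + norm v + 1)" using h by (simp add: algebra_simps)
      also have "\<dots> = d / 2" using pos by (simp add: h_def field_simps)
      also have "\<dots> < d" using d by simp
      finally show ?thesis .
    qed
    have inU: "x + s *\<^sub>R u + t *\<^sub>R v \<in> U" if "0 \<le> s" "s \<le> h" "0 \<le> t" "t \<le> h" for s t
      using close[OF that] d3 by (simp add: d_def)
    have inU': "x + s *\<^sub>R v + t *\<^sub>R u \<in> U" if "0 \<le> s" "s \<le> h" "0 \<le> t" "t \<le> h" for s t
      using inU[OF that(3,4,1,2)] by (simp add: algebra_simps)
    obtain s t where st: "0 \<le> s" "s \<le> h" "0 \<le> t" "t \<le> h"
      "f (x + h *\<^sub>R u + h *\<^sub>R v) - f (x + h *\<^sub>R u) - f (x + h *\<^sub>R v) + f x = h * h * ?fuv (x + s *\<^sub>R u + t *\<^sub>R v)"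
      using second_difference_mvt[OF U f h inU] by blast
    obtain s' t' where st': "0 \<le> s'" "s' \<le> h" "0 \<le> t'" "t' \<le> h"
      "f (x + h *\<^sub>R v + h *\<^sub>R u) - f (x + h *\<^sub>R v) - f (x + h *\<^sub>R u) + f x = h * h * ?fvu (x + s' *\<^sub>R v + t' *\<^sub>R u)"
      using second_difference_mvt[OF U f h inU'] by blast
    have "h * h * ?fuv (x + s *\<^sub>R u + t *\<^sub>R v) = h * h * ?fvu (x + s' *\<^sub>R v + t' *\<^sub>R u)"
      using st(5) st'(5) by (simp add: algebra_simps)
    then have eq: "?fuv (x + s *\<^sub>R u + t *\<^sub>R v) = ?fvu (x + s' *\<^sub>R v + t' *\<^sub>R u)" using h by simp
    have "dist (x + s' *\<^sub>R v + t' *\<^sub>R u) x < d"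
      using close[OF st'(3,4,1,2)] by (simp add: algebra_simps)
    then have "dist (?fvu (x + s' *\<^sub>R v + t' *\<^sub>R u)) (?fvu x) < e / 2" using d2 by (simp add: d_def)
    moreover have "dist (?fuv (x + s *\<^sub>R u + t *\<^sub>R v)) (?fuv x) < e / 2"
      using close[OF st(1-4)] d1 by (simp add: d_def)
    ultimately show ?thesis using eq unfolding dist_real_def by linarith
  qed
  from this[of "\<bar>?fuv x - ?fvu x\<bar>"] show ?thesis by auto
qed

lemma second_derivative_symmetric:
  fixes f :: "'a::real_normed_vector \<Rightarrow> 'b::euclidean_space"
  assumes U: "open U" and f: "smooth_on U f" and x: "x \<in> U"
  shows "frechet_derivative (\<lambda>y. frechet_derivative f (at y) u) (at x) v
       = frechet_derivative (\<lambda>y. frechet_derivative f (at y) v) (at x) u"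
proof (rule euclidean_eqI)
  fix b :: 'b assume "b \<in> Basis"
  have bl: "bounded_linear (\<lambda>z::'b. z \<bullet> b)" by (rule bounded_linear_inner_left)
  have comp: "frechet_derivative (\<lambda>y. g y \<bullet> b) (at y) w = frechet_derivative g (at y) w \<bullet> b"
    if "smooth_on U g" "y \<in> U" for g :: "'a \<Rightarrow> 'b" and y w
    using frechet_derivative_at[OF bounded_linear.has_derivative[OF bl smooth_on_derivative[OF U that]]]
    by metis
  have comp2: "frechet_derivative (\<lambda>y. frechet_derivative f (at y) u) (at x) v \<bullet> b =
    frechet_derivative (\<lambda>y. frechet_derivative (\<lambda>y. f y \<bullet> b) (at y) u) (at x) v" for u v
  proof -
    have sm: "smooth_on U (\<lambda>y. frechet_derivative f (at y) u)" by (rule smooth_on_frechet[OF f])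
    have "frechet_derivative (\<lambda>y. frechet_derivative f (at y) u \<bullet> b) (at x) =
        frechet_derivative (\<lambda>y. frechet_derivative (\<lambda>y. f y \<bullet> b) (at y) u) (at x)"
      by (rule frechet_derivative_transform_within_open[OF _ U x])
         (use comp[OF f] smooth_on_differentiable[OF U bounded_linear.smooth_on[OF bl U sm] x] in auto)
    then show ?thesis using comp[OF sm x] by metis
  qed
  show "frechet_derivative (\<lambda>y. frechet_derivative f (at y) u) (at x) v \<bullet> b =
      frechet_derivative (\<lambda>y. frechet_derivative f (at y) v) (at x) u \<bullet> b"
    unfolding comp2
    by (rule second_derivative_symmetric_real[OF U bounded_linear.smooth_on[OF bl U f] x])
qed

text \<open>A vector field as a derivation. The values of \<open>F\<close> lie in any normed space,
  so that a field can also be differentiated along another field, as in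
  \<open>along a b\<close>.\<close>

definition along :: "('a::real_normed_vector \<Rightarrow> 'a) \<Rightarrow> ('a \<Rightarrow> 'b::real_normed_vector) \<Rightarrow> 'a \<Rightarrow> 'b" where
  "along a F x = frechet_derivative F (at x) (a x)"

lemma along_expand:
  fixes a :: "'a::euclidean_space \<Rightarrow> 'a"
  assumes "open U" "smooth_on U F" "x \<in> U"
  shows "along a F x = (\<Sum>b\<in>Basis. (a x \<bullet> b) *\<^sub>R frechet_derivative F (at x) b)"
proof -
  have lin: "linear (frechet_derivative F (at x))"
    by (rule has_derivative_linear[OF smooth_on_derivative[OF assms]])
  have "along a F x = frechet_derivative F (at x) (\<Sum>b\<in>Basis. (a x \<bullet> b) *\<^sub>R b)"
    by (simp only: along_def euclidean_representation)
  then show ?thesis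
    by (simp only: linear_sum[OF lin] linear_scale[OF lin])
qed

lemma smooth_on_along:
  fixes a :: "'a::euclidean_space \<Rightarrow> 'a"
  assumes U: "open U" and F: "smooth_on U F" and a: "smooth_on U a"
  shows "smooth_on U (along a F)"
proof -
  have "smooth_on U (\<lambda>x. \<Sum>b\<in>Basis. (a x \<bullet> b) *\<^sub>R frechet_derivative F (at x) b)"
    by (intro smooth_on_sum[OF U] smooth_on_scaleR[OF U] smooth_on_frechet[OF F]
        bounded_linear.smooth_on[OF bounded_linear_inner_left U a]) auto
  then show ?thesis
    using smooth_on_cong[OF U along_expand[OF U F]] by fast
qed

text \<open>Each product of two fields is a first-order term plus a double sum of second derivatives
  (\<open>main\<close>); by the symmetry of second derivatives the double sums cancel.\<close>

lemma along_bracket: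
  fixes a b :: "'a::euclidean_space \<Rightarrow> 'a" and F :: "'a \<Rightarrow> 'b::euclidean_space"
  assumes U: "open U" and F: "smooth_on U F" and a: "smooth_on U a" and b: "smooth_on U b" and x: "x \<in> U"
  shows "along a (along b F) x - along b (along a F) x
    = frechet_derivative F (at x) (along a b x - along b a x)"
proof -
  let ?D = "\<lambda>G x. frechet_derivative G (at x)"
  have lin: "linear (?D F x)"
    using has_derivative_linear[OF smooth_on_derivative[OF U F x]] .
  have main: "along a (along b F) x = ?D F x (along a b x)
       + (\<Sum>i\<in>Basis. \<Sum>j\<in>Basis. (b x \<bullet> i) *\<^sub>R (a x \<bullet> j) *\<^sub>R ?D (\<lambda>y. ?D F y i) x j)"
    if a: "smooth_on U a" and b: "smooth_on U b" for a b
  proof -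
    have "((\<lambda>x. \<Sum>i\<in>Basis. (b x \<bullet> i) *\<^sub>R ?D F x i) has_derivative
       (\<lambda>w. \<Sum>i\<in>Basis. (b x \<bullet> i) *\<^sub>R ?D (\<lambda>y. ?D F y i) x w + (?D b x w \<bullet> i) *\<^sub>R ?D F x i)) (at x)"
      by (intro has_derivative_sum has_derivative_scaleR has_derivative_inner_left
          smooth_on_derivative[OF U _ x] b smooth_on_frechet[OF F])
    then have 1: "(along b F has_derivative
       (\<lambda>w. \<Sum>i\<in>Basis. (b x \<bullet> i) *\<^sub>R ?D (\<lambda>y. ?D F y i) x w + (?D b x w \<bullet> i) *\<^sub>R ?D F x i)) (at x)"
      by (rule has_derivative_transform_within_open[OF _ U x]) (rule along_expand[OF U F, symmetric])
    have "along a (along b F) x =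
        (\<Sum>i\<in>Basis. (b x \<bullet> i) *\<^sub>R ?D (\<lambda>y. ?D F y i) x (a x)) + (\<Sum>i\<in>Basis. (along a b x \<bullet> i) *\<^sub>R ?D F x i)"
      unfolding along_def[of a "along b F"] frechet_derivative_at[OF 1, symmetric]
      by (simp add: sum.distrib along_def)
    also have "(\<Sum>i\<in>Basis. (along a b x \<bullet> i) *\<^sub>R ?D F x i) = ?D F x (along a b x)"
      using along_expand[OF U F x, of "\<lambda>_. along a b x"] by (simp add: along_def[of _ F])
    also have "(\<Sum>i\<in>Basis. (b x \<bullet> i) *\<^sub>R ?D (\<lambda>y. ?D F y i) x (a x)) =
       (\<Sum>i\<in>Basis. \<Sum>j\<in>Basis. (b x \<bullet> i) *\<^sub>R (a x \<bullet> j) *\<^sub>R ?D (\<lambda>y. ?D F y i) x j)"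
      using along_expand[OF U smooth_on_frechet[OF F] x, of a]
      by (simp add: along_def scaleR_sum_right)
    finally show ?thesis by (simp add: add.commute)
  qed
  have "(\<Sum>i\<in>Basis. \<Sum>j\<in>Basis. (b x \<bullet> i) *\<^sub>R (a x \<bullet> j) *\<^sub>R ?D (\<lambda>y. ?D F y i) x j)
     = (\<Sum>j\<in>Basis. \<Sum>i\<in>Basis. (a x \<bullet> j) *\<^sub>R (b x \<bullet> i) *\<^sub>R ?D (\<lambda>y. ?D F y j) x i)"
    by (subst sum.swap) (simp add: second_derivative_symmetric[OF U F x] mult.commute)
  then show ?thesis
    unfolding main[OF a b] main[OF b a] using linear_diff[OF lin] by simp
qed

section \<open>Commutation relations\<close>

text \<open>The commutation calculus is carried out over an abstract complex space because it is
  used twice: for functions of the cell coordinates and for functions on the group.\<close>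

locale cvec = vector_space scale
  for scale :: "complex \<Rightarrow> 'v::ab_group_add \<Rightarrow> 'v" (infixr \<open>\<cdot>\<close> 75)
begin

text \<open>Linearity is only claimed on \<open>S\<close>: the derivatives to which this applies
  behave linearly on smooth functions and are arbitrary choices elsewhere.\<close>

definition lin_op :: "'v set \<Rightarrow> ('v \<Rightarrow> 'v) \<Rightarrow> bool" where
  "lin_op S T \<longleftrightarrow> (\<forall>f\<in>S. T f \<in> S) \<and> (\<forall>f\<in>S. \<forall>g\<in>S. T (f + g) = T f + T g) \<and>
     (\<forall>c. \<forall>f\<in>S. T (c \<cdot> f) = c \<cdot> T f)"

lemma lin_opD:
  assumes "lin_op S T"
  shows "f \<in> S \<Longrightarrow> T f \<in> S" "f \<in> S \<Longrightarrow> g \<in> S \<Longrightarrow> T (f + g) = T f + T g"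
    "f \<in> S \<Longrightarrow> T (c \<cdot> f) = c \<cdot> T f"
  using assms by (auto simp: lin_op_def)

lemma lin_op_zero: "subspace S \<Longrightarrow> lin_op S T \<Longrightarrow> T 0 = 0"
  using lin_opD(2)[of S T 0 0] subspace_0[of S] by simp

lemma lin_op_uminus: "lin_op S T \<Longrightarrow> f \<in> S \<Longrightarrow> T (- f) = - T f"
  using lin_opD(3)[of S T f "-1"] by simp

lemma lin_op_sum:
  assumes "subspace S" "lin_op S T"
  shows "(\<And>i. i \<in> I \<Longrightarrow> f i \<in> S) \<Longrightarrow> T (\<Sum>i\<in>I. f i) = (\<Sum>i\<in>I. T (f i))"
proof (induction I rule: infinite_finite_induct)
  case (insert i I)
  then show ?case using subspace_sum[OF assms(1), of I f] by (simp add: lin_opD[OF assms(2)])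
qed (auto simp: lin_op_zero[OF assms])

lemma lin_op_sum_scale:
  assumes "subspace S" "lin_op S T" "\<And>i. i \<in> I \<Longrightarrow> f i \<in> S"
  shows "T (\<Sum>i\<in>I. c i \<cdot> f i) = (\<Sum>i\<in>I. c i \<cdot> T (f i))"
  using lin_op_sum[OF assms(1,2), of I "\<lambda>i. c i \<cdot> f i"] assms by (simp add: lin_opD subspace_scale)

lemma lin_op_comp: "lin_op S T \<Longrightarrow> lin_op S T' \<Longrightarrow> lin_op S (\<lambda>f. T (T' f))"
  by (auto simp: lin_op_def)

lemma lin_op_funpow: "lin_op S T \<Longrightarrow> lin_op S (T ^^ n)"
  by (induction n) (auto simp: lin_op_def)

text \<open>Reindexing for the term by which a root vector consumes a \<open>Z\<close>. The first
  assumption removes n = 0; the support condition makes the boundary index m = l harmless, so that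
  the range agrees with that of the other term of the recursion.\<close>

lemma sum_shift_supported:
  assumes d: "d 0 = 0" "\<And>n. n > min k l \<Longrightarrow> d n = 0" and R: "\<And>m. m < k \<Longrightarrow> m < l \<Longrightarrow> R (Suc m) = R' m"
  shows "(\<Sum>n\<le>min k l. d n \<cdot> R n) = (\<Sum>m | m < k \<and> m \<le> l. d (Suc m) \<cdot> R' m)"
proof -
  have "(\<Sum>n\<le>min k l. d n \<cdot> R n) = (\<Sum>n\<in>Suc ` {m. m < k \<and> m < l}. d n \<cdot> R n)"
  proof (rule sum.mono_neutral_right)
    show "\<forall>n\<in>{..min k l} - Suc ` {m. m < k \<and> m < l}. d n \<cdot> R n = 0"
    proof
      fix n assume n: "n \<in> {..min k l} - Suc ` {m. m < k \<and> m < l}"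
      have "n = 0"
      proof (rule ccontr)
        assume "n \<noteq> 0"
        then have "n = Suc (n - 1)" "n - 1 < k" "n - 1 < l" using n by auto
        then show False using n by blast
      qed
      then show "d n \<cdot> R n = 0" by (simp add: d(1))
    qed
  qed auto
  also have "\<dots> = (\<Sum>m | m < k \<and> m < l. d (Suc m) \<cdot> R' m)"
    by (subst sum.reindex) (auto intro!: sum.cong simp: R)
  also have "\<dots> = (\<Sum>m | m < k \<and> m \<le> l. d (Suc m) \<cdot> R' m)"
  proof (rule sum.mono_neutral_left)
    show "finite {m. m < k \<and> m \<le> l}" by (rule finite_subset[of _ "{..<k}"]) auto
    show "\<forall>i\<in>{m. m < k \<and> m \<le> l} - {m. m < k \<and> m < l}. d (Suc i) \<cdot> R' i = 0"
    proof
      fix i assume "i \<in> {m. m < k \<and> m \<le> l} - {m. m < k \<and> m < l}"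
      then have "d (Suc i) = 0" by (intro d(2)) auto
      then show "d (Suc i) \<cdot> R' i = 0" by simp
    qed
  qed auto
  finally show ?thesis .
qed

lemma lin_op_scale: "subspace S \<Longrightarrow> lin_op S T \<Longrightarrow> lin_op S (\<lambda>f. c \<cdot> T f)"
  by (auto simp: lin_op_def subspace_scale algebra_simps)

lemma funpow_commute:
  assumes "lin_op S A" "lin_op S T" "\<And>f. f \<in> S \<Longrightarrow> A (T f) = T (A f)" "f \<in> S"
  shows "A ((T ^^ n) f) = (T ^^ n) (A f)"
  by (induction n) (simp_all add: assms lin_opD(1)[OF lin_op_funpow[OF assms(2)]])

text \<open>The commutator with \<open>A\<close> is a derivation sending \<open>T\<close> to
  \<open>B\<close>, and \<open>B\<close> commutes with \<open>T\<close>. For n = 0 the truncated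
  exponent \<open>n - 1\<close> is multiplied by zero.\<close>

lemma funpow_central_commutator:
  assumes S: "subspace S" and A: "lin_op S A" and T: "lin_op S T" and B: "lin_op S B"
    and AT: "\<And>f. f \<in> S \<Longrightarrow> A (T f) = T (A f) + B f"
    and BT: "\<And>f. f \<in> S \<Longrightarrow> B (T f) = T (B f)" and f: "f \<in> S"
  shows "A ((T ^^ n) f) = (T ^^ n) (A f) + (of_nat n) \<cdot> (T ^^ (n - 1)) (B f)"
proof (induction n)
  case 0
  then show ?case by (simp)
next
  case (Suc n)
  have mem: "(T ^^ m) f \<in> S" "(T ^^ m) (A f) \<in> S" "(T ^^ m) (B f) \<in> S" for m
    using lin_opD(1)[OF lin_op_funpow[OF T]] lin_opD(1)[OF A f] lin_opD(1)[OF B f] f by auto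
  have shift: "(of_nat n) \<cdot> T ((T ^^ (n - 1)) (B f)) = (of_nat n) \<cdot> (T ^^ n) (B f)"
    by (cases n) (auto simp: algebra_simps)
  have "A ((T ^^ Suc n) f) = T (A ((T ^^ n) f)) + B ((T ^^ n) f)"
    by (simp add: AT mem)
  also have "\<dots> = T ((T ^^ n) (A f)) + (of_nat n) \<cdot> (T ^^ n) (B f) + (T ^^ n) (B f)"
    using shift funpow_commute[OF B T BT f, of n]
    by (simp only: Suc.IH lin_opD[OF T] subspace_scale[OF S] subspace_add[OF S] mem)
  finally show ?case by (simp add: algebra_simps)
qed

lemma funpow_eigen_shift:
  assumes S: "subspace S" and A: "lin_op S A" and T: "lin_op S T"
    and AT: "\<And>f. f \<in> S \<Longrightarrow> A (T f) = T (A f) + c \<cdot> T f" and f: "f \<in> S"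
  shows "A ((T ^^ n) f) = (T ^^ n) (A f) + (c * of_nat n) \<cdot> (T ^^ n) f"
proof (induction n)
  case 0
  then show ?case by (simp)
next
  case (Suc n)
  have mem: "(T ^^ m) f \<in> S" "(T ^^ m) (A f) \<in> S" for m
    using lin_opD(1)[OF lin_op_funpow[OF T]] lin_opD(1)[OF A f] f by auto
  have "A ((T ^^ Suc n) f) = T (A ((T ^^ n) f)) + c \<cdot> T ((T ^^ n) f)"
    by (simp add: AT mem)
  also have "\<dots> = T ((T ^^ n) (A f)) + (c * of_nat n) \<cdot> T ((T ^^ n) f) + c \<cdot> T ((T ^^ n) f)"
    unfolding Suc.IH by (simp add: lin_opD[OF T] subspace_scale[OF S] mem)
  finally show ?case by (simp add: algebra_simps)
qed

text \<open>Moving \<open>H\<close> past the j-th power of \<open>T\<close> costs -2j; summed over j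
  < n this gives the term -n(n - 1).\<close>

lemma funpow_sl2:
  assumes S: "subspace S" and E: "lin_op S E" and T: "lin_op S T" and H: "lin_op S H"
    and ET: "\<And>f. f \<in> S \<Longrightarrow> E (T f) = T (E f) + H f"
    and HT: "\<And>f. f \<in> S \<Longrightarrow> H (T f) = T (H f) + (-2) \<cdot> T f" and f: "f \<in> S"
  shows "E ((T ^^ n) f) = (T ^^ n) (E f) + (of_nat n) \<cdot> (T ^^ (n - 1)) (H f)
     + (- of_nat n * (of_nat n - 1)) \<cdot> (T ^^ (n - 1)) f"
proof (induction n)
  case 0
  then show ?case by (simp)
next
  case (Suc n)
  have mem: "(T ^^ m) f \<in> S" "(T ^^ m) (E f) \<in> S" "(T ^^ m) (H f) \<in> S" for m
    using lin_opD(1)[OF lin_op_funpow[OF T]] lin_opD(1)[OF E f] lin_opD(1)[OF H f] f by auto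
  have shift: "(of_nat n * c) \<cdot> T ((T ^^ (n - 1)) g) = (of_nat n * c) \<cdot> (T ^^ n) g" for c g
    by (cases n) (auto simp: algebra_simps)
  have shift1: "(of_nat n) \<cdot> T ((T ^^ (n - 1)) g) = (of_nat n) \<cdot> (T ^^ n) g" for g
    using shift[of 1] by simp
  have shift2: "(- of_nat n * (of_nat n - 1)) \<cdot> T ((T ^^ (n - 1)) g)
     = (- of_nat n * (of_nat n - 1)) \<cdot> (T ^^ n) g" for g
    using shift[of "- (of_nat n - 1)"] by simp
  have "E ((T ^^ Suc n) f) = T (E ((T ^^ n) f)) + H ((T ^^ n) f)"
    by (simp add: ET mem)
  also have "\<dots> = T ((T ^^ n) (E f)) + (of_nat n) \<cdot> (T ^^ n) (H f)
     + (- of_nat n * (of_nat n - 1)) \<cdot> (T ^^ n) f + ((T ^^ n) (H f) + (-2 * of_nat n) \<cdot> (T ^^ n) f)"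
    using funpow_eigen_shift[OF S H T HT f, of n]
    by (simp only: Suc.IH lin_opD[OF T] subspace_scale[OF S] subspace_add[OF S] mem shift1 shift2)
  finally have *: "E ((T ^^ Suc n) f) = \<dots>" .
  have coeff: "- of_nat (Suc n) * (of_nat (Suc n) - 1 :: complex)
      = - of_nat n * (of_nat n - 1) + (-2 * of_nat n)"
    by (simp add: algebra_simps)
  show ?case
    unfolding * coeff unfolding scale_left_distrib of_nat_Suc by (simp add: add_ac)
qed

definition pbw :: "('v \<Rightarrow> 'v) \<Rightarrow> ('v \<Rightarrow> 'v) \<Rightarrow> ('v \<Rightarrow> 'v) \<Rightarrow> nat \<Rightarrow> nat \<Rightarrow> nat \<Rightarrow> 'v \<Rightarrow> 'v" where
  "pbw X Y Z i j k f = (X ^^ i) ((Y ^^ j) ((Z ^^ k) f))"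

end

section \<open>Normal ordering in the Heisenberg algebra\<close>

locale heisenberg = cvec scale
  for scale :: "complex \<Rightarrow> 'v::ab_group_add \<Rightarrow> 'v" (infixr \<open>\<cdot>\<close> 75) +
  fixes S :: "'v set" and X Y Z :: "'v \<Rightarrow> 'v"
  assumes S: "subspace S" and X: "lin_op S X" and Y: "lin_op S Y" and Z: "lin_op S Z"
    and YX: "f \<in> S \<Longrightarrow> Y (X f) = X (Y f) + Z f"
    and ZX: "f \<in> S \<Longrightarrow> Z (X f) = X (Z f)"
    and ZY: "f \<in> S \<Longrightarrow> Z (Y f) = Y (Z f)"
begin

lemma pow_closed:
  "f \<in> S \<Longrightarrow> (X ^^ n) f \<in> S" "f \<in> S \<Longrightarrow> (Y ^^ n) f \<in> S" "f \<in> S \<Longrightarrow> (Z ^^ n) f \<in> S"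
  by (simp_all add: lin_opD(1)[OF lin_op_funpow[OF X]] lin_opD(1)[OF lin_op_funpow[OF Y]]
      lin_opD(1)[OF lin_op_funpow[OF Z]])

lemma lin_op_pbw: "lin_op S (pbw X Y Z i j k)"
  unfolding pbw_def
  by (rule lin_op_comp[OF lin_op_funpow[OF X] lin_op_comp[OF lin_op_funpow[OF Y] lin_op_funpow[OF Z]]])

lemma pbw_closed: "f \<in> S \<Longrightarrow> pbw X Y Z i j k f \<in> S"
  using lin_opD(1)[OF lin_op_pbw] .

lemma X_pbw: "X (pbw X Y Z i j k f) = pbw X Y Z (Suc i) j k f"
  by (simp add: pbw_def)

lemma Y_Xpow: "f \<in> S \<Longrightarrow> Y ((X ^^ n) f) = (X ^^ n) (Y f) + (of_nat n) \<cdot> (X ^^ (n - 1)) (Z f)"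
  by (rule funpow_central_commutator[OF S Y X Z YX ZX])

lemma Z_Xpow: "f \<in> S \<Longrightarrow> Z ((X ^^ n) f) = (X ^^ n) (Z f)"
  by (rule funpow_commute[OF Z X ZX])

lemma Z_Ypow: "f \<in> S \<Longrightarrow> Z ((Y ^^ n) f) = (Y ^^ n) (Z f)"
  by (rule funpow_commute[OF Z Y ZY])

lemma Z_pbw: "f \<in> S \<Longrightarrow> Z (pbw X Y Z i j k f) = pbw X Y Z i j (Suc k) f"
  by (simp add: pbw_def Z_Xpow Z_Ypow pow_closed)

lemma Y_pbw:
  "f \<in> S \<Longrightarrow> Y (pbw X Y Z i j k f)
     = pbw X Y Z i (Suc j) k f + (of_nat i) \<cdot> pbw X Y Z (i - 1) j (Suc k) f"
  by (simp add: pbw_def Y_Xpow Z_Ypow pow_closed)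

lemma X_Ypow: "f \<in> S \<Longrightarrow> (Y ^^ n) (X f) = X ((Y ^^ n) f) + (of_nat n) \<cdot> (Y ^^ (n - 1)) (Z f)"
proof -
  assume f: "f \<in> S"
  have "X ((Y ^^ n) f) = (Y ^^ n) (X f) + (of_nat n) \<cdot> (Y ^^ (n - 1)) ((-1) \<cdot> Z f)"
    by (rule funpow_central_commutator[OF S X Y lin_op_scale[OF S Z] _ _ f, of "-1"])
       (simp_all add: YX ZY lin_opD[OF Y] lin_opD(1)[OF Z] lin_op_uminus[OF Y])
  then show ?thesis
    using f by (simp add: lin_opD[OF lin_op_funpow[OF Y]] lin_opD(1)[OF Z] lin_op_uminus[OF lin_op_funpow[OF Y]])
qed

definition nform :: "nat \<Rightarrow> nat \<Rightarrow> (nat \<Rightarrow> complex) \<Rightarrow> 'v \<Rightarrow> 'v" where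
  "nform k l a f = (\<Sum>n\<le>min k l. (a n) \<cdot> pbw X Y Z (k - n) (l - n) n f)"

lemma nform_closed: "f \<in> S \<Longrightarrow> nform k l a f \<in> S"
  unfolding nform_def by (intro subspace_sum[OF S] subspace_scale[OF S] pbw_closed)

end

text \<open>The simple root vectors \<open>E\<close>, \<open>E'\<close> with coroots \<open>H\<close>, \<open>H'\<close> acting alongside \<open>X\<close>, \<open>Y\<close>, \<open>Z\<close>, which
  stand for the matrix units $E_{21}$, $E_{32}$, $E_{31}$.\<close>

locale sl3_ops = heisenberg scale S X Y Z
  for scale :: "complex \<Rightarrow> 'v::ab_group_add \<Rightarrow> 'v" (infixr \<open>\<cdot>\<close> 75) and S X Y Z +
  fixes E E' H H' :: "'v \<Rightarrow> 'v"
  assumes E: "lin_op S E" and E': "lin_op S E'" and H: "lin_op S H" and H': "lin_op S H'"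
    and EX: "f \<in> S \<Longrightarrow> E (X f) = X (E f) + H f"
    and EY: "f \<in> S \<Longrightarrow> E (Y f) = Y (E f)"
    and EZ: "f \<in> S \<Longrightarrow> E (Z f) = Z (E f) + (-1) \<cdot> Y f"
    and E'X: "f \<in> S \<Longrightarrow> E' (X f) = X (E' f)"
    and E'Y: "f \<in> S \<Longrightarrow> E' (Y f) = Y (E' f) + H' f"
    and E'Z: "f \<in> S \<Longrightarrow> E' (Z f) = Z (E' f) + X f"
    and HX: "f \<in> S \<Longrightarrow> H (X f) = X (H f) + (-2) \<cdot> X f"
    and HY: "f \<in> S \<Longrightarrow> H (Y f) = Y (H f) + 1 \<cdot> Y f"
    and HZ: "f \<in> S \<Longrightarrow> H (Z f) = Z (H f) + (-1) \<cdot> Z f"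
    and H'Y: "f \<in> S \<Longrightarrow> H' (Y f) = Y (H' f) + (-2) \<cdot> Y f"
    and H'Z: "f \<in> S \<Longrightarrow> H' (Z f) = Z (H' f) + (-1) \<cdot> Z f"
begin

section \<open>Simple root vectors acting on ordered monomials applied to a highest weight
  vector\<close>

context
  fixes f :: "'v" and l1 l2 :: complex
  assumes f: "f \<in> S" and Ef: "E f = 0" and E'f: "E' f = 0"
    and Hf: "H f = l1 \<cdot> f" and H'f: "H' f = l2 \<cdot> f"
begin

text \<open>\<open>E\<close> commutes with \<open>Y\<close>, turns a \<open>Z\<close> into
  \<open>-Y\<close> and meets the powers of \<open>X\<close> by the sl2 rule; l1 + q - r is the
  \<open>H\<close>-weight of the vector on which the power of \<open>X\<close> acts, and -p + 1 is
  the sl2 correction.\<close>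

lemma E_pbw:
  "E (pbw X Y Z p q r f) = (of_nat p * (l1 + of_nat q - of_nat r - of_nat p + 1)) \<cdot> pbw X Y Z (p - 1) q r f
      + (- of_nat r) \<cdot> pbw X Y Z p (Suc q) (r - 1) f"
proof -
  let ?z = "(Z ^^ r) f"
  let ?yz = "(Y ^^ q) ?z"
  note linX = lin_opD[OF lin_op_funpow[OF X]] lin_op_uminus[OF lin_op_funpow[OF X]] subspace_scale[OF S]
    and linY = lin_opD[OF lin_op_funpow[OF Y]] lin_op_uminus[OF lin_op_funpow[OF Y]] subspace_scale[OF S]
    and linZ = lin_opD[OF lin_op_funpow[OF Z]] lin_op_uminus[OF lin_op_funpow[OF Z]]
  have mem: "(Z ^^ n) f \<in> S" "(Y ^^ m) ((Z ^^ n) f) \<in> S" "(X ^^ i) ((Y ^^ m) ((Z ^^ n) f)) \<in> S" for n m i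
    using f by (simp_all add: pow_closed)
  have "E ?z = (Z ^^ r) (E f) + (of_nat r) \<cdot> (Z ^^ (r - 1)) ((-1) \<cdot> Y f)"
    by (rule funpow_central_commutator[OF S E Z lin_op_scale[OF S Y] _ _ f])
       (simp_all add: EZ ZY lin_opD[OF Y] lin_opD[OF Z] lin_op_uminus[OF Z])
  also have "\<dots> = (- of_nat r) \<cdot> Y ((Z ^^ (r - 1)) f)"
    using funpow_commute[OF Y Z ZY[symmetric] f, of "r - 1"] f
    by (simp add: Ef lin_op_zero[OF S lin_op_funpow[OF Z]] linZ lin_opD[OF Y] lin_op_uminus[OF lin_op_funpow[OF Z]])
  finally have Ez: "E ?z = \<dots>" .
  have Eyz: "E ?yz = (- of_nat r) \<cdot> (Y ^^ Suc q) ((Z ^^ (r - 1)) f)"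
    using funpow_commute[OF E Y EY mem(1)[of r], of q] f
    by (simp add: Ez linY pow_closed lin_opD(1)[OF Y] funpow_swap1)
  have Hz: "H ?z = (l1 - of_nat r) \<cdot> ?z"
    using funpow_eigen_shift[OF S H Z HZ f, of r] f by (simp add: Hf linZ algebra_simps)
  have "H ?yz = (Y ^^ q) ((l1 - of_nat r) \<cdot> ?z) + (1 * of_nat q) \<cdot> ?yz"
    using funpow_eigen_shift[OF S H Y HY mem(1)[of r], of q] by (simp only: Hz)
  also have "(Y ^^ q) ((l1 - of_nat r) \<cdot> ?z) = (l1 - of_nat r) \<cdot> ?yz"
    using mem by (simp add: linY)
  finally have Hyz: "H ?yz = (l1 - of_nat r + of_nat q) \<cdot> ?yz" by (simp add: algebra_simps)
  have e1: "(X ^^ p) (E ?yz) = (- of_nat r) \<cdot> (X ^^ p) ((Y ^^ Suc q) ((Z ^^ (r - 1)) f))"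
    unfolding Eyz by (rule linX(3)[OF mem(2)])
  have e2: "(X ^^ (p - 1)) (H ?yz) = (l1 - of_nat r + of_nat q) \<cdot> (X ^^ (p - 1)) ?yz"
    unfolding Hyz by (rule linX(3)[OF mem(2)])
  have e3: "E ((X ^^ p) ?yz) = (X ^^ p) (E ?yz) + of_nat p \<cdot> (X ^^ (p - 1)) (H ?yz)
      + (- of_nat p * (of_nat p - 1)) \<cdot> (X ^^ (p - 1)) ?yz"
    by (rule funpow_sl2[OF S E X H EX HX mem(2)])
  show ?thesis
    unfolding pbw_def e3 e1 e2 by (simp add: algebra_simps)
qed

text \<open>The \<open>X\<close> that \<open>E'\<close> makes out of a \<open>Z\<close> appears to
  the right of the power of \<open>Y\<close>. Moving it to the front gives q r times a monomial that
  cancels the contribution -r of the power of \<open>Z\<close> to the \<open>H'\<close>-weight;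
  hence, unlike in \<open>E_pbw\<close>, the first coefficient does not contain r.\<close>

lemma E'_pbw:
  "E' (pbw X Y Z p q r f) = (of_nat q * (l2 - of_nat q + 1)) \<cdot> pbw X Y Z p (q - 1) r f
      + (of_nat r) \<cdot> pbw X Y Z (Suc p) q (r - 1) f"
proof -
  let ?z = "(Z ^^ r) f"
  let ?yz = "(Y ^^ q) ?z"
  note linX = lin_opD[OF lin_op_funpow[OF X]] lin_op_uminus[OF lin_op_funpow[OF X]] subspace_scale[OF S]
    and linY = lin_opD[OF lin_op_funpow[OF Y]] lin_op_uminus[OF lin_op_funpow[OF Y]] subspace_scale[OF S]
    and linZ = lin_opD[OF lin_op_funpow[OF Z]] lin_op_uminus[OF lin_op_funpow[OF Z]]
  have mem: "(Z ^^ n) f \<in> S" "(Y ^^ m) ((Z ^^ n) f) \<in> S" "(X ^^ i) ((Y ^^ m) ((Z ^^ n) f)) \<in> S" for n m i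
    using f by (simp_all add: pow_closed)
  have "E' ?z = (Z ^^ r) (E' f) + (of_nat r) \<cdot> (Z ^^ (r - 1)) (X f)"
    by (rule funpow_central_commutator[OF S E' Z X _ _ f]) (simp_all add: E'Z ZX)
  also have "\<dots> = (of_nat r) \<cdot> X ((Z ^^ (r - 1)) f)"
    using funpow_commute[OF X Z ZX[symmetric] f, of "r - 1"] f
    by (simp add: E'f lin_op_zero[OF S lin_op_funpow[OF Z]])
  finally have E'z: "E' ?z = \<dots>" .
  have H'z: "H' ?z = (l2 - of_nat r) \<cdot> ?z"
    using funpow_eigen_shift[OF S H' Z H'Z f, of r] f by (simp add: H'f linZ algebra_simps)
  have step: "(of_nat r) \<cdot> (Y ^^ (q - 1)) (Z ((Z ^^ (r - 1)) f)) = (of_nat r) \<cdot> (Y ^^ (q - 1)) ?z"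
    by (cases r) (auto simp: algebra_simps)
  have "E' ?yz = (Y ^^ q) ((of_nat r) \<cdot> X ((Z ^^ (r - 1)) f)) + (of_nat q) \<cdot> (Y ^^ (q - 1)) ((l2 - of_nat r) \<cdot> ?z)
     + (- of_nat q * (of_nat q - 1)) \<cdot> (Y ^^ (q - 1)) ?z"
    using funpow_sl2[OF S E' Y H' E'Y H'Y mem(1)[of r], of q] by (simp only: E'z H'z)
  also have "(Y ^^ q) ((of_nat r) \<cdot> X ((Z ^^ (r - 1)) f))
      = (of_nat r) \<cdot> X ((Y ^^ q) ((Z ^^ (r - 1)) f)) + (of_nat q) \<cdot> ((of_nat r) \<cdot> (Y ^^ (q - 1)) (Z ((Z ^^ (r - 1)) f)))"
    using mem(1)[of "r - 1"] lin_opD(1)[OF X] by (simp add: linY X_Ypow algebra_simps)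
  also have "complex_of_nat q \<cdot> (Y ^^ (q - 1)) ((l2 - of_nat r) \<cdot> ?z)
      = (of_nat q * (l2 - of_nat r)) \<cdot> (Y ^^ (q - 1)) ?z"
    using mem by (simp add: linY)
  finally have E'yz: "E' ?yz = (of_nat r) \<cdot> X ((Y ^^ q) ((Z ^^ (r - 1)) f))
      + (of_nat q * (l2 - of_nat q + 1)) \<cdot> (Y ^^ (q - 1)) ?z"
    unfolding step by (simp add: algebra_simps)
  show ?thesis
    using funpow_commute[OF E' X E'X mem(2)[of q r], of p] mem lin_opD(1)[OF X]
    by (simp add: pbw_def E'yz linX subspace_scale[OF S] funpow_swap1 add.commute)
qed

text \<open>Singular vectors are the weight vectors for which all coefficients in the next two lemmas vanish.\<close>

lemma E_nform:
  assumes a: "\<And>n. n > min k l \<Longrightarrow> a n = 0"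
  shows "E (nform k l a f) = (\<Sum>m | m < k \<and> m \<le> l.
    (of_nat (k - m) * (l1 + of_nat l - of_nat k + 1 - of_nat m) * a m - of_nat (Suc m) * a (Suc m)) \<cdot> pbw X Y Z (k - 1 - m) (l - m) m f)"
proof -
  let ?P = "{m. m < k \<and> m \<le> l}"
  let ?b = "\<lambda>n. of_nat (k - n) * (l1 + of_nat l - of_nat k + 1 - of_nat n) * a n"
  have "E (nform k l a f) = (\<Sum>n\<le>min k l. (a n) \<cdot> E (pbw X Y Z (k - n) (l - n) n f))"
    unfolding nform_def by (rule lin_op_sum_scale[OF S E]) (simp add: pbw_closed f)
  also have "\<dots> = (\<Sum>n\<le>min k l. (?b n) \<cdot> pbw X Y Z (k - 1 - n) (l - n) n f
       + (- of_nat n * a n) \<cdot> pbw X Y Z (k - n) (Suc (l - n)) (n - 1) f)"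
    unfolding E_pbw by (intro sum.cong refl) (auto simp: of_nat_diff algebra_simps diff_right_commute)
  also have "\<dots> = (\<Sum>n\<le>min k l. (?b n) \<cdot> pbw X Y Z (k - 1 - n) (l - n) n f)
       + (\<Sum>n\<le>min k l. (- of_nat n * a n) \<cdot> pbw X Y Z (k - n) (Suc (l - n)) (n - 1) f)"
    by (rule sum.distrib)
  also have "(\<Sum>n\<le>min k l. (?b n) \<cdot> pbw X Y Z (k - 1 - n) (l - n) n f)
     = (\<Sum>n\<in>?P. (?b n) \<cdot> pbw X Y Z (k - 1 - n) (l - n) n f)"
    by (rule sum.mono_neutral_right) auto
  also have "(\<Sum>n\<le>min k l. (- of_nat n * a n) \<cdot> pbw X Y Z (k - n) (Suc (l - n)) (n - 1) f)
     = (\<Sum>m\<in>?P. (- of_nat (Suc m) * a (Suc m)) \<cdot> pbw X Y Z (k - 1 - m) (l - m) m f)"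
    using a by (intro sum_shift_supported) (auto simp: Suc_diff_Suc)
  finally show ?thesis
    by (simp add: sum.distrib[symmetric] algebra_simps)
qed

lemma E'_nform:
  assumes a: "\<And>n. n > min k l \<Longrightarrow> a n = 0"
  shows "E' (nform k l a f) = (\<Sum>m | m < l \<and> m \<le> k.
    (of_nat (Suc m) * a (Suc m) + of_nat (l - m) * (l2 - of_nat l + of_nat m + 1) * a m) \<cdot> pbw X Y Z (k - m) (l - 1 - m) m f)"
proof -
  let ?P = "{m. m < l \<and> m \<le> k}"
  let ?b = "\<lambda>n. of_nat (l - n) * (l2 - of_nat l + of_nat n + 1) * a n"
  have "E' (nform k l a f) = (\<Sum>n\<le>min k l. (a n) \<cdot> E' (pbw X Y Z (k - n) (l - n) n f))"
    unfolding nform_def by (rule lin_op_sum_scale[OF S E']) (simp add: pbw_closed f)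
  also have "\<dots> = (\<Sum>n\<le>min k l. (?b n) \<cdot> pbw X Y Z (k - n) (l - 1 - n) n f
       + (of_nat n * a n) \<cdot> pbw X Y Z (Suc (k - n)) (l - n) (n - 1) f)"
    unfolding E'_pbw by (intro sum.cong refl) (auto simp: of_nat_diff algebra_simps diff_right_commute)
  also have "\<dots> = (\<Sum>n\<le>min k l. (?b n) \<cdot> pbw X Y Z (k - n) (l - 1 - n) n f)
       + (\<Sum>n\<le>min k l. (of_nat n * a n) \<cdot> pbw X Y Z (Suc (k - n)) (l - n) (n - 1) f)"
    by (rule sum.distrib)
  also have "(\<Sum>n\<le>min k l. (?b n) \<cdot> pbw X Y Z (k - n) (l - 1 - n) n f)
     = (\<Sum>n\<in>?P. (?b n) \<cdot> pbw X Y Z (k - n) (l - 1 - n) n f)"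
    by (rule sum.mono_neutral_right) auto
  also have "(\<Sum>n\<le>min k l. (of_nat n * a n) \<cdot> pbw X Y Z (Suc (k - n)) (l - n) (n - 1) f)
     = (\<Sum>m\<in>?P. (of_nat (Suc m) * a (Suc m)) \<cdot> pbw X Y Z (k - m) (l - 1 - m) m f)"
    using a unfolding min.commute[of k l]
    by (intro sum_shift_supported) (auto simp: Suc_diff_Suc)
  finally show ?thesis
    by (simp add: sum.distrib[symmetric] algebra_simps)
qed

end

end

section \<open>Left-invariant differential operators on the big cell\<close>

definition cm :: "complex \<Rightarrow> ('a \<Rightarrow> complex) \<Rightarrow> 'a \<Rightarrow> complex" where
  "cm c f = (\<lambda>x. c * f x)"

lemma cm_apply [simp]: "cm c f x = c * f x"
  by (simp add: cm_def)

interpretation fn: cvec cm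
  by unfold_locales (simp_all add: fun_eq_iff algebra_simps)

lemma sum_fun_apply: "(\<Sum>i\<in>I. f i) x = (\<Sum>i\<in>I. f i x)"
  by (induction I rule: infinite_finite_induct) auto

definition smooth3 :: "(real^3 \<Rightarrow> complex) set" where
  "smooth3 = Collect (smooth_on UNIV)"

lemma smooth3_add: "F \<in> smooth3 \<Longrightarrow> G \<in> smooth3 \<Longrightarrow> (\<lambda>x. F x + G x) \<in> smooth3"
  by (simp add: smooth3_def smooth_on_add)

lemma smooth3_diff: "F \<in> smooth3 \<Longrightarrow> G \<in> smooth3 \<Longrightarrow> (\<lambda>x. F x - G x) \<in> smooth3"
  by (simp add: smooth3_def smooth_on_diff)

lemma smooth3_mult: "F \<in> smooth3 \<Longrightarrow> G \<in> smooth3 \<Longrightarrow> (\<lambda>x. F x * G x) \<in> smooth3"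
  by (simp add: smooth3_def smooth_on_mult)

lemma smooth3_power: "F \<in> smooth3 \<Longrightarrow> (\<lambda>x. F x ^ n) \<in> smooth3"
  by (simp add: smooth3_def smooth_on_power)

lemma smooth3_const: "(\<lambda>x. c) \<in> smooth3"
  by (simp add: smooth3_def smooth_on_const)

lemma smooth3_coord: "(\<lambda>x. complex_of_real (x $ i)) \<in> smooth3"
  by (simp add: smooth3_def smooth_on_of_real smooth_on_linear bounded_linear_vec_nth)

lemma smooth3_coord_div: "(\<lambda>x. complex_of_real (x $ i / 2)) \<in> smooth3"
  using smooth3_mult[OF smooth3_coord smooth3_const[of "1/2"]] by simp

lemma subspace_smooth3: "fn.subspace smooth3"
proof -
  have "(0::real^3 \<Rightarrow> complex) \<in> smooth3"
    unfolding zero_fun_def by (rule smooth3_const)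
  moreover have "f + g = (\<lambda>x. f x + g x)" for f g :: "real^3 \<Rightarrow> complex" by (simp add: fun_eq_iff)
  ultimately show ?thesis
    by (simp add: fn.subspace_def smooth3_add smooth3_const cm_def smooth3_mult)
qed

lemma vec_nth_has_derivative: "((\<lambda>x. x $ j) has_derivative (\<lambda>v. v $ j)) (at x)"
  by (rule bounded_linear_imp_has_derivative[OF bounded_linear_vec_nth])

lemma frechet_mult:
  fixes F G :: "'a::real_normed_vector \<Rightarrow> complex"
  assumes "F differentiable at x" "G differentiable at x"
  shows "frechet_derivative (\<lambda>x. F x * G x) (at x) v
     = F x * frechet_derivative G (at x) v + frechet_derivative F (at x) v * G x"
  using frechet_derivative_at[OF has_derivative_mult[OF assms[unfolded frechet_derivative_works]]] by metis

lemma frechet_add: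
  assumes "F differentiable at x" "G differentiable at x"
  shows "frechet_derivative (\<lambda>x. F x + G x) (at x) v
     = frechet_derivative F (at x) v + frechet_derivative G (at x) v"
  using frechet_derivative_at[OF has_derivative_add[OF assms[unfolded frechet_derivative_works]]] by metis

lemma smooth3_differentiable: "F \<in> smooth3 \<Longrightarrow> F differentiable at x"
  using smooth_on_differentiable[of UNIV F x] by (simp add: smooth3_def)

lemma pd_smooth3: "F \<in> smooth3 \<Longrightarrow> pd i F \<in> smooth3"
  by (simp add: smooth3_def pd_def smooth_on_frechet)

lemma pds_smooth3: "F \<in> smooth3 \<Longrightarrow> pds w F \<in> smooth3"
  by (induction w) (auto intro: pd_smooth3)

lemma pd_mult:
  "F \<in> smooth3 \<Longrightarrow> G \<in> smooth3 \<Longrightarrow> pd i (\<lambda>x. F x * G x) = (\<lambda>x. F x * pd i G x + pd i F x * G x)"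
  by (simp add: pd_def frechet_mult smooth3_differentiable)

lemma pd_add:
  "F \<in> smooth3 \<Longrightarrow> G \<in> smooth3 \<Longrightarrow> pd i (\<lambda>x. F x + G x) = (\<lambda>x. pd i F x + pd i G x)"
  by (simp add: pd_def frechet_add smooth3_differentiable)

lemma pd_const: "pd i (\<lambda>x. c) = (\<lambda>x. 0)"
  by (simp add: pd_def)

lemma pd_coord: "pd i (\<lambda>x. complex_of_real (x $ j)) = (\<lambda>x. if i = j then 1 else 0)"
proof -
  have "((\<lambda>x. complex_of_real (x $ j)) has_derivative (\<lambda>v. complex_of_real (v $ j))) (at x)" for x :: "real^3"
    by (rule has_derivative_of_real[OF vec_nth_has_derivative])
  from frechet_derivative_at[OF this, symmetric] show ?thesis
    by (simp add: pd_def fun_eq_iff axis_def)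
qed

lemma Dop_smooth3:
  assumes "F \<in> smooth3"
  shows "Dop1 F \<in> smooth3" "Dop2 F \<in> smooth3" "Dop3 F \<in> smooth3"
  unfolding Dop1_def Dop2_def Dop3_def
  by (intro smooth3_add smooth3_diff smooth3_mult smooth3_coord_div pd_smooth3 assms)+

lemma word_op_smooth3: "F \<in> smooth3 \<Longrightarrow> word_op w F \<in> smooth3"
  by (induction w) (auto simp: Dop_def intro: Dop_smooth3)

lemma Dop_mult:
  assumes "F \<in> smooth3" "G \<in> smooth3"
  shows "Dop1 (\<lambda>x. F x * G x) = (\<lambda>x. F x * Dop1 G x + Dop1 F x * G x)"
    "Dop2 (\<lambda>x. F x * G x) = (\<lambda>x. F x * Dop2 G x + Dop2 F x * G x)"
    "Dop3 (\<lambda>x. F x * G x) = (\<lambda>x. F x * Dop3 G x + Dop3 F x * G x)"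
  unfolding Dop1_def Dop2_def Dop3_def
  by (simp_all add: pd_mult[OF assms] fun_eq_iff algebra_simps add_divide_distrib)

lemma Dop_add:
  assumes "F \<in> smooth3" "G \<in> smooth3"
  shows "Dop1 (\<lambda>x. F x + G x) = (\<lambda>x. Dop1 F x + Dop1 G x)"
    "Dop2 (\<lambda>x. F x + G x) = (\<lambda>x. Dop2 F x + Dop2 G x)"
    "Dop3 (\<lambda>x. F x + G x) = (\<lambda>x. Dop3 F x + Dop3 G x)"
  unfolding Dop1_def Dop2_def Dop3_def
  by (simp_all add: pd_add[OF assms] fun_eq_iff algebra_simps add_divide_distrib)

lemma Dop_const: "Dop1 (\<lambda>x. c) = (\<lambda>x. 0)" "Dop2 (\<lambda>x. c) = (\<lambda>x. 0)" "Dop3 (\<lambda>x. c) = (\<lambda>x. 0)"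
  by (simp_all add: Dop1_def Dop2_def Dop3_def pd_const)

lemma lin_op_Dop: "fn.lin_op smooth3 Dop1" "fn.lin_op smooth3 Dop2" "fn.lin_op smooth3 Dop3"
proof -
  have plus: "f + g = (\<lambda>x. f x + g x)" for f g :: "real^3 \<Rightarrow> complex" by (simp add: fun_eq_iff)
  show "fn.lin_op smooth3 Dop1" "fn.lin_op smooth3 Dop2" "fn.lin_op smooth3 Dop3"
    unfolding fn.lin_op_def plus cm_def
    by (simp_all add: Dop_smooth3 Dop_add Dop_mult Dop_const smooth3_const)
qed

text \<open>The fields behind \<open>Dop1\<close>, \<open>Dop2\<close>, \<open>Dop3\<close>; every
  index other than 1 and 2 means the third, in accordance with \<open>Dop\<close>.\<close>

definition fld :: "nat \<Rightarrow> real^3 \<Rightarrow> real^3" where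
  "fld i x = (if i = 1 then axis 1 1 + (x$2 / 2) *\<^sub>R axis 3 1
     else if i = 2 then axis 2 1 - (x$1 / 2) *\<^sub>R axis 3 1 else axis 3 1)"

lemma Dop_along: "F \<in> smooth3 \<Longrightarrow> Dop i F = along (fld i) F"
proof
  fix x assume F: "F \<in> smooth3"
  then have lin: "linear (frechet_derivative F (at x))"
    by (simp add: linear_frechet_derivative smooth3_differentiable)
  have scale: "frechet_derivative F (at x) (r *\<^sub>R v) = complex_of_real r * frechet_derivative F (at x) v" for r v
    by (subst linear_scale[OF lin]) (rule scaleR_conv_of_real)
  show "Dop i F x = along (fld i) F x"
    by (simp add: Dop_def Dop1_def Dop2_def Dop3_def pd_def along_def fld_def
        linear_add[OF lin] linear_diff[OF lin] scale)
qed

lemma fld_derivative: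
  "(fld i has_derivative (\<lambda>v. if i = 1 then (v$2 / 2) *\<^sub>R axis 3 1
     else if i = 2 then - (v$1 / 2) *\<^sub>R axis 3 1 else 0)) (at x)"
  unfolding fld_def by (cases "i = 1"; cases "i = 2") (auto intro!: derivative_eq_intros vec_nth_has_derivative)

lemma smooth_on_fld: "smooth_on UNIV (fld i)"
proof -
  have c: "smooth_on UNIV (\<lambda>x::real^3. (x $ j / 2) *\<^sub>R axis 3 1 :: real^3)" for j
  proof -
    have "bounded_linear (\<lambda>x::real^3. (x $ j / 2) *\<^sub>R axis 3 1 :: real^3)"
      by (intro bounded_linear_scaleR_left[THEN bounded_linear_compose] bounded_linear_divide[THEN bounded_linear_compose]
          bounded_linear_vec_nth)
    then show ?thesis by (intro smooth_on_linear open_UNIV)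
  qed
  show ?thesis
    unfolding fld_def
    by (cases "i = 1"; cases "i = 2") (auto intro!: smooth_on_add smooth_on_diff smooth_on_const c)
qed

lemma along_fld_fld:
  "along (fld i) (fld j) x = (if j = 1 then (fld i x $ 2 / 2) *\<^sub>R axis 3 1
     else if j = 2 then - (fld i x $ 1 / 2) *\<^sub>R axis 3 1 else 0)"
  unfolding along_def frechet_derivative_at[OF fld_derivative, symmetric] by simp

lemma fld_nth: "fld i x $ 1 = (if i = 1 then 1 else 0)" "fld i x $ 2 = (if i = 2 then 1 else 0)"
  by (auto simp: fld_def axis_def)

lemma Dop_bracket:
  assumes F: "F \<in> smooth3"
  shows "Dop i (Dop j F) x - Dop j (Dop i F) x
    = frechet_derivative F (at x) (along (fld i) (fld j) x - along (fld j) (fld i) x)"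
proof -
  have "along (fld i) F \<in> smooth3" for i
    using F smooth_on_along[OF open_UNIV _ smooth_on_fld] by (simp add: smooth3_def)
  then show ?thesis
    using along_bracket[OF open_UNIV _ smooth_on_fld smooth_on_fld, of F x i j] F
    by (simp add: Dop_along smooth3_def)
qed

interpretation R3: heisenberg cm smooth3 Dop1 Dop2 Dop3
proof unfold_locales
  show "fn.subspace smooth3" by (rule subspace_smooth3)
  show "fn.lin_op smooth3 Dop1" "fn.lin_op smooth3 Dop2" "fn.lin_op smooth3 Dop3" by (rule lin_op_Dop)+
  fix F assume F: "F \<in> smooth3"
  have lin: "linear (frechet_derivative F (at x))" for x
    using F by (simp add: linear_frechet_derivative smooth3_differentiable)
  have d: "Dop 1 = Dop1" "Dop 2 = Dop2" "Dop 3 = Dop3" by (simp_all add: Dop_def fun_eq_iff)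
  have "Dop2 (Dop1 F) x - Dop1 (Dop2 F) x = Dop3 F x" for x
    using Dop_bracket[OF F, of 2 1 x] unfolding d
    by (simp add: along_fld_fld fld_nth Dop3_def pd_def scaleR_add_left[symmetric])
  then show "Dop2 (Dop1 F) = Dop1 (Dop2 F) + Dop3 F"
    by (simp add: fun_eq_iff algebra_simps)
  have "Dop3 (Dop1 F) x - Dop1 (Dop3 F) x = 0" "Dop3 (Dop2 F) x - Dop2 (Dop3 F) x = 0" for x
    using Dop_bracket[OF F, of 3 1 x] Dop_bracket[OF F, of 3 2 x] linear_0[OF lin]
    unfolding d by (simp_all add: along_fld_fld fld_nth)
  then show "Dop3 (Dop1 F) = Dop1 (Dop3 F)" "Dop3 (Dop2 F) = Dop2 (Dop3 F)"
    by (simp_all add: fun_eq_iff)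
qed

abbreviation mon3 :: "nat \<times> nat \<times> nat \<Rightarrow> op3" where
  "mon3 t \<equiv> (case t of (i, j, k) \<Rightarrow> fn.pbw Dop1 Dop2 Dop3 i j k)"

text \<open>The left module over the smooth functions generated by \<open>B\<close>. With
  \<open>pds\<close> it is the notion \<open>is_diffop\<close>, with \<open>mon3\<close> it refers
  to the left-invariant frame; the normal form is the passage from one generating family to the
  other.\<close>

definition spanned :: "('t \<Rightarrow> op3) \<Rightarrow> op3 \<Rightarrow> bool" where
  "spanned B D \<longleftrightarrow> (\<exists>ts. (\<forall>p\<in>set ts. fst p \<in> smooth3) \<and>
     (\<forall>F\<in>smooth3. D F = (\<lambda>x. \<Sum>p\<leftarrow>ts. fst p x * B (snd p) F x)))"

lemma is_diffop_spanned: "is_diffop D \<longleftrightarrow> spanned pds D"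
  by (simp add: is_diffop_def spanned_def smooth3_def)

lemma spanned_basic: "spanned B (B t)"
  unfolding spanned_def by (rule exI[of _ "[(\<lambda>x. 1, t)]"]) (simp add: smooth3_const)

lemma spanned_zero: "spanned B (\<lambda>F x. 0)"
  unfolding spanned_def by (rule exI[of _ "[]"]) simp

lemma spanned_cong: "(\<And>F. F \<in> smooth3 \<Longrightarrow> D F = D' F) \<Longrightarrow> spanned B D \<longleftrightarrow> spanned B D'"
  by (simp add: spanned_def)

lemma spanned_add:
  assumes "spanned B D" "spanned B D'"
  shows "spanned B (\<lambda>F x. D F x + D' F x)"
proof -
  from assms obtain ts ts' where "\<forall>p\<in>set ts. fst p \<in> smooth3" "\<forall>p\<in>set ts'. fst p \<in> smooth3"
    "\<forall>F\<in>smooth3. D F = (\<lambda>x. \<Sum>p\<leftarrow>ts. fst p x * B (snd p) F x)"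
    "\<forall>F\<in>smooth3. D' F = (\<lambda>x. \<Sum>p\<leftarrow>ts'. fst p x * B (snd p) F x)"
    unfolding spanned_def by blast
  then show ?thesis
    unfolding spanned_def by (intro exI[of _ "ts @ ts'"]) auto
qed

lemma spanned_mult:
  assumes "spanned B D" "c \<in> smooth3"
  shows "spanned B (\<lambda>F x. c x * D F x)"
proof -
  from assms obtain ts where "\<forall>p\<in>set ts. fst p \<in> smooth3"
    "\<forall>F\<in>smooth3. D F = (\<lambda>x. \<Sum>p\<leftarrow>ts. fst p x * B (snd p) F x)"
    unfolding spanned_def by blast
  then show ?thesis
    unfolding spanned_def using assms(2)
    by (intro exI[of _ "map (\<lambda>p. (\<lambda>x. c x * fst p x, snd p)) ts"])
       (auto simp: smooth3_mult o_def mult.assoc sum_list_const_mult)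
qed

lemma spanned_sum:
  "finite I \<Longrightarrow> (\<And>i. i \<in> I \<Longrightarrow> spanned B (D i)) \<Longrightarrow> spanned B (\<lambda>F x. \<Sum>i\<in>I. D i F x)"
  by (induction I rule: finite_induct) (auto intro: spanned_zero spanned_add)

text \<open>By the Leibniz rule, closure under a partial derivative is a matter of the generators
  only.\<close>

lemma spanned_pd:
  assumes D: "spanned B D" and B: "\<And>t F. F \<in> smooth3 \<Longrightarrow> B t F \<in> smooth3"
    and pdB: "\<And>t. spanned B (\<lambda>F. pd i (B t F))"
  shows "spanned B (\<lambda>F. pd i (D F))"
proof -
  from D obtain ts where ts: "\<forall>p\<in>set ts. fst p \<in> smooth3"
    "\<forall>F\<in>smooth3. D F = (\<lambda>x. \<Sum>p\<leftarrow>ts. fst p x * B (snd p) F x)"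
    unfolding spanned_def by blast
  have "spanned B (\<lambda>F. pd i (\<lambda>x. \<Sum>p\<leftarrow>ts. fst p x * B (snd p) F x))"
    using ts(1)
  proof (induction ts)
    case Nil
    then show ?case by (simp add: pd_const spanned_zero)
  next
    case (Cons p ts)
    have sm: "(\<lambda>x. \<Sum>p\<leftarrow>ts. fst p x * B (snd p) F x) \<in> smooth3" if "F \<in> smooth3" for F
      using Cons.prems by (induction ts) (auto intro!: smooth3_add smooth3_mult smooth3_const B that)
    have eq: "pd i (\<lambda>x. \<Sum>p\<leftarrow>p # ts. fst p x * B (snd p) F x) = (\<lambda>x.
       (fst p x * pd i (B (snd p) F) x + pd i (fst p) x * B (snd p) F x)
         + pd i (\<lambda>x. \<Sum>p\<leftarrow>ts. fst p x * B (snd p) F x) x)" if "F \<in> smooth3" for F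
      using Cons.prems that by (simp add: pd_add smooth3_mult B sm pd_mult)
    have sp: "spanned B (\<lambda>F x. (fst p x * pd i (B (snd p) F) x + pd i (fst p) x * B (snd p) F x)
         + pd i (\<lambda>x. \<Sum>p\<leftarrow>ts. fst p x * B (snd p) F x) x)"
      using Cons by (intro spanned_add spanned_mult pdB spanned_basic pd_smooth3) auto
    show ?case
      by (rule iffD2[OF spanned_cong sp]) (rule eq)
  qed
  then show ?thesis
    using spanned_cong[of "\<lambda>F. pd i (D F)" "\<lambda>F. pd i (\<lambda>x. \<Sum>p\<leftarrow>ts. fst p x * B (snd p) F x)" B] ts(2) by simp
qed

lemma is_diffop_pd: "is_diffop D \<Longrightarrow> is_diffop (\<lambda>F. pd i (D F))"
proof -
  have "spanned pds (\<lambda>F. pd i (pds w F))" for w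
  proof -
    have "pds (i # w) = (\<lambda>F. pd i (pds w F))" by (simp add: fun_eq_iff)
    then show ?thesis using spanned_basic[of pds "i # w"] by simp
  qed
  note basic = this
  show "is_diffop D \<Longrightarrow> is_diffop (\<lambda>F. pd i (D F))"
    unfolding is_diffop_spanned by (rule spanned_pd[OF _ pds_smooth3 basic])
qed

lemma is_diffop_ident: "is_diffop (\<lambda>F. F)"
proof -
  have "pds [] = (\<lambda>F. F)" by (simp add: fun_eq_iff)
  then show ?thesis using spanned_basic[of pds "[]"] by (simp add: is_diffop_spanned)
qed

lemma is_diffop_word_op: "is_diffop (word_op w)"
proof (induction w)
  case Nil
  have "word_op [] = (\<lambda>F. F)" by (simp add: fun_eq_iff)
  then show ?case by (simp add: is_diffop_ident)
next
  case (Cons i w)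
  let ?P = "\<lambda>i F. pd i (word_op w F)"
  have P: "spanned pds (?P i)" for i using is_diffop_pd[OF Cons] by (simp add: is_diffop_spanned)
  have "spanned pds (\<lambda>F x. ?P 1 F x + complex_of_real (x$2 / 2) * ?P 3 F x)"
    "spanned pds (\<lambda>F x. ?P 2 F x + (-1) * (complex_of_real (x$1 / 2) * ?P 3 F x))"
    by (intro spanned_add spanned_mult P smooth3_coord_div smooth3_const)+
  moreover have "word_op (i # w) = (if i = 1 then \<lambda>F x. ?P 1 F x + complex_of_real (x$2 / 2) * ?P 3 F x
      else if i = 2 then \<lambda>F x. ?P 2 F x + (-1) * (complex_of_real (x$1 / 2) * ?P 3 F x) else ?P 3)"
    by (simp add: fun_eq_iff Dop_def Dop1_def Dop2_def Dop3_def)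
  ultimately show ?case using P[of 3] by (simp add: is_diffop_spanned)
qed

lemma mon3_smooth3: "F \<in> smooth3 \<Longrightarrow> mon3 t F \<in> smooth3"
  by (cases t) (simp add: R3.pbw_closed)

text \<open>Solving for the partial derivatives: the first is \<open>Dop1\<close> minus x2/2 times
  \<open>Dop3\<close>, the second is \<open>Dop2\<close> plus x1/2 times \<open>Dop3\<close>.
  Applied to an ordered monomial, the left-invariant fields give ordered monomials again, with one
  reordering term for \<open>Dop2\<close>.\<close>

lemma spanned_mon3_pd: "spanned mon3 (\<lambda>F. pd i (mon3 t F))"
proof -
  obtain p q r where t: "t = (p, q, r)" by (cases t)
  have D1: "spanned mon3 (\<lambda>F. Dop1 (mon3 t F))"
    using spanned_basic[of mon3 "(Suc p, q, r)"] by (simp add: t R3.X_pbw)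
  have D3: "spanned mon3 (\<lambda>F. Dop3 (mon3 t F))"
    using spanned_basic[of mon3 "(p, q, Suc r)"] spanned_cong[of "\<lambda>F. Dop3 (mon3 t F)" "mon3 (p, q, Suc r)" mon3]
    by (simp add: t R3.Z_pbw)
  have "spanned mon3 (\<lambda>F x. mon3 (p, Suc q, r) F x + of_nat p * mon3 (p - 1, q, Suc r) F x)"
    by (intro spanned_add spanned_mult spanned_basic smooth3_const)
  then have D2: "spanned mon3 (\<lambda>F. Dop2 (mon3 t F))"
    using spanned_cong[of "\<lambda>F. Dop2 (mon3 t F)"
        "\<lambda>F x. mon3 (p, Suc q, r) F x + of_nat p * mon3 (p - 1, q, Suc r) F x" mon3]
    by (simp add: t R3.Y_pbw fun_eq_iff)
  have m: "spanned mon3 (\<lambda>F x. Dop1 (mon3 t F) x + (-1) * (complex_of_real (x$2 / 2) * Dop3 (mon3 t F) x))"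
    "spanned mon3 (\<lambda>F x. Dop2 (mon3 t F) x + complex_of_real (x$1 / 2) * Dop3 (mon3 t F) x)"
    by (intro spanned_add spanned_mult D1 D2 D3 smooth3_coord_div smooth3_const)+
  have e: "(\<lambda>F x. Dop1 (mon3 t F) x + (-1) * (complex_of_real (x$2 / 2) * Dop3 (mon3 t F) x)) = (\<lambda>F. pd 1 (mon3 t F))"
    "(\<lambda>F x. Dop2 (mon3 t F) x + complex_of_real (x$1 / 2) * Dop3 (mon3 t F) x) = (\<lambda>F. pd 2 (mon3 t F))"
    "(\<lambda>F. Dop3 (mon3 t F)) = (\<lambda>F. pd 3 (mon3 t F))"
    by (simp_all add: Dop1_def Dop2_def Dop3_def)
  show ?thesis
    using m[unfolded e] D3[unfolded e] exhaust_3[of i] by fastforce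
qed

lemma is_diffop_spanned_mon3: "is_diffop D \<Longrightarrow> spanned mon3 D"
proof -
  have "spanned mon3 (pds w)" for w
  proof (induction w)
    case Nil
    have "pds [] = mon3 (0, 0, 0)" by (simp add: fun_eq_iff fn.pbw_def)
    then show ?case by (metis spanned_basic)
  next
    case (Cons i w)
    have "pds (i # w) = (\<lambda>F. pd i (pds w F))" by (simp add: fun_eq_iff)
    then show ?case using spanned_pd[OF Cons mon3_smooth3 spanned_mon3_pd] by simp
  qed
  note pds = this
  assume "is_diffop D"
  then obtain ts where ts: "\<forall>p\<in>set ts. fst p \<in> smooth3"
    "\<forall>F\<in>smooth3. D F = (\<lambda>x. \<Sum>p\<leftarrow>ts. fst p x * pds (snd p) F x)"
    unfolding is_diffop_spanned spanned_def by blast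
  have "spanned mon3 (\<lambda>F x. \<Sum>p\<leftarrow>ts. fst p x * pds (snd p) F x)"
    using ts(1) by (induction ts) (auto intro!: spanned_zero spanned_add spanned_mult pds)
  then show ?thesis
    using spanned_cong[of D "\<lambda>F x. \<Sum>p\<leftarrow>ts. fst p x * pds (snd p) F x" mon3] ts(2) by simp
qed

text \<open>The term list of a differential operator may repeat an index; collecting equal ones
  makes the coefficients functions on a finite set of exponents, as the comparison of coefficients
  requires.\<close>

lemma sum_list_group:
  fixes g :: "'t \<Rightarrow> 'b::semiring_0"
  assumes "finite I" "snd ` set ts \<subseteq> I"
  shows "(\<Sum>p\<leftarrow>ts. fst p x * g (snd p)) = (\<Sum>t\<in>I. (\<Sum>p\<leftarrow>ts. if snd p = t then fst p x else 0) * g t)"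
  using assms(2)
proof (induction ts)
  case (Cons p ts)
  have "(\<Sum>t\<in>I. (\<Sum>p\<leftarrow>p # ts. if snd p = t then fst p x else 0) * g t)
     = (\<Sum>t\<in>I. (if snd p = t then fst p x * g t else 0)
         + (\<Sum>p\<leftarrow>ts. if snd p = t then fst p x else 0) * g t)"
    by (intro sum.cong) (auto simp: distrib_right)
  also have "\<dots> = fst p x * g (snd p) + (\<Sum>t\<in>I. (\<Sum>p\<leftarrow>ts. if snd p = t then fst p x else 0) * g t)"
    using Cons.prems assms(1) by (simp add: sum.distrib)
  finally show ?case using Cons by simp
qed simp

lemma is_diffop_normal_form:
  assumes "is_diffop D"
  obtains I a where "finite I" "\<And>F x. F \<in> smooth3 \<Longrightarrow> D F x = (\<Sum>t\<in>I. a t x * mon3 t F x)"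
proof -
  obtain ts where "\<forall>F\<in>smooth3. D F = (\<lambda>x. \<Sum>p\<leftarrow>ts. fst p x * mon3 (snd p) F x)"
    using is_diffop_spanned_mon3[OF assms] unfolding spanned_def by blast
  then have "D F x = (\<Sum>t\<in>snd ` set ts. (\<Sum>p\<leftarrow>ts. if snd p = t then fst p x else 0) * mon3 t F x)"
    if "F \<in> smooth3" for F x
    using sum_list_group[of "snd ` set ts" ts x "\<lambda>t. mon3 t F x"] that by simp
  then show thesis by (intro that[of "snd ` set ts"]) auto
qed

text \<open>In the coordinates $x_1$, $x_2$ and $x_3 + x_1x_2/2$ on the big cell, the monomial
  $D_1^i D_2^j D_3^k$ takes the corresponding mixed partial derivative at the origin.\<close>

definition x1 :: "real^3 \<Rightarrow> complex" where "x1 x = complex_of_real (x$1)"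
definition x2 :: "real^3 \<Rightarrow> complex" where "x2 x = complex_of_real (x$2)"
definition z31 :: "real^3 \<Rightarrow> complex" where "z31 x = complex_of_real (x$3 + x$1 * x$2 / 2)"

lemma coord_smooth3: "x1 \<in> smooth3" "x2 \<in> smooth3" "z31 \<in> smooth3"
proof -
  show 1: "x1 \<in> smooth3" and 2: "x2 \<in> smooth3"
    unfolding x1_def[abs_def] x2_def[abs_def] by (rule smooth3_coord)+
  have "(\<lambda>x. complex_of_real (x$3) + x1 x * (x2 x * (1/2))) \<in> smooth3"
    by (intro smooth3_add smooth3_mult smooth3_const 1 2 smooth3_coord)
  moreover have "(\<lambda>x. complex_of_real (x$3) + x1 x * (x2 x * (1/2))) = z31"
    by (simp add: fun_eq_iff x1_def x2_def z31_def)
  ultimately show "z31 \<in> smooth3" by simp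
qed

lemma Dop_coord:
  "Dop1 x1 = (\<lambda>x. 1)" "Dop2 x1 = (\<lambda>x. 0)" "Dop3 x1 = (\<lambda>x. 0)"
  "Dop1 x2 = (\<lambda>x. 0)" "Dop2 x2 = (\<lambda>x. 1)" "Dop3 x2 = (\<lambda>x. 0)"
  "Dop1 z31 = x2" "Dop2 z31 = (\<lambda>x. 0)" "Dop3 z31 = (\<lambda>x. 1)"
proof -
  have p1: "pd i x1 = (\<lambda>x. if i = 1 then 1 else 0)" and p2: "pd i x2 = (\<lambda>x. if i = 2 then 1 else 0)" for i
    unfolding x1_def[abs_def] x2_def[abs_def] by (rule pd_coord)+
  obtain c :: complex where c: "c = 1 / 2" by blast
  have z: "z31 = (\<lambda>x. complex_of_real (x$3) + x1 x * (x2 x * c))"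
    by (simp add: fun_eq_iff x1_def x2_def z31_def c)
  have sm: "(\<lambda>x. x2 x * c) \<in> smooth3" "(\<lambda>x. x1 x * (x2 x * c)) \<in> smooth3"
    by (intro smooth3_mult coord_smooth3 smooth3_const)+
  have pz: "pd i z31 = (\<lambda>x. (if i = 3 then 1 else 0) + (x1 x * (pd i x2 x * c) + pd i x1 x * (x2 x * c)))" for i
    unfolding z
    by (simp add: pd_add pd_mult pd_const pd_coord smooth3_coord smooth3_const coord_smooth3 sm)
  show "Dop1 x1 = (\<lambda>x. 1)" "Dop2 x1 = (\<lambda>x. 0)" "Dop3 x1 = (\<lambda>x. 0)"
    "Dop1 x2 = (\<lambda>x. 0)" "Dop2 x2 = (\<lambda>x. 1)" "Dop3 x2 = (\<lambda>x. 0)"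
    "Dop1 z31 = x2" "Dop2 z31 = (\<lambda>x. 0)" "Dop3 z31 = (\<lambda>x. 1)"
    by (simp_all add: Dop1_def Dop2_def Dop3_def p1 p2 pz fun_eq_iff x1_def x2_def c)
qed

section \<open>Pairing ordered monomials in the fields with monomials in the coordinates\<close>

definition derivation3 :: "op3 \<Rightarrow> bool" where
  "derivation3 T \<longleftrightarrow> (\<forall>F\<in>smooth3. T F \<in> smooth3) \<and>
    (\<forall>F\<in>smooth3. \<forall>G\<in>smooth3. T (\<lambda>x. F x * G x) = (\<lambda>x. F x * T G x + T F x * G x)) \<and>
    (\<forall>F\<in>smooth3. \<forall>G\<in>smooth3. T (\<lambda>x. F x + G x) = (\<lambda>x. T F x + T G x)) \<and>
    (\<forall>c. T (\<lambda>x. c) = (\<lambda>x. 0))"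

lemma derivation3_Dop: "derivation3 Dop1" "derivation3 Dop2" "derivation3 Dop3"
  by (simp_all add: derivation3_def Dop_smooth3 Dop_mult Dop_add Dop_const)

lemma derivation3D:
  assumes "derivation3 T"
  shows "F \<in> smooth3 \<Longrightarrow> T F \<in> smooth3"
    "F \<in> smooth3 \<Longrightarrow> G \<in> smooth3 \<Longrightarrow> T (\<lambda>x. F x * G x) = (\<lambda>x. F x * T G x + T F x * G x)"
    "F \<in> smooth3 \<Longrightarrow> G \<in> smooth3 \<Longrightarrow> T (\<lambda>x. F x + G x) = (\<lambda>x. T F x + T G x)"
    "T (\<lambda>x. c) = (\<lambda>x. 0)"
  using assms by (simp_all add: derivation3_def)

lemma derivation3_funpow: "derivation3 T \<Longrightarrow> F \<in> smooth3 \<Longrightarrow> (T ^^ n) F \<in> smooth3"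
  by (induction n) (simp_all add: derivation3D)

lemma derivation3_power:
  assumes T: "derivation3 T" and t: "t \<in> smooth3" "T t = (\<lambda>x. c)"
  shows "T (\<lambda>x. t x ^ n) = (\<lambda>x. c * of_nat n * t x ^ (n - 1))"
proof (induction n)
  case 0
  then show ?case by (simp add: derivation3D(4)[OF T])
next
  case (Suc n)
  have "T (\<lambda>x. t x ^ Suc n) = (\<lambda>x. t x * T (\<lambda>x. t x ^ n) x + T t x * t x ^ n)"
    using derivation3D(2)[OF T t(1) smooth3_power[OF t(1)]] by simp
  then show ?case unfolding Suc t(2)
    by (cases n) (simp_all add: fun_eq_iff algebra_simps)
qed

lemma funpow_kills:
  assumes T: "derivation3 T" and u: "u \<in> smooth3" "T u = (\<lambda>x. 0)" and G: "G \<in> smooth3"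
  shows "(T ^^ n) (\<lambda>x. u x * G x) = (\<lambda>x. u x * (T ^^ n) G x)"
  by (induction n) (simp_all add: derivation3D[OF T] u derivation3_funpow[OF T G])

text \<open>Leading term modulo one more power of \<open>t\<close>. The constant is m(m - 1)...(m -
  n + 1), of which only the nonvanishing is recorded.\<close>

lemma funpow_power:
  assumes T: "derivation3 T" and t: "t \<in> smooth3" "T t = (\<lambda>x. 1)" and G: "G \<in> smooth3"
  shows "n \<le> m \<Longrightarrow> \<exists>c G'. c \<noteq> 0 \<and> G' \<in> smooth3 \<and>
    (T ^^ n) (\<lambda>x. t x ^ m * G x) = (\<lambda>x. t x ^ (m - n) * (c * G x) + t x ^ (m - n) * (t x * G' x))"
proof (induction n)
  case 0
  show ?case by (rule exI[of _ 1], rule exI[of _ "\<lambda>x. 0"]) (simp add: smooth3_const)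
next
  case (Suc n)
  then obtain c G' where c: "c \<noteq> 0" and G': "G' \<in> smooth3" and
    eq: "(T ^^ n) (\<lambda>x. t x ^ m * G x) = (\<lambda>x. t x ^ (m - n) * (c * G x) + t x ^ (m - n) * (t x * G' x))"
    by auto
  obtain r where r: "m - n = Suc r" "m - Suc n = r" using Suc.prems by (metis Suc_diff_Suc Suc_le_lessD)
  note D = derivation3D[OF T]
  have sm: "(\<lambda>x. c * G x) \<in> smooth3" "(\<lambda>x. t x * G' x) \<in> smooth3" "(\<lambda>x. t x ^ k) \<in> smooth3" for k
    by (intro smooth3_mult smooth3_const smooth3_power t G G')+
  have sm': "(\<lambda>x. t x ^ k * (c * G x)) \<in> smooth3" "(\<lambda>x. t x ^ k * (t x * G' x)) \<in> smooth3" for k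
    by (intro smooth3_mult sm)+
  have "(T ^^ Suc n) (\<lambda>x. t x ^ m * G x) = T (\<lambda>x. t x ^ Suc r * (c * G x) + t x ^ Suc r * (t x * G' x))"
    by (simp add: eq r)
  also have "\<dots> = (\<lambda>x. t x ^ Suc r * (c * T G x) + of_nat (Suc r) * t x ^ r * (c * G x)
      + (t x ^ Suc r * (t x * T G' x + G' x) + of_nat (Suc r) * t x ^ r * (t x * G' x)))"
    unfolding D(3)[OF sm'] D(2)[OF sm(3) sm(1)] D(2)[OF sm(3) sm(2)] derivation3_power[OF T t]
      D(2)[OF smooth3_const G] D(2)[OF t(1) G'] D(4) t(2) by (simp add: fun_eq_iff)
  also have "\<dots> = (\<lambda>x. t x ^ r * (of_nat (Suc r) * c * G x)
      + t x ^ r * (t x * (c * T G x + (t x * T G' x + G' x) + of_nat (Suc r) * G' x)))"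
    by (simp add: fun_eq_iff algebra_simps)
  finally show ?case
    unfolding r using c
    by (intro exI[of _ "of_nat (Suc r) * c"] exI[of _ "\<lambda>x. c * T G x + (t x * T G' x + G' x) + of_nat (Suc r) * G' x"] conjI)
       (simp_all del: of_nat_Suc add: smooth3_add smooth3_mult smooth3_const t G' D G)
qed

lemma funpow_power_less:
  assumes "derivation3 T" "t \<in> smooth3" "T t = (\<lambda>x. 1)" "G \<in> smooth3" "n < m"
  shows "\<exists>G'\<in>smooth3. (T ^^ n) (\<lambda>x. t x ^ m * G x) = (\<lambda>x. t x * G' x)"
proof -
  obtain c G' where G': "G' \<in> smooth3" and eq:
    "(T ^^ n) (\<lambda>x. t x ^ m * G x) = (\<lambda>x. t x ^ (m - n) * (c * G x) + t x ^ (m - n) * (t x * G' x))"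
    using funpow_power[OF assms(1-4), of n m] assms(5) by auto
  obtain r where r: "m - n = Suc r" using assms(5) by (metis Suc_diff_Suc)
  have "(T ^^ n) (\<lambda>x. t x ^ m * G x) = (\<lambda>x. t x * (t x ^ r * (c * G x) + t x ^ r * (t x * G' x)))"
    unfolding eq r by (simp add: fun_eq_iff algebra_simps)
  moreover have "(\<lambda>x. t x ^ r * (c * G x) + t x ^ r * (t x * G' x)) \<in> smooth3"
    by (intro smooth3_add smooth3_mult smooth3_const smooth3_power G' assms)
  ultimately show ?thesis
    by (intro bexI[of _ "\<lambda>x. t x ^ r * (c * G x) + t x ^ r * (t x * G' x)"])
qed

lemma funpow_power_eq:
  assumes "derivation3 T" "t \<in> smooth3" "T t = (\<lambda>x. 1)" "G \<in> smooth3"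
  shows "\<exists>c G'. c \<noteq> 0 \<and> G' \<in> smooth3 \<and> (T ^^ n) (\<lambda>x. t x ^ n * G x) = (\<lambda>x. c * G x + t x * G' x)"
  using funpow_power[OF assms, of n n] by simp

text \<open>\<open>Dop1\<close> sends \<open>z31\<close> to \<open>x2\<close>, so it does not
  preserve the multiples of \<open>z31\<close>; it preserves the ideal generated by
  \<open>z31\<close> and \<open>x2\<close>, all of whose members vanish at the origin.\<close>

lemma Dop1_funpow_ideal:
  assumes "G \<in> smooth3" "G' \<in> smooth3"
  shows "\<exists>K\<in>smooth3. \<exists>K'\<in>smooth3. (Dop1 ^^ n) (\<lambda>x. z31 x * G x + x2 x * G' x) = (\<lambda>x. z31 x * K x + x2 x * K' x)"
proof (induction n)
  case 0
  then show ?case using assms by auto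
next
  case (Suc n)
  then obtain K K' where K: "K \<in> smooth3" "K' \<in> smooth3"
    and eq: "(Dop1 ^^ n) (\<lambda>x. z31 x * G x + x2 x * G' x) = (\<lambda>x. z31 x * K x + x2 x * K' x)" by auto
  have "(Dop1 ^^ Suc n) (\<lambda>x. z31 x * G x + x2 x * G' x) = Dop1 (\<lambda>x. z31 x * K x + x2 x * K' x)"
    by (simp add: eq)
  also have "\<dots> = (\<lambda>x. z31 x * Dop1 K x + x2 x * (K x + Dop1 K' x))"
    by (simp add: Dop_add Dop_mult Dop_coord coord_smooth3 K smooth3_mult fun_eq_iff algebra_simps)
  finally show ?case
    by (intro bexI[of _ "Dop1 K"] bexI[of _ "\<lambda>x. K x + Dop1 K' x"]) (auto intro!: smooth3_add K Dop_smooth3)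
qed

lemma coord_at_0 [simp]: "x1 0 = 0" "x2 0 = 0" "z31 0 = 0"
  by (simp_all add: x1_def x2_def z31_def)

definition test_fun :: "(real^3 \<Rightarrow> complex) \<Rightarrow> nat \<times> nat \<times> nat \<Rightarrow> real^3 \<Rightarrow> complex" where
  "test_fun Q t x = (case t of (i, j, k) \<Rightarrow> x1 x ^ i * (x2 x ^ j * (z31 x ^ k * Q x)))"

text \<open>The operators act from the right: \<open>Dop3\<close> kills \<open>x1\<close> and
  \<open>x2\<close> and strips powers of \<open>z31\<close>, then \<open>Dop2\<close> kills
  \<open>x1\<close> and \<open>z31\<close> and strips powers of \<open>x2\<close>, then
  \<open>Dop1\<close> strips powers of \<open>x1\<close>. A power left over in either of the first
  two stages puts the function into the ideal of \<open>Dop1_funpow_ideal\<close>, and a power of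
  \<open>x1\<close> left over vanishes at 0 as well.\<close>

lemma mon3_test_fun:
  assumes Q: "Q \<in> smooth3"
  shows mon3_test_fun_less: "i' < i \<or> j' < j \<or> k' < k \<Longrightarrow> mon3 (i', j', k') (test_fun Q (i, j, k)) 0 = 0"
    and mon3_test_fun_eq: "Q 0 \<noteq> 0 \<Longrightarrow> mon3 (i, j, k) (test_fun Q (i, j, k)) 0 \<noteq> 0"
proof -
  note der = derivation3_Dop
  note sm = coord_smooth3 smooth3_power[OF coord_smooth3(1)] smooth3_power[OF coord_smooth3(2)]
    smooth3_power[OF coord_smooth3(3)]
  note coord = Dop_coord[unfolded fun_eq_iff]
  define R where "R k' = (Dop3 ^^ k') (\<lambda>x. z31 x ^ k * Q x)" for k'
  define R2 where "R2 j' k' = (Dop2 ^^ j') (\<lambda>x. x2 x ^ j * R k' x)" for j' k'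
  have R: "R k' \<in> smooth3" for k'
    unfolding R_def by (intro derivation3_funpow der smooth3_mult sm Q)
  have R2: "R2 j' k' \<in> smooth3" for j' k'
    unfolding R2_def by (intro derivation3_funpow der smooth3_mult sm R)
  have k1: "Dop2 (\<lambda>x. x1 x ^ i) = (\<lambda>x. 0)" "Dop3 (\<lambda>x. x1 x ^ i) = (\<lambda>x. 0)" "Dop3 (\<lambda>x. x2 x ^ j) = (\<lambda>x. 0)"
    using derivation3_power[OF der(2) sm(1), of 0 i] derivation3_power[OF der(3) sm(1), of 0 i]
      derivation3_power[OF der(3) sm(2), of 0 j] by (simp_all add: Dop_coord)
  have Dz: "(Dop3 ^^ k') (test_fun Q (i, j, k)) = (\<lambda>x. x1 x ^ i * (x2 x ^ j * R k' x))" for k'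
    unfolding test_fun_def[abs_def] R_def
    by (simp add: funpow_kills[OF der(3)] k1 sm smooth3_mult Q)
  have Dy: "(Dop2 ^^ j') (\<lambda>x. x1 x ^ i * (x2 x ^ j * R k' x)) = (\<lambda>x. x1 x ^ i * R2 j' k' x)" for j' k'
    unfolding R2_def by (simp add: funpow_kills[OF der(2)] k1 sm smooth3_mult R)
  have mon: "mon3 (i', j', k') (test_fun Q (i, j, k)) = (Dop1 ^^ i') (\<lambda>x. x1 x ^ i * R2 j' k' x)" for i' j' k'
    by (simp add: fn.pbw_def Dz Dy)
  have ideal0: "(Dop1 ^^ n) (\<lambda>x. z31 x * G x + x2 x * G' x) 0 = 0" if "G \<in> smooth3" "G' \<in> smooth3" for n G G'
    using Dop1_funpow_ideal[OF that, of n] by auto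
  show "mon3 (i', j', k') (test_fun Q (i, j, k)) 0 = 0" if less: "i' < i \<or> j' < j \<or> k' < k"
  proof -
    consider "i' < i" | "j' < j" | "k' < k" using less by blast
    then show ?thesis
    proof cases
      case 1
      obtain G where "(Dop1 ^^ i') (\<lambda>x. x1 x ^ i * R2 j' k' x) = (\<lambda>x. x1 x * G x)"
        using funpow_power_less[OF der(1) sm(1) Dop_coord(1) R2 1] by blast
      then show ?thesis unfolding mon by simp
    next
      case 2
      obtain G where G: "G \<in> smooth3" "R2 j' k' = (\<lambda>x. x2 x * G x)"
        unfolding R2_def using funpow_power_less[OF der(2) sm(2) Dop_coord(5) R 2] by blast
      have "(\<lambda>x. x1 x ^ i * R2 j' k' x) = (\<lambda>x. z31 x * 0 + x2 x * (x1 x ^ i * G x))"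
        by (simp add: G fun_eq_iff)
      then show ?thesis
        unfolding mon using ideal0[of "\<lambda>x. 0" "\<lambda>x. x1 x ^ i * G x" i'] by (simp add: smooth3_const smooth3_mult sm G)
    next
      case 3
      obtain G where G: "G \<in> smooth3" "R k' = (\<lambda>x. z31 x * G x)"
        unfolding R_def using funpow_power_less[OF der(3) sm(3) Dop_coord(9) Q 3] by blast
      have "(\<lambda>x. x2 x ^ j * R k' x) = (\<lambda>x. z31 x * (x2 x ^ j * G x))"
        by (simp add: G fun_eq_iff)
      then have "R2 j' k' = (\<lambda>x. z31 x * (Dop2 ^^ j') (\<lambda>x. x2 x ^ j * G x) x)"
        unfolding R2_def using funpow_kills[OF der(2) sm(3) Dop_coord(8)] by (simp add: smooth3_mult sm G)
      then have "(\<lambda>x. x1 x ^ i * R2 j' k' x)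
          = (\<lambda>x. z31 x * (x1 x ^ i * (Dop2 ^^ j') (\<lambda>x. x2 x ^ j * G x) x) + x2 x * 0)"
        by (simp add: fun_eq_iff)
      moreover have "(\<lambda>x. x1 x ^ i * (Dop2 ^^ j') (\<lambda>x. x2 x ^ j * G x) x) \<in> smooth3"
        by (intro smooth3_mult derivation3_funpow der sm G)
      ultimately show ?thesis
        unfolding mon using ideal0[of "\<lambda>x. x1 x ^ i * (Dop2 ^^ j') (\<lambda>x. x2 x ^ j * G x) x" "\<lambda>x. 0" i']
        by (simp add: smooth3_const)
    qed
  qed
  show "mon3 (i, j, k) (test_fun Q (i, j, k)) 0 \<noteq> 0" if Q0: "Q 0 \<noteq> 0"
  proof -
    obtain c1 G1 where 1: "c1 \<noteq> 0" "(Dop1 ^^ i) (\<lambda>x. x1 x ^ i * R2 j k x) = (\<lambda>x. c1 * R2 j k x + x1 x * G1 x)"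
      using funpow_power_eq[OF der(1) sm(1) Dop_coord(1) R2] by blast
    obtain c2 G2 where 2: "c2 \<noteq> 0" "R2 j k = (\<lambda>x. c2 * R k x + x2 x * G2 x)"
      unfolding R2_def using funpow_power_eq[OF der(2) sm(2) Dop_coord(5) R] by blast
    obtain c3 G3 where 3: "c3 \<noteq> 0" "R k = (\<lambda>x. c3 * Q x + z31 x * G3 x)"
      unfolding R_def using funpow_power_eq[OF der(3) sm(3) Dop_coord(9) Q] by blast
    show ?thesis unfolding mon 1(2) by (simp add: 1 2 3 Q0)
  qed
qed

text \<open>Triangularity: let \<open>s\<close> have maximal total degree among the indices with
  nonzero coefficient. Any other such index is smaller than \<open>s\<close> in some entry, so its
  monomial vanishes on the test function of \<open>s\<close>. The factor \<open>Q\<close> is allowed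
  because covariant functions supply the monomials only up to a nonvanishing factor.\<close>

lemma mon3_independent:
  assumes I: "finite I"
    and test: "\<And>t. \<exists>Q\<in>smooth3. Q 0 \<noteq> 0 \<and> test_fun Q t \<in> V"
    and zero: "\<And>F. F \<in> V \<Longrightarrow> (\<Sum>t\<in>I. b t * mon3 t F 0) = 0"
    and t: "t \<in> I"
  shows "b t = 0"
proof (rule ccontr)
  define deg :: "nat \<times> nat \<times> nat \<Rightarrow> nat" where "deg = (\<lambda>(i, j, k). i + j + k)"
  let ?J = "{t \<in> I. b t \<noteq> 0}"
  assume "b t \<noteq> 0"
  then have J: "?J \<noteq> {}" using t by blast
  have fin: "finite (deg ` ?J)" using I by simp
  obtain s where s: "s \<in> ?J" "deg s = Max (deg ` ?J)"
    using Max_in[OF fin] J by (metis (no_types, lifting) image_iff image_is_empty)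
  have max: "deg t \<le> deg s" if "t \<in> ?J" for t
    unfolding s(2) by (rule Max_ge[OF fin imageI[OF that]])
  obtain i j k where ijk: "s = (i, j, k)" by (cases s)
  obtain Q where Q: "Q \<in> smooth3" "Q 0 \<noteq> 0" "test_fun Q s \<in> V" using test by blast
  have "b t * mon3 t (test_fun Q s) 0 = 0" if t: "t \<in> I - {s}" for t
  proof (cases "b t = 0")
    case False
    obtain i' j' k' where t': "t = (i', j', k')" by (cases t)
    have "i' + j' + k' \<le> i + j + k" using max[of t] t False by (simp add: deg_def t' ijk)
    moreover have "\<not> (i' = i \<and> j' = j \<and> k' = k)" using t by (auto simp: t' ijk)
    ultimately have "i' < i \<or> j' < j \<or> k' < k" by linarith
    then show ?thesis using mon3_test_fun_less[OF Q(1)] by (simp add: t' ijk)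
  qed simp
  then have "(\<Sum>t\<in>I - {s}. b t * mon3 t (test_fun Q s) 0) = 0"
    by (intro sum.neutral ballI)
  then have "(\<Sum>t\<in>I. b t * mon3 t (test_fun Q s) 0) = b s * mon3 s (test_fun Q s) 0"
    using sum.remove[OF I, of s "\<lambda>t. b t * mon3 t (test_fun Q s) 0"] s(1) by simp
  moreover have "mon3 s (test_fun Q s) 0 \<noteq> 0" using mon3_test_fun_eq[OF Q(1,2)] by (simp add: ijk)
  ultimately show False using zero[OF Q(3)] s by simp
qed

section \<open>Symmetrized products and Cayley continuants\<close>

lemma falling_0 [simp]: "falling r 0 = 1"
  by (simp add: falling_def)

lemma falling_Suc: "falling r (Suc n) = falling r n * (r - of_nat n)"
  by (simp add: falling_def)

lemma falling_add: "falling r (i + j) = falling r i * falling (r - of_nat i) j"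
  by (induction j) (simp_all add: falling_Suc algebra_simps)

lemma falling_pochhammer: "falling r n = pochhammer (r - of_nat n + 1) n"
proof (induction n arbitrary: r)
  case (Suc n)
  have "falling r (Suc n) = r * falling (r - 1) n"
    using falling_add[of r 1 n] by (simp add: falling_Suc)
  also have "\<dots> = pochhammer (r - of_nat (Suc n) + 1) (Suc n)"
    by (simp add: Suc pochhammer_rec' algebra_simps)
  finally show ?case .
qed simp

lemma falling_of_nat: "falling (of_nat l) n = of_nat (fact n * (l choose n))"
  using gbinomial_mult_fact[of n "of_nat l :: complex"]
  by (simp add: falling_def binomial_gbinomial lessThan_atLeast0)

lemma rising_pochhammer: "rising r n = pochhammer r n"
  by (simp add: rising_def pochhammer_prod lessThan_atLeast0)

text \<open>Vandermonde for rising factorials, after reading each falling factorial as the rising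
  one that starts at its smallest factor.\<close>

lemma falling_vandermonde:
  "(\<Sum>i\<le>N. of_nat (N choose i) * rising b i * falling (c - b - of_nat i) (N - i)) = falling c N"
proof -
  have "falling c N = pochhammer (b + (c - b - of_nat N + 1)) N"
    by (simp add: falling_pochhammer algebra_simps)
  also have "\<dots> = (\<Sum>i\<le>N. of_nat (N choose i) * pochhammer b i * pochhammer (c - b - of_nat N + 1) (N - i))"
    by (rule pochhammer_binomial_sum)
  also have "\<dots> = (\<Sum>i\<le>N. of_nat (N choose i) * rising b i * falling (c - b - of_nat i) (N - i))"
    by (intro sum.cong refl) (auto simp: rising_pochhammer falling_pochhammer of_nat_diff algebra_simps)
  finally show ?thesis ..
qed

lemma sum_triangle:
  fixes g :: "nat \<Rightarrow> nat \<Rightarrow> 'a::comm_monoid_add"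
  shows "(\<Sum>m\<le>M. \<Sum>j\<le>M - m. g m (m + j)) = (\<Sum>n\<le>M. \<Sum>m\<le>n. g m n)"
proof -
  have "(\<Sum>m\<le>M. \<Sum>j\<le>M - m. g m (m + j)) = (\<Sum>(m, j)\<in>{(m, j). m + j \<le> M}. g m (m + j))"
  proof -
    have "{(m, j). m + j \<le> M} = (SIGMA m:{..M}. {..M - m})" by auto
    then show ?thesis by (simp add: sum.Sigma)
  qed
  also have "\<dots> = (\<Sum>n\<le>M. \<Sum>m\<le>n. g m (m + (n - m)))"
    by (rule sum.triangle_reindex_eq)
  finally show ?thesis by simp
qed

text \<open>With a = (s + k)/2 and b = (s - k)/2 the continuant is a sum of falling factorials of a
  times rising factorials of b. Since a - b = k, summing over m - j for fixed j is
  \<open>falling_vandermonde\<close> and completes the falling factorial of a to length n; the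
  remaining binomial coefficients add up to the power of 2.\<close>

lemma Cay_binomial_sum:
  fixes s :: complex
  assumes n: "n \<le> k"
  shows "(\<Sum>m\<le>n. of_nat (n choose m) * Cay m s (of_nat k) * falling (of_nat (k - m)) (n - m))
    = 2 ^ n * falling ((of_nat k + s) / 2) n"
proof -
  define a where "a = (s + of_nat k) / 2"
  define b where "b = (s - of_nat k) / 2"
  have ab: "a - b = of_nat k" by (simp add: a_def b_def field_simps)
  have sub: "of_nat (k - m) = a - b - of_nat m" if "m \<le> n" for m
    using that n by (simp add: ab of_nat_diff)
  let ?g = "\<lambda>j m. of_nat (n choose m) * of_nat (m choose j) * falling a j * rising b (m - j) * falling (a - b - of_nat m) (n - m)"
  have "(\<Sum>m\<le>n. of_nat (n choose m) * Cay m s (of_nat k) * falling (of_nat (k - m)) (n - m))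
      = (\<Sum>m\<le>n. \<Sum>j\<le>m. ?g j m)"
    by (intro sum.cong refl)
       (auto simp: Cay_def sub a_def[symmetric] b_def[symmetric] sum_distrib_left sum_distrib_right atMost_atLeast0 mult_ac intro!: sum.cong)
  also have "\<dots> = (\<Sum>j\<le>n. \<Sum>i\<le>n - j. ?g j (j + i))"
    by (rule sum_triangle[symmetric])
  also have "\<dots> = (\<Sum>j\<le>n. of_nat (n choose j) * falling a n)"
  proof (intro sum.cong refl)
    fix j assume "j \<in> {..n}"
    then have j: "j \<le> n" by simp
    have "(\<Sum>i\<le>n - j. ?g j (j + i)) = (\<Sum>i\<le>n - j. of_nat (n choose j) * falling a j *
        (of_nat (n - j choose i) * rising b i * falling (a - of_nat j - b - of_nat i) (n - j - i)))"
    proof (intro sum.cong refl)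
      fix i assume "i \<in> {..n - j}"
      then have "(n choose (j + i)) * ((j + i) choose j) = (n choose j) * ((n - j) choose i)"
        using j choose_mult[of j "j + i" n] by simp
      then have "of_nat (n choose (j + i)) * of_nat ((j + i) choose j) = (of_nat (n choose j) * of_nat ((n - j) choose i) :: complex)"
        by (metis of_nat_mult)
      then show "?g j (j + i) = of_nat (n choose j) * falling a j *
        (of_nat (n - j choose i) * rising b i * falling (a - of_nat j - b - of_nat i) (n - j - i))"
        by (simp add: algebra_simps)
    qed
    also have "\<dots> = of_nat (n choose j) * falling a j * falling (a - of_nat j) (n - j)"
      unfolding sum_distrib_left[symmetric] falling_vandermonde ..
    also have "\<dots> = of_nat (n choose j) * falling a n"
      using falling_add[of a j "n - j"] j by simp
    finally show "(\<Sum>i\<le>n - j. ?g j (j + i)) = of_nat (n choose j) * falling a n" .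
  qed
  also have "\<dots> = 2 ^ n * falling a n"
    using choose_row_sum[of n] by (simp add: sum_distrib_right[symmetric] of_nat_sum[symmetric] del: of_nat_sum)
  finally show ?thesis by (simp add: a_def add.commute)
qed

section \<open>Words with prescribed letter multiplicities and the symmetrization map\<close>

lemma words_rec:
  assumes "0 < p + q + r"
  shows "words p q r = (if 0 < p then (#) 1 ` words (p - 1) q r else {})
    \<union> (if 0 < q then (#) 2 ` words p (q - 1) r else {})
    \<union> (if 0 < r then (#) 3 ` words p q (r - 1) else {})" (is "_ = ?R")
proof
  show "words p q r \<subseteq> ?R"
  proof
    fix w assume w: "w \<in> words p q r"
    with assms obtain i v where iv: "w = i # v" by (cases w) (auto simp: words_def)
    with w have "i = 1 \<or> i = 2 \<or> i = 3" by (auto simp: words_def)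
    with w iv show "w \<in> ?R" by (auto simp: words_def)
  qed
  show "?R \<subseteq> words p q r" by (auto simp: words_def split: if_splits)
qed

lemma words_0: "words 0 0 0 = {[]}"
proof -
  have "w = []" if "w \<in> words 0 0 0" for w
    using that by (cases w) (auto simp: words_def)
  then show ?thesis by (auto simp: words_def)
qed

lemma finite_words: "finite (words p q r)"
proof (induction "p + q + r" arbitrary: p q r)
  case 0
  then show ?case by (simp add: words_0)
next
  case (Suc n)
  then have "0 < p + q + r" by linarith
  then show ?case using Suc by (subst words_rec) auto
qed

lemma sum_words_rec:
  fixes \<phi> :: "nat list \<Rightarrow> 'b::comm_monoid_add"
  assumes "0 < p + q + r"
  shows "sum \<phi> (words p q r) = (if 0 < p then \<Sum>w\<in>words (p - 1) q r. \<phi> (1 # w) else 0)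
    + (if 0 < q then \<Sum>w\<in>words p (q - 1) r. \<phi> (2 # w) else 0)
    + (if 0 < r then \<Sum>w\<in>words p q (r - 1). \<phi> (3 # w) else 0)"
proof -
  have im: "sum \<phi> ((#) i ` W) = (\<Sum>w\<in>W. \<phi> (i # w))" for i W
    by (subst sum.reindex) auto
  show ?thesis
    unfolding words_rec[OF assms]
    by (subst sum.union_disjoint, (auto simp: finite_words)[3])+ (auto simp: im)
qed

lemma card_words: "card (words p q r) * (fact p * fact q * fact r) = fact (p + q + r)"
proof (induction "p + q + r" arbitrary: p q r)
  case 0
  then show ?case by (simp add: words_0)
next
  case (Suc n)
  then have pos: "0 < p + q + r" by linarith
  have c: "card (words p q r) = (if 0 < p then card (words (p - 1) q r) else 0)
    + (if 0 < q then card (words p (q - 1) r) else 0) + (if 0 < r then card (words p q (r - 1)) else 0)"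
    using sum_words_rec[OF pos, of "\<lambda>_. 1::nat"] by simp
  have 1: "(if 0 < p then card (words (p - 1) q r) else 0) * (fact p * fact q * fact r) = p * fact n"
    using Suc.hyps(1)[of "p - 1" q r] Suc.hyps(2) by (cases p) (auto simp: algebra_simps)
  have 2: "(if 0 < q then card (words p (q - 1) r) else 0) * (fact p * fact q * fact r) = q * fact n"
    using Suc.hyps(1)[of p "q - 1" r] Suc.hyps(2) by (cases q) (auto simp: algebra_simps)
  have 3: "(if 0 < r then card (words p q (r - 1)) else 0) * (fact p * fact q * fact r) = r * fact n"
    using Suc.hyps(1)[of p q "r - 1"] Suc.hyps(2) by (cases r) (auto simp: algebra_simps)
  show ?case
    using Suc.hyps(2) unfolding c add_mult_distrib 1 2 3
    by (metis add_mult_distrib fact_Suc of_nat_id)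
qed

text \<open>The proportion of words that begin with a given letter. It turns the average over all
  words into a recursion in the first letter.\<close>

lemma card_words_pred:
  "0 < p \<Longrightarrow> (p + q + r) * card (words (p - 1) q r) = p * card (words p q r)"
  "0 < q \<Longrightarrow> (p + q + r) * card (words p (q - 1) r) = q * card (words p q r)"
  "0 < r \<Longrightarrow> (p + q + r) * card (words p q (r - 1)) = r * card (words p q r)"
proof -
  have step: "N * c' = p * c"
    if "c * (fact p * d) = fact N" "c' * (fact (p - 1) * d) = fact (N - 1)" "0 < p" "0 < N" "0 < d"
    for c c' d p N :: nat
  proof -
    have "(N * c') * (fact p * d) = N * p * (c' * (fact (p - 1) * d))"
      using that(3) by (simp add: fact_reduce mult_ac)
    also have "\<dots> = p * fact N"
      using that(4) unfolding that(2) by (simp add: fact_reduce mult_ac)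
    also have "\<dots> = (p * c) * (fact p * d)"
      unfolding that(1)[symmetric] by (simp add: mult_ac)
    finally show ?thesis using that(5) by simp
  qed
  show "(p + q + r) * card (words (p - 1) q r) = p * card (words p q r)" if "0 < p"
    using card_words[of p q r] card_words[of "p - 1" q r] that
    by (intro step[where d = "fact q * fact r"]) (auto simp: mult.assoc)
  show "(p + q + r) * card (words p (q - 1) r) = q * card (words p q r)" if "0 < q"
    using card_words[of p q r] card_words[of p "q - 1" r] that
    by (intro step[where d = "fact p * fact r"]) (auto simp: mult_ac)
  show "(p + q + r) * card (words p q (r - 1)) = r * card (words p q r)" if "0 < r"
    using card_words[of p q r] card_words[of p q "r - 1"] that
    by (intro step[where d = "fact p * fact q"]) (auto simp: mult_ac)
qed

text \<open>Passage from symmetric to normal order: choose j letters of each of the two kinds and a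
  matching between them; each matched pair stands in the wrong order in half of the words and then
  contributes a \<open>Z\<close>.\<close>

definition symm_coef :: "nat \<Rightarrow> nat \<Rightarrow> nat \<Rightarrow> complex" where
  "symm_coef p q j = of_nat ((p choose j) * (q choose j) * fact j) / 2 ^ j"

lemma symm_coef_rec:
  "of_nat p * symm_coef (p - 1) q j = (of_nat p - of_nat j) * symm_coef p q j"
  "of_nat q * symm_coef p (q - 1) j = (of_nat q - of_nat j) * symm_coef p q j"
  "(of_nat q - of_nat j) * (of_nat p - of_nat j) * symm_coef p q j = 2 * of_nat (Suc j) * symm_coef p q (Suc j)"
proof -
  have pred: "of_nat p * of_nat ((p - 1) choose j) = (of_nat p - of_nat j) * (of_nat (p choose j) :: complex)" for p
  proof (cases "j \<le> p")
    case True
    have "p * ((p - 1) choose j) = (p - j) * (p choose j)"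
      using binomial_absorb_comp[of p j] by simp
    then have "of_nat (p * ((p - 1) choose j)) = (of_nat ((p - j) * (p choose j)) :: complex)" by simp
    then show ?thesis using True by (simp add: of_nat_diff)
  qed (simp add: binomial_eq_0)
  have succ: "of_nat (Suc j) * of_nat (p choose Suc j) = (of_nat p - of_nat j) * (of_nat (p choose j) :: complex)" for p
  proof (cases "j \<le> p")
    case True
    have "Suc j * (p choose Suc j) = (p - j) * (p choose j)"
      by (cases p) (use binomial_absorption[of j p] binomial_absorb_comp[of p j] in simp_all)
    then have "of_nat (Suc j * (p choose Suc j)) = (of_nat ((p - j) * (p choose j)) :: complex)" by simp
    then show ?thesis using True by (simp only: of_nat_mult of_nat_diff)
  qed (simp add: binomial_eq_0)
  show "of_nat p * symm_coef (p - 1) q j = (of_nat p - of_nat j) * symm_coef p q j"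
    unfolding symm_coef_def of_nat_mult times_divide_eq_right mult.assoc[symmetric] pred ..
  have "of_nat q * symm_coef p (q - 1) j = (of_nat q * of_nat ((q - 1) choose j)) * of_nat ((p choose j) * fact j) / 2 ^ j"
    by (simp add: symm_coef_def mult_ac)
  then show "of_nat q * symm_coef p (q - 1) j = (of_nat q - of_nat j) * symm_coef p q j"
    unfolding pred by (simp add: symm_coef_def mult_ac)
  have "2 * of_nat (Suc j) * symm_coef p q (Suc j)
     = (of_nat (Suc j) * of_nat (p choose Suc j)) * (of_nat (Suc j) * of_nat (q choose Suc j)) * fact j / 2 ^ j"
    by (simp add: symm_coef_def field_simps)
  then show "(of_nat q - of_nat j) * (of_nat p - of_nat j) * symm_coef p q j = 2 * of_nat (Suc j) * symm_coef p q (Suc j)"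
    unfolding succ by (simp add: symm_coef_def mult_ac)
qed

context
  fixes F :: "real^3 \<Rightarrow> complex"
  assumes F: "F \<in> smooth3"
begin

abbreviation (input) ordered_sum :: "nat \<Rightarrow> nat \<Rightarrow> nat \<Rightarrow> real^3 \<Rightarrow> complex" where
  "ordered_sum p q r \<equiv> \<lambda>x. \<Sum>j\<le>p. symm_coef p q j * mon3 (p - j, q - j, j + r) F x"

lemma ordered_sum_fun: "ordered_sum p q r = (\<Sum>j\<le>p. cm (symm_coef p q j) (mon3 (p - j, q - j, j + r) F))"
  by (simp add: fun_eq_iff sum_fun_apply)

lemma Dop1_ordered_sum:
  "0 < p \<Longrightarrow> of_nat p * Dop1 (ordered_sum (p - 1) q r) x
     = (\<Sum>j\<le>p. (of_nat p - of_nat j) * symm_coef p q j * mon3 (p - j, q - j, j + r) F x)"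
proof -
  assume p: "0 < p"
  have "Dop1 (ordered_sum (p - 1) q r) x
      = (\<Sum>j\<le>p - 1. symm_coef (p - 1) q j * mon3 (Suc (p - 1 - j), q - j, j + r) F x)"
    unfolding ordered_sum_fun
    by (simp add: fn.lin_op_sum_scale[OF R3.S R3.X] R3.pbw_closed F sum_fun_apply R3.X_pbw)
  then have "of_nat p * Dop1 (ordered_sum (p - 1) q r) x
      = (\<Sum>j\<le>p - 1. (of_nat p * symm_coef (p - 1) q j) * mon3 (Suc (p - 1 - j), q - j, j + r) F x)"
    by (simp add: sum_distrib_left mult.assoc)
  also have "\<dots> = (\<Sum>j\<le>p - 1. (of_nat p - of_nat j) * symm_coef p q j * mon3 (p - j, q - j, j + r) F x)"
    unfolding symm_coef_rec(1) using p by (intro sum.cong refl) (auto simp: Suc_diff_Suc Suc_diff_le)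
  also have "\<dots> = (\<Sum>j\<le>p. (of_nat p - of_nat j) * symm_coef p q j * mon3 (p - j, q - j, j + r) F x)"
    using p by (intro sum.mono_neutral_left) (auto simp: le_less not_le)
  finally show ?thesis .
qed

text \<open>The summand 2j collects the terms in which \<open>Dop2\<close> passes a
  \<open>Dop1\<close> and produces a \<open>Dop3\<close>. Together with p - j from
  \<open>Dop1\<close> and r from \<open>Dop3\<close> the factors add up to p + q + r for every j,
  the length of the words, as the recursion in the first letter demands.\<close>

lemma Dop2_ordered_sum:
  "0 < q \<Longrightarrow> of_nat q * Dop2 (ordered_sum p (q - 1) r) x
     = (\<Sum>j\<le>p. (of_nat q - of_nat j + 2 * of_nat j) * symm_coef p q j * mon3 (p - j, q - j, j + r) F x)"
proof -
  assume q: "0 < q"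
  let ?P = "\<lambda>j. mon3 (p - j, q - j, j + r) F x"
  have "Dop2 (ordered_sum p (q - 1) r) x
      = (\<Sum>j\<le>p. symm_coef p (q - 1) j * (mon3 (p - j, Suc (q - 1 - j), j + r) F x
          + of_nat (p - j) * mon3 (p - j - 1, q - 1 - j, Suc (j + r)) F x))"
    unfolding ordered_sum_fun
    by (simp add: fn.lin_op_sum_scale[OF R3.S R3.Y] R3.pbw_closed F sum_fun_apply R3.Y_pbw)
  then have "of_nat q * Dop2 (ordered_sum p (q - 1) r) x
      = (\<Sum>j\<le>p. (of_nat q * symm_coef p (q - 1) j) * (mon3 (p - j, Suc (q - 1 - j), j + r) F x
          + of_nat (p - j) * mon3 (p - j - 1, q - 1 - j, Suc (j + r)) F x))"
    by (simp add: sum_distrib_left mult.assoc)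
  also have "\<dots> = (\<Sum>j\<le>p. (of_nat q - of_nat j) * symm_coef p q j * ?P j
      + (of_nat q - of_nat j) * (of_nat p - of_nat j) * symm_coef p q j * ?P (Suc j))"
  proof (intro sum.cong refl)
    fix j assume "j \<in> {..p}"
    then have j: "of_nat (p - j) = (of_nat p - of_nat j :: complex)" by (simp add: of_nat_diff)
    have "symm_coef p q j = 0" if "q < j" using that by (simp add: symm_coef_def binomial_eq_0)
    \<comment> \<open>For j = q the truncated subtraction \<open>Suc (q - 1 - j)\<close> differs
      from \<open>q - j\<close>, but the factor q - j is then zero; for larger j the coefficient
      itself vanishes.\<close>
    then consider "symm_coef p q j = 0" | "j = q" | "j < q" by linarith
    then show "(of_nat q * symm_coef p (q - 1) j) * (mon3 (p - j, Suc (q - 1 - j), j + r) F x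
          + of_nat (p - j) * mon3 (p - j - 1, q - 1 - j, Suc (j + r)) F x)
        = (of_nat q - of_nat j) * symm_coef p q j * ?P j
      + (of_nat q - of_nat j) * (of_nat p - of_nat j) * symm_coef p q j * ?P (Suc j)"
      unfolding symm_coef_rec(2) j
    proof cases
      case 3
      then have "Suc (q - 1 - j) = q - j" "q - 1 - j = q - Suc j" "p - j - 1 = p - Suc j" by auto
      then show "(of_nat q - of_nat j) * symm_coef p q j * (mon3 (p - j, Suc (q - 1 - j), j + r) F x
          + (of_nat p - of_nat j) * mon3 (p - j - 1, q - 1 - j, Suc (j + r)) F x)
        = (of_nat q - of_nat j) * symm_coef p q j * ?P j
      + (of_nat q - of_nat j) * (of_nat p - of_nat j) * symm_coef p q j * ?P (Suc j)"
        by (simp only: add_Suc) (simp add: algebra_simps)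
    qed auto
  qed
  also have "\<dots> = (\<Sum>j\<le>p. (of_nat q - of_nat j) * symm_coef p q j * ?P j)
      + (\<Sum>j\<le>p. 2 * of_nat (Suc j) * symm_coef p q (Suc j) * ?P (Suc j))"
    unfolding symm_coef_rec(3) by (rule sum.distrib)
  also have "(\<Sum>j\<le>p. 2 * of_nat (Suc j) * symm_coef p q (Suc j) * ?P (Suc j))
      = (\<Sum>j\<le>Suc p. 2 * of_nat j * symm_coef p q j * ?P j)"
    unfolding sum.atMost_Suc_shift by simp
  also have "\<dots> = (\<Sum>j\<le>p. 2 * of_nat j * symm_coef p q j * ?P j)"
    by (simp add: symm_coef_def)
  finally show ?thesis by (simp only: sum.distrib[symmetric] distrib_right)
qed

end

text \<open>Both sides satisfy the recursion in the first letter of the word.\<close>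

lemma sum_words_ordered:
  assumes F: "F \<in> smooth3"
  shows "(\<Sum>w\<in>words p q r. word_op w F x)
    = of_nat (card (words p q r)) * (\<Sum>j\<le>p. symm_coef p q j * mon3 (p - j, q - j, j + r) F x)"
proof (induction "p + q + r" arbitrary: p q r x)
  case 0
  then show ?case by (simp add: words_0 symm_coef_def fn.pbw_def)
next
  case (Suc n)
  then have pos: "0 < p + q + r" by linarith
  let ?O = "\<lambda>p q r x. \<Sum>j\<le>p. symm_coef p q j * mon3 (p - j, q - j, j + r) F x"
  let ?N = "of_nat (p + q + r) :: complex" and ?c = "of_nat (card (words p q r)) :: complex"
  have O: "?O p q r \<in> smooth3" for p q r
    unfolding ordered_sum_fun[OF F] by (intro fn.subspace_sum fn.subspace_scale R3.S mon3_smooth3 F)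
  have W: "(\<lambda>x. \<Sum>w\<in>words p q r. word_op w F x) = (\<Sum>w\<in>words p q r. word_op w F)" for p q r
    by (simp add: fun_eq_iff sum_fun_apply)
  have IH: "(\<lambda>x. \<Sum>w\<in>words p q r. word_op w F x) = cm (of_nat (card (words p q r))) (?O p q r)"
    if "n = p + q + r" for p q r
    using Suc.hyps(1)[OF that] by (simp add: fun_eq_iff)
  have D: "(\<Sum>w\<in>words p q r. Dop i (word_op w F) x) = of_nat (card (words p q r)) * Dop i (?O p q r) x"
    if n: "n = p + q + r" for p q r i
  proof -
    have lin: "fn.lin_op smooth3 (Dop i)" by (simp add: Dop_def lin_op_Dop)
    have "(\<Sum>w\<in>words p q r. Dop i (word_op w F)) = Dop i (\<lambda>x. \<Sum>w\<in>words p q r. word_op w F x)"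
      unfolding W by (rule fn.lin_op_sum[OF R3.S lin, symmetric]) (rule word_op_smooth3[OF F])
    also have "\<dots> = cm (of_nat (card (words p q r))) (Dop i (?O p q r))"
      unfolding IH[OF n] by (rule fn.lin_opD(3)[OF lin O])
    finally show ?thesis by (simp add: fun_eq_iff sum_fun_apply)
  qed
  have c: "?N * of_nat (card (words (p - 1) q r)) = of_nat p * ?c" if "0 < p"
    using card_words_pred(1)[OF that, of q r] by (metis of_nat_mult)
  have c': "?N * of_nat (card (words p (q - 1) r)) = of_nat q * ?c" if "0 < q"
    using card_words_pred(2)[OF that, of p r] by (metis of_nat_mult)
  have c'': "?N * of_nat (card (words p q (r - 1))) = of_nat r * ?c" if "0 < r"
    using card_words_pred(3)[OF that, of p q] by (metis of_nat_mult)
  let ?s = "\<lambda>j. symm_coef p q j * mon3 (p - j, q - j, j + r) F x"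
  have 1: "?N * (if 0 < p then \<Sum>w\<in>words (p - 1) q r. word_op (1 # w) F x else 0)
      = ?c * (\<Sum>j\<le>p. (of_nat p - of_nat j) * ?s j)"
  proof (cases "0 < p")
    case True
    then have n: "n = p - 1 + q + r" using Suc.hyps(2) by simp
    have d: "Dop 1 = Dop1" by (simp add: Dop_def)
    have "?N * (\<Sum>w\<in>words (p - 1) q r. word_op (1 # w) F x)
       = (?N * of_nat (card (words (p - 1) q r))) * Dop1 (?O (p - 1) q r) x"
      using D[OF n, of 1] unfolding d by (simp add: mult.assoc d[simplified])
    also have "\<dots> = ?c * (of_nat p * Dop1 (?O (p - 1) q r) x)"
      unfolding c[OF True] by simp
    also have "\<dots> = ?c * (\<Sum>j\<le>p. (of_nat p - of_nat j) * ?s j)"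
      unfolding Dop1_ordered_sum[OF F True] by (simp add: mult.assoc)
    finally show ?thesis using True by simp
  qed simp
  have 2: "?N * (if 0 < q then \<Sum>w\<in>words p (q - 1) r. word_op (2 # w) F x else 0)
      = ?c * (\<Sum>j\<le>p. (of_nat q - of_nat j + 2 * of_nat j) * ?s j)"
  proof (cases "0 < q")
    case True
    then have n: "n = p + (q - 1) + r" using Suc.hyps(2) by simp
    have d: "Dop 2 = Dop2" by (simp add: Dop_def)
    have "?N * (\<Sum>w\<in>words p (q - 1) r. word_op (2 # w) F x)
       = (?N * of_nat (card (words p (q - 1) r))) * Dop2 (?O p (q - 1) r) x"
      using D[OF n, of 2] unfolding d by (simp add: mult.assoc d)
    also have "\<dots> = ?c * (of_nat q * Dop2 (?O p (q - 1) r) x)"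
      unfolding c'[OF True] by simp
    also have "\<dots> = ?c * (\<Sum>j\<le>p. (of_nat q - of_nat j + 2 * of_nat j) * ?s j)"
      unfolding Dop2_ordered_sum[OF F True] by (simp add: mult.assoc)
    finally show ?thesis using True by simp
  next
    case False
    then have "?s j = 0" if "j \<noteq> 0" for j using that by (simp add: symm_coef_def)
    then have "(of_nat q - of_nat j + 2 * of_nat j) * ?s j = 0" for j
      using False by (cases "j = 0") auto
    then have "(\<Sum>j\<le>p. (of_nat q - of_nat j + 2 * of_nat j) * ?s j) = 0"
      by (intro sum.neutral ballI)
    then show ?thesis unfolding if_not_P[OF False] by simp
  qed
  have 3: "?N * (if 0 < r then \<Sum>w\<in>words p q (r - 1). word_op (3 # w) F x else 0)
      = ?c * (of_nat r * ?O p q r x)"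
  proof (cases "0 < r")
    case True
    then have n: "n = p + q + (r - 1)" using Suc.hyps(2) by simp
    have d: "Dop 3 = Dop3" by (simp add: Dop_def)
    have "?N * (\<Sum>w\<in>words p q (r - 1). word_op (3 # w) F x)
       = (?N * of_nat (card (words p q (r - 1)))) * Dop3 (?O p q (r - 1)) x"
      using D[OF n, of 3] unfolding d by (simp add: mult.assoc d)
    also have "\<dots> = ?c * (of_nat r * Dop3 (?O p q (r - 1)) x)"
      unfolding c''[OF True] by simp
    also have "Dop3 (?O p q (r - 1)) x = ?O p q r x"
      unfolding ordered_sum_fun[OF F] using True
      by (simp add: fn.lin_op_sum_scale[OF R3.S R3.Z] R3.pbw_closed F sum_fun_apply R3.Z_pbw)
    finally show ?thesis using True by simp
  qed simp
  have "?N * (\<Sum>w\<in>words p q r. word_op w F x) = ?c * (\<Sum>j\<le>p. (of_nat p - of_nat j) * ?s j)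
      + ?c * (\<Sum>j\<le>p. (of_nat q - of_nat j + 2 * of_nat j) * ?s j) + ?c * (of_nat r * ?O p q r x)"
    unfolding sum_words_rec[OF pos] distrib_left 1 2 3 ..
  also have "\<dots> = ?c * (\<Sum>j\<le>p. (of_nat p - of_nat j) * ?s j + (of_nat q - of_nat j + 2 * of_nat j) * ?s j + of_nat r * ?s j)"
    by (simp only: sum.distrib distrib_left sum_distrib_left)
  also have "\<dots> = ?N * (?c * ?O p q r x)"
    by (simp add: sum_distrib_left algebra_simps)
  finally have "?N * (\<Sum>w\<in>words p q r. word_op w F x) = ?N * (?c * ?O p q r x)" .
  moreover have "?N \<noteq> 0" using pos by (simp only: of_nat_eq_0_iff)
  ultimately show ?case by (simp only: mult_cancel_left simp_thms)
qed

lemma symm_ordered: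
  assumes F: "F \<in> smooth3"
  shows "symm p q r F x = (\<Sum>j\<le>min p q. symm_coef p q j * mon3 (p - j, q - j, j + r) F x)"
proof -
  have "card (words p q r) \<noteq> 0"
    using card_words[of p q r] by (metis fact_nonzero mult_0)
  then have "symm p q r F x = (\<Sum>j\<le>p. symm_coef p q j * mon3 (p - j, q - j, j + r) F x)"
    by (simp add: symm_def sum_words_ordered[OF F])
  also have "\<dots> = (\<Sum>j\<le>min p q. symm_coef p q j * mon3 (p - j, q - j, j + r) F x)"
    by (rule sum.mono_neutral_right) (auto simp: symm_coef_def binomial_eq_0)
  finally show ?thesis .
qed

text \<open>Normalized to 1 at n = 0. The parameter \<open>\<tau>\<close> becomes l in family b, 0
  in family b' and (k + s)/2 in family c.\<close>

definition sing_coef :: "nat \<Rightarrow> complex \<Rightarrow> nat \<Rightarrow> complex" where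
  "sing_coef k \<tau> n = of_nat (k choose n) * falling \<tau> n"

lemma nform_apply:
  "R3.nform k l a F x = (\<Sum>n\<le>min k l. a n * mon3 (k - n, l - n, n) F x)"
  by (simp add: R3.nform_def sum_fun_apply)

text \<open>One computation for all symmetrized operators: \<open>\<theta> m\<close> is m! (l choose
  m) up to sign for \<open>Dpm\<close>, and a Cayley continuant for \<open>Dc\<close>. After
  reordering and collecting by the final power n of \<open>Dop3\<close>, the coefficient is (k
  choose n)/2^n times the sum in the assumption.\<close>

lemma symm_sum_nform:
  assumes F: "F \<in> smooth3"
    and \<theta>: "\<And>n. n \<le> min k l \<Longrightarrow>
      (\<Sum>m\<le>n. of_nat (n choose m) * \<theta> m * falling (of_nat (l - m)) (n - m)) = 2 ^ n * falling \<tau> n"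
  shows "(\<Sum>m\<le>min k l. of_nat (k choose m) * \<theta> m / 2 ^ m * symm (k - m) (l - m) m F x)
    = R3.nform k l (sing_coef k \<tau>) F x"
proof -
  let ?M = "min k l"
  let ?g = "\<lambda>m n. of_nat (k choose m) * \<theta> m / 2 ^ m * symm_coef (k - m) (l - m) (n - m) * mon3 (k - n, l - n, n) F x"
  have "(\<Sum>m\<le>?M. of_nat (k choose m) * \<theta> m / 2 ^ m * symm (k - m) (l - m) m F x)
      = (\<Sum>m\<le>?M. \<Sum>j\<le>?M - m. ?g m (m + j))"
  proof (intro sum.cong refl)
    fix m
    have "min (k - m) (l - m) = ?M - m" by simp
    then show "of_nat (k choose m) * \<theta> m / 2 ^ m * symm (k - m) (l - m) m F x = (\<Sum>j\<le>?M - m. ?g m (m + j))"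
      unfolding symm_ordered[OF F] by (simp add: sum_distrib_left mult.assoc add.commute)
  qed
  also have "\<dots> = (\<Sum>n\<le>?M. \<Sum>m\<le>n. ?g m n)"
    by (rule sum_triangle)
  also have "\<dots> = (\<Sum>n\<le>?M. sing_coef k \<tau> n * mon3 (k - n, l - n, n) F x)"
  proof (intro sum.cong refl)
    fix n assume "n \<in> {..?M}"
    then have n: "n \<le> ?M" by simp
    have "of_nat (k choose m) * \<theta> m / 2 ^ m * symm_coef (k - m) (l - m) (n - m)
        = of_nat (k choose n) / 2 ^ n * (of_nat (n choose m) * \<theta> m * falling (of_nat (l - m)) (n - m))" if m: "m \<le> n" for m
    proof -
      have "(k choose n) * (n choose m) = (k choose m) * ((k - m) choose (n - m))"
        using choose_mult[OF m] n by simp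
      then have ch: "of_nat (k choose m) * of_nat ((k - m) choose (n - m)) = (of_nat (k choose n) * of_nat (n choose m) :: complex)"
        by (metis of_nat_mult)
      have pw: "(2::complex) ^ n = 2 ^ m * 2 ^ (n - m)" using m by (simp add: power_add[symmetric])
      have "of_nat (k choose m) * \<theta> m / 2 ^ m * symm_coef (k - m) (l - m) (n - m)
        = (of_nat (k choose m) * of_nat ((k - m) choose (n - m))) * (\<theta> m * falling (of_nat (l - m)) (n - m)) / (2 ^ m * 2 ^ (n - m))"
        unfolding falling_of_nat symm_coef_def by (simp add: mult_ac)
      also have "\<dots> = of_nat (k choose n) / 2 ^ n * (of_nat (n choose m) * \<theta> m * falling (of_nat (l - m)) (n - m))"
        unfolding ch pw by (simp add: mult_ac)
      finally show ?thesis .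
    qed
    then have "(\<Sum>m\<le>n. ?g m n) = (\<Sum>m\<le>n. of_nat (k choose n) / 2 ^ n *
        (of_nat (n choose m) * \<theta> m * falling (of_nat (l - m)) (n - m)) * mon3 (k - n, l - n, n) F x)"
      by (intro sum.cong refl) simp
    also have "\<dots> = of_nat (k choose n) / 2 ^ n * (2 ^ n * falling \<tau> n) * mon3 (k - n, l - n, n) F x"
      unfolding \<theta>[OF n, symmetric] by (simp add: sum_distrib_left sum_distrib_right)
    finally show "(\<Sum>m\<le>n. ?g m n) = sing_coef k \<tau> n * mon3 (k - n, l - n, n) F x"
      by (simp add: sing_coef_def)
  qed
  finally show ?thesis by (simp add: nform_apply)
qed

lemma Dc_nform:
  assumes "F \<in> smooth3"
  shows "Dc s k F = R3.nform k k (sing_coef k ((of_nat k + s) / 2)) F"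
proof
  fix x
  show "Dc s k F x = R3.nform k k (sing_coef k ((of_nat k + s) / 2)) F x"
    using symm_sum_nform[OF assms, of k k "\<lambda>m. Cay m s (of_nat k)" "(of_nat k + s) / 2" x] Cay_binomial_sum[of _ k s]
    by (simp add: Dc_def atMost_atLeast0)
qed

text \<open>All falling factorials merge into one of length n, and the binomial theorem leaves
  (\<sigma> + 1)^n with \<sigma> the sign. For the minus sign only n = 0 survives, so on smooth
  functions \<open>Dpm False k l\<close> is simply \<open>Dop1\<close> to the power k after
  \<open>Dop2\<close> to the power l.\<close>

lemma Dpm_nform:
  assumes "F \<in> smooth3"
  shows "Dpm pos k l F = R3.nform k l (sing_coef k (if pos then of_nat l else 0)) F"
proof
  fix x
  let ?\<sigma> = "if pos then 1 else -1 :: complex"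
  let ?\<theta> = "\<lambda>m. ?\<sigma> ^ m * of_nat (fact m * (l choose m))"
  let ?\<tau> = "if pos then of_nat l else 0 :: complex"
  have "(\<Sum>m\<le>n. of_nat (n choose m) * ?\<theta> m * falling (of_nat (l - m)) (n - m)) = 2 ^ n * falling ?\<tau> n"
    if n: "n \<le> min k l" for n
  proof -
    have "(\<Sum>m\<le>n. of_nat (n choose m) * ?\<theta> m * falling (of_nat (l - m)) (n - m))
        = (\<Sum>m\<le>n. of_nat (n choose m) * ?\<sigma> ^ m * 1 ^ (n - m) * falling (of_nat l) n)"
    proof (intro sum.cong refl)
      fix m assume "m \<in> {..n}"
      then have m: "m \<le> n" by simp
      then have "falling (of_nat l) n = of_nat (fact m * (l choose m)) * falling (of_nat (l - m)) (n - m)"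
        using falling_add[of "of_nat l" m "n - m"] n by (simp add: falling_of_nat[of l m] of_nat_diff)
      then show "of_nat (n choose m) * ?\<theta> m * falling (of_nat (l - m)) (n - m)
          = of_nat (n choose m) * ?\<sigma> ^ m * 1 ^ (n - m) * falling (of_nat l) n"
        by (simp add: mult_ac)
    qed
    also have "\<dots> = (?\<sigma> + 1) ^ n * falling (of_nat l) n"
      unfolding sum_distrib_right[symmetric] binomial_ring ..
    also have "\<dots> = 2 ^ n * falling ?\<tau> n"
      by (cases n) (auto simp: falling_def prod.lessThan_Suc_shift)
    finally show ?thesis .
  qed
  from symm_sum_nform[OF assms, of k l ?\<theta> ?\<tau> x, OF this]
  show "Dpm pos k l F x = R3.nform k l (sing_coef k ?\<tau>) F x"
    unfolding Dpm_def atMost_atLeast0 by (cases pos) (simp_all add: mult_ac)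
qed

lemma word_op_replicate: "word_op (replicate n i) F = (Dop i ^^ n) F"
  by (induction n) simp_all

lemma Dpow_nform:
  "Dpow 1 k F = R3.nform k 0 (sing_coef k \<tau>) F"
  "Dpow 2 l F = R3.nform 0 l (sing_coef 0 \<tau>) F"
  by (simp_all add: fun_eq_iff Dpow_def word_op_replicate nform_apply sing_coef_def fn.pbw_def Dop_def)

lemma id_nform: "F = R3.nform 0 0 (sing_coef 0 \<tau>) F"
  by (simp add: fun_eq_iff nform_apply sing_coef_def fn.pbw_def)

section \<open>Left-invariant vector fields on the group\<close>

lemma mk3_nth [simp]:
  "mk3 a b c d e f g h i $ 1 $ 1 = a" "mk3 a b c d e f g h i $ 1 $ 2 = b" "mk3 a b c d e f g h i $ 1 $ 3 = c"
  "mk3 a b c d e f g h i $ 2 $ 1 = d" "mk3 a b c d e f g h i $ 2 $ 2 = e" "mk3 a b c d e f g h i $ 2 $ 3 = f"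
  "mk3 a b c d e f g h i $ 3 $ 1 = g" "mk3 a b c d e f g h i $ 3 $ 2 = h" "mk3 a b c d e f g h i $ 3 $ 3 = i"
  by (simp_all add: mk3_def)

lemma mat3_eq_iff: "(A::mat3) = B \<longleftrightarrow> A$1$1 = B$1$1 \<and> A$1$2 = B$1$2 \<and> A$1$3 = B$1$3 \<and>
  A$2$1 = B$2$1 \<and> A$2$2 = B$2$2 \<and> A$2$3 = B$2$3 \<and> A$3$1 = B$3$1 \<and> A$3$2 = B$3$2 \<and> A$3$3 = B$3$3"
  by (auto simp: vec_eq_iff forall_3)

lemma mat3_mult_nth: "((A::mat3) ** B) $ i $ j = A$i$1 * B$1$j + A$i$2 * B$2$j + A$i$3 * B$3$j"
  by (simp add: matrix_matrix_mult_def sum_3)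

lemma mat_1_nth: "(mat 1 :: mat3) $ i $ j = (if i = j then 1 else 0)"
  by (simp add: mat_def)

lemma mk3_mult: "mk3 a b c d e f g h i ** mk3 a' b' c' d' e' f' g' h' i' =
  mk3 (a*a' + b*d' + c*g') (a*b' + b*e' + c*h') (a*c' + b*f' + c*i')
      (d*a' + e*d' + f*g') (d*b' + e*e' + f*h') (d*c' + e*f' + f*i')
      (g*a' + h*d' + i*g') (g*b' + h*e' + i*h') (g*c' + h*f' + i*i')"
  by (simp add: mat3_eq_iff mat3_mult_nth)

lemma mk3_diff: "mk3 a b c d e f g h i - mk3 a' b' c' d' e' f' g' h' i' =
  mk3 (a-a') (b-b') (c-c') (d-d') (e-e') (f-f') (g-g') (h-h') (i-i')"
  by (simp add: mat3_eq_iff)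

lemma mk3_scaleR: "r *\<^sub>R mk3 a b c d e f g h i = mk3 (r*a) (r*b) (r*c) (r*d) (r*e) (r*f) (r*g) (r*h) (r*i)"
  by (simp add: mat3_eq_iff)

lemma mat_1_mk3: "(mat 1 :: mat3) = mk3 1 0 0 0 1 0 0 0 1"
  by (simp add: mat3_eq_iff mat_1_nth)

lemma det_mk3: "det (mk3 a b c d e f g h i) = a*e*i + b*f*g + c*d*h - a*f*h - b*d*i - c*e*g"
  by (simp add: det_3)

lemma SL3_mult: "g \<in> SL3 \<Longrightarrow> h \<in> SL3 \<Longrightarrow> g ** h \<in> SL3"
  by (simp add: SL3_def det_mul)

lemma SL3_one: "mat 1 \<in> SL3"
  by (simp add: SL3_def)

lemma SL3_inverse:
  assumes "g \<in> SL3"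
  shows "g ** matrix_inv g = mat 1" "matrix_inv g ** g = mat 1" "matrix_inv g \<in> SL3"
proof -
  have "invertible g" using assms by (simp add: SL3_def invertible_det_nz)
  then show 1: "g ** matrix_inv g = mat 1" and "matrix_inv g ** g = mat 1"
    unfolding invertible_def matrix_inv_def by (metis (mono_tags, lifting) someI_ex)+
  have "det g * det (matrix_inv g) = 1" using arg_cong[OF 1, of det] by (simp add: det_mul)
  then show "matrix_inv g \<in> SL3" using assms by (simp add: SL3_def)
qed

lemma SL3_mult_left_iff: "g \<in> SL3 \<Longrightarrow> g ** h \<in> SL3 \<longleftrightarrow> h \<in> SL3"
  by (simp add: SL3_def det_mul)

lemma bounded_linear_mat3_mult:
  "bounded_linear (\<lambda>g::mat3. g ** A)" "bounded_linear (\<lambda>g::mat3. A ** g)"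
  by (intro linear_conv_bounded_linear[THEN iffD1] linearI;
      simp add: mat3_eq_iff mat3_mult_nth algebra_simps)+

lemma nbar_SL3: "nbar x \<in> SL3"
  by (simp add: nbar_def SL3_def det_mk3)

lemma nbar_0: "nbar 0 = mat 1"
  by (simp add: nbar_def mat_1_mk3)

text \<open>A curve representing the Lie algebra element \<open>A\<close>. Only the velocity at the
  identity enters a right derivative (\<open>Rd_ext\<close>), so elementary matrices can serve as
  curves.\<close>

definition lie_curve :: "(real \<Rightarrow> mat3) \<Rightarrow> mat3 \<Rightarrow> bool" where
  "lie_curve \<gamma> A \<longleftrightarrow> (\<gamma> has_vector_derivative A) (at 0) \<and> \<gamma> 0 = mat 1 \<and> (\<forall>t. \<gamma> t \<in> SL3)"

text \<open>The left-invariant field of the curve. The value zero off \<open>SL3\<close>, together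
  with \<open>smoothG\<close>, makes the commutation relations equations between functions on all
  matrices.\<close>

definition Rd :: "(real \<Rightarrow> mat3) \<Rightarrow> (mat3 \<Rightarrow> complex) \<Rightarrow> mat3 \<Rightarrow> complex" where
  "Rd \<gamma> f g = (if g \<in> SL3 then vector_derivative (\<lambda>t. f (g ** \<gamma> t)) (at 0) else 0)"

definition smoothG :: "(mat3 \<Rightarrow> complex) set" where
  "smoothG = {f. smooth_on_G f \<and> (\<forall>g. g \<notin> SL3 \<longrightarrow> f g = 0)}"

lemma smooth_on_G_ext:
  assumes "smooth_on_G f" "g \<in> SL3"
  obtains U F where "open U" "SL3 \<subseteq> U" "smooth_on U F" "\<And>g. g \<in> SL3 \<Longrightarrow> F g = f g"
  using assms unfolding smooth_on_G_def by blast

lemma ext_has_vector_derivative: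
  assumes \<gamma>: "lie_curve \<gamma> A" and g: "g \<in> SL3"
    and F: "open U" "SL3 \<subseteq> U" "smooth_on U F" "\<And>g. g \<in> SL3 \<Longrightarrow> F g = f g"
  shows "((\<lambda>t. f (g ** \<gamma> t)) has_vector_derivative frechet_derivative F (at g) (g ** A)) (at 0)"
proof -
  have \<gamma>': "(\<gamma> has_vector_derivative A) (at 0)" "\<gamma> 0 = mat 1" "\<gamma> t \<in> SL3" for t
    using \<gamma> by (auto simp: lie_curve_def)
  have "((\<lambda>t. g ** \<gamma> t) has_vector_derivative g ** A) (at 0)"
    by (rule bounded_linear.has_vector_derivative[OF bounded_linear_mat3_mult(2) \<gamma>'(1)])
  moreover have "(F has_derivative frechet_derivative F (at g)) (at (g ** \<gamma> 0))"
    using smooth_on_derivative[OF F(1,3), of g] g F(2) by (auto simp: \<gamma>'(2))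
  ultimately have "((F \<circ> (\<lambda>t. g ** \<gamma> t)) has_vector_derivative frechet_derivative F (at g) (g ** A)) (at 0)"
    by (intro vector_derivative_diff_chain_within) (auto intro: has_derivative_at_withinI)
  then show ?thesis
    using F(4) g \<gamma>'(3) by (simp add: o_def SL3_mult)
qed

lemma Rd_ext:
  assumes "lie_curve \<gamma> A" "g \<in> SL3" "open U" "SL3 \<subseteq> U" "smooth_on U F" "\<And>g. g \<in> SL3 \<Longrightarrow> F g = f g"
  shows "Rd \<gamma> f g = along (\<lambda>g. g ** A) F g"
  using vector_derivative_at[OF ext_has_vector_derivative[OF assms]] assms(2)
  by (simp add: Rd_def along_def)

lemma Rd_has_vector_derivative:
  assumes "lie_curve \<gamma> A" "g \<in> SL3" "smooth_on_G f"
  shows "((\<lambda>t. f (g ** \<gamma> t)) has_vector_derivative Rd \<gamma> f g) (at 0)"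
proof -
  obtain U F where "open U" "SL3 \<subseteq> U" "smooth_on U F" "\<And>g. g \<in> SL3 \<Longrightarrow> F g = f g"
    using smooth_on_G_ext[OF assms(3,2)] by blast
  from ext_has_vector_derivative[OF assms(1,2) this] show ?thesis
    using assms(2) by (simp add: Rd_def vector_derivative_at)
qed

lemma smooth_on_mat3_mult:
  "open U \<Longrightarrow> smooth_on U (\<lambda>g::mat3. g ** A)" "open U \<Longrightarrow> smooth_on U (\<lambda>g::mat3. A ** g)"
  by (intro smooth_on_linear bounded_linear_mat3_mult; assumption)+

lemma Rd_smooth_on_G:
  assumes "lie_curve \<gamma> A" "smooth_on_G f"
  shows "smooth_on_G (Rd \<gamma> f)"
proof -
  obtain U F where F: "open U" "SL3 \<subseteq> U" "smooth_on U F" "\<And>g. g \<in> SL3 \<Longrightarrow> F g = f g"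
    using smooth_on_G_ext[OF assms(2) SL3_one] by blast
  have "smooth_on U (along (\<lambda>g. g ** A) F)"
    by (rule smooth_on_along[OF F(1,3) smooth_on_mat3_mult(1)[OF F(1)]])
  then show ?thesis
    unfolding smooth_on_G_def using Rd_ext[OF assms(1) _ F] F(1,2) by metis
qed

lemma smoothG_Rd: "lie_curve \<gamma> A \<Longrightarrow> f \<in> smoothG \<Longrightarrow> Rd \<gamma> f \<in> smoothG"
  using Rd_smooth_on_G by (auto simp: smoothG_def Rd_def)

lemma smooth_on_G_add:
  assumes "smooth_on_G f" "smooth_on_G g"
  shows "smooth_on_G (\<lambda>x. f x + g x)"
proof -
  obtain U F where F: "open U" "SL3 \<subseteq> U" "smooth_on U F" "\<And>g. g \<in> SL3 \<Longrightarrow> F g = f g"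
    using smooth_on_G_ext[OF assms(1) SL3_one] by blast
  obtain V H where H: "open V" "SL3 \<subseteq> V" "smooth_on V H" "\<And>x. x \<in> SL3 \<Longrightarrow> H x = g x"
    using smooth_on_G_ext[OF assms(2) SL3_one] by blast
  have o: "open (U \<inter> V)" using F(1) H(1) by blast
  have "smooth_on (U \<inter> V) (\<lambda>x. F x + H x)"
    using smooth_on_add[OF o smooth_on_subset[OF F(3,1) o] smooth_on_subset[OF H(3,1) o]] by simp
  then show ?thesis
    unfolding smooth_on_G_def using o F(2,4) H(2,4) by (intro exI[of _ "U \<inter> V"] exI[of _ "\<lambda>x. F x + H x"]) auto
qed

lemma smooth_on_G_mult_const:
  assumes "smooth_on_G f"
  shows "smooth_on_G (\<lambda>x. c * f x)"
proof -
  obtain U F where F: "open U" "SL3 \<subseteq> U" "smooth_on U F" "\<And>g. g \<in> SL3 \<Longrightarrow> F g = f g"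
    using smooth_on_G_ext[OF assms SL3_one] by blast
  have "smooth_on U (\<lambda>x. c * F x)" by (intro smooth_on_mult smooth_on_const F)
  then show ?thesis
    unfolding smooth_on_G_def using F by (intro exI[of _ U] exI[of _ "\<lambda>x. c * F x"]) auto
qed

lemma smooth_on_G_zero: "smooth_on_G (\<lambda>x. 0)"
  unfolding smooth_on_G_def by (intro exI[of _ UNIV] exI[of _ "\<lambda>x. 0"]) (simp add: smooth_on_const)

lemma subspace_smoothG: "fn.subspace smoothG"
proof -
  have "(0::mat3 \<Rightarrow> complex) \<in> smoothG"
    unfolding zero_fun_def by (simp add: smoothG_def smooth_on_G_zero)
  moreover have "f + g \<in> smoothG" if "f \<in> smoothG" "g \<in> smoothG" for f g
    unfolding plus_fun_def using that by (simp add: smoothG_def smooth_on_G_add)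
  ultimately show ?thesis
    unfolding fn.subspace_def by (simp add: cm_def smoothG_def smooth_on_G_mult_const)
qed

lemma lin_op_Rd:
  assumes \<gamma>: "lie_curve \<gamma> A"
  shows "fn.lin_op smoothG (Rd \<gamma>)"
proof -
  have "Rd \<gamma> (\<lambda>x. f x + h x) g = Rd \<gamma> f g + Rd \<gamma> h g" if "f \<in> smoothG" "h \<in> smoothG" for f h g
  proof (cases "g \<in> SL3")
    case True
    have "((\<lambda>t. f (g ** \<gamma> t) + h (g ** \<gamma> t)) has_vector_derivative Rd \<gamma> f g + Rd \<gamma> h g) (at 0)"
      using that by (intro has_vector_derivative_add Rd_has_vector_derivative[OF \<gamma> True]) (auto simp: smoothG_def)
    from vector_derivative_at[OF this] show ?thesis using True by (simp add: Rd_def)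
  qed (simp add: Rd_def)
  then have add: "Rd \<gamma> (f + h) = Rd \<gamma> f + Rd \<gamma> h" if "f \<in> smoothG" "h \<in> smoothG" for f h
    using that unfolding plus_fun_def by (simp add: fun_eq_iff)
  have "Rd \<gamma> (\<lambda>x. c * f x) g = c * Rd \<gamma> f g" if "f \<in> smoothG" for f c g
  proof (cases "g \<in> SL3")
    case True
    have "((\<lambda>t. c * f (g ** \<gamma> t)) has_vector_derivative c * Rd \<gamma> f g) (at 0)"
      using that by (intro has_vector_derivative_mult_right Rd_has_vector_derivative[OF \<gamma> True]) (auto simp: smoothG_def)
    from vector_derivative_at[OF this] show ?thesis using True by (simp add: Rd_def)
  qed (simp add: Rd_def)
  then have "Rd \<gamma> (\<lambda>x. c * f x) = (\<lambda>x. c * Rd \<gamma> f x)" if "f \<in> smoothG" for f c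
    using that by (simp add: fun_eq_iff)
  then show ?thesis
    unfolding fn.lin_op_def using smoothG_Rd[OF \<gamma>] add by (simp add: cm_def)
qed

text \<open>On a smooth extension the right derivatives are the linear fields sending g to gA and to
  gB, whose bracket sends g to g(AB - BA).\<close>

lemma Rd_bracket:
  assumes \<gamma>: "lie_curve \<gamma> A" and \<delta>: "lie_curve \<delta> B" and f: "f \<in> smoothG" and g: "g \<in> SL3"
    and \<eta>: "lie_curve \<eta> C" and C: "A ** B - B ** A = c *\<^sub>R C"
  shows "Rd \<gamma> (Rd \<delta> f) g = Rd \<delta> (Rd \<gamma> f) g + of_real c * Rd \<eta> f g"
proof -
  have "smooth_on_G f" using f by (simp add: smoothG_def)
  then obtain U F where F: "open U" "SL3 \<subseteq> U" "smooth_on U F" "\<And>g. g \<in> SL3 \<Longrightarrow> F g = f g"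
    using smooth_on_G_ext[OF _ SL3_one] by blast
  note sm = smooth_on_mat3_mult(1)[OF F(1)]
  have gU: "g \<in> U" using g F(2) by blast
  have lin: "linear (frechet_derivative F (at g))"
    by (rule has_derivative_linear[OF smooth_on_derivative[OF F(1,3) gU]])
  have 1: "Rd \<gamma> (Rd \<delta> f) g = along (\<lambda>g. g ** A) (along (\<lambda>g. g ** B) F) g"
    if \<gamma>: "lie_curve \<gamma> A" and \<delta>: "lie_curve \<delta> B" for \<gamma> \<delta> A B
    by (rule Rd_ext[OF \<gamma> g F(1,2) smooth_on_along[OF F(1,3) sm]]) (rule Rd_ext[OF \<delta> _ F, symmetric])
  have al: "along (\<lambda>g. g ** A) (\<lambda>g. g ** B) g = g ** A ** B" for A B :: mat3
    unfolding along_def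
    using frechet_derivative_at[OF bounded_linear_imp_has_derivative[OF bounded_linear_mat3_mult(1)], of B g] by metis
  have "g ** A ** B - g ** B ** A = c *\<^sub>R (g ** C)"
  proof -
    have "g ** A ** B - g ** B ** A = g ** (A ** B - B ** A)"
      by (simp add: mat3_eq_iff mat3_mult_nth algebra_simps)
    also have "\<dots> = c *\<^sub>R (g ** C)"
      unfolding C by (simp add: mat3_eq_iff mat3_mult_nth algebra_simps)
    finally show ?thesis .
  qed
  then have "Rd \<gamma> (Rd \<delta> f) g - Rd \<delta> (Rd \<gamma> f) g = frechet_derivative F (at g) (c *\<^sub>R (g ** C))"
    unfolding 1[OF \<gamma> \<delta>] 1[OF \<delta> \<gamma>] along_bracket[OF F(1,3) sm sm gU] al by simp
  also have "\<dots> = c *\<^sub>R Rd \<eta> f g"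
    using Rd_ext[OF \<eta> g F(1-3), of f] F(4) by (simp add: linear_scale[OF lin] along_def)
  finally show ?thesis by (simp add: scaleR_conv_of_real algebra_simps)
qed

lemma mk3_has_vector_derivative:
  assumes "(a has_real_derivative a') (at x)" "(b has_real_derivative b') (at x)" "(c has_real_derivative c') (at x)"
    "(d has_real_derivative d') (at x)" "(e has_real_derivative e') (at x)" "(f has_real_derivative f') (at x)"
    "(g has_real_derivative g') (at x)" "(h has_real_derivative h') (at x)" "(i has_real_derivative i') (at x)"
  shows "((\<lambda>t. mk3 (a t) (b t) (c t) (d t) (e t) (f t) (g t) (h t) (i t)) has_vector_derivative
     mk3 a' b' c' d' e' f' g' h' i') (at x)"
proof -
  have eq: "mk3 a b c d e f g h i =
    a *\<^sub>R mk3 1 0 0 0 0 0 0 0 0 + b *\<^sub>R mk3 0 1 0 0 0 0 0 0 0 + c *\<^sub>R mk3 0 0 1 0 0 0 0 0 0 +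
    d *\<^sub>R mk3 0 0 0 1 0 0 0 0 0 + e *\<^sub>R mk3 0 0 0 0 1 0 0 0 0 + f *\<^sub>R mk3 0 0 0 0 0 1 0 0 0 +
    g *\<^sub>R mk3 0 0 0 0 0 0 1 0 0 + h *\<^sub>R mk3 0 0 0 0 0 0 0 1 0 + i *\<^sub>R mk3 0 0 0 0 0 0 0 0 1" for a b c d e f g h i
    by (simp add: mat3_eq_iff)
  have sc: "((\<lambda>t. a t *\<^sub>R M) has_vector_derivative a' *\<^sub>R M) (at x)"
    if "(a has_real_derivative a') (at x)" for a a' and M :: mat3
    using has_vector_derivative_scaleR[OF that has_vector_derivative_const, of M] by simp
  show ?thesis
    unfolding eq[of "a _"] eq[of a'] by (intro has_vector_derivative_add sc assms)
qed

definition "e21 t = mk3 1 0 0 t 1 0 0 0 1"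
definition "e32 t = mk3 1 0 0 0 1 0 0 t 1"
definition "e31 t = mk3 1 0 0 0 1 0 t 0 1"
definition "e12 t = mk3 1 t 0 0 1 0 0 0 1"
definition "e23 t = mk3 1 0 0 0 1 t 0 0 1"
definition "h1 t = mk3 (exp t) 0 0 0 (exp (- t)) 0 0 0 1"
definition "h2 t = mk3 1 0 0 0 (exp t) 0 0 0 (exp (- t))"

lemma lie_curves:
  "lie_curve e21 (mk3 0 0 0 1 0 0 0 0 0)" "lie_curve e32 (mk3 0 0 0 0 0 0 0 1 0)"
  "lie_curve e31 (mk3 0 0 0 0 0 0 1 0 0)" "lie_curve e12 (mk3 0 1 0 0 0 0 0 0 0)"
  "lie_curve e23 (mk3 0 0 0 0 0 1 0 0 0)" "lie_curve h1 (mk3 1 0 0 0 (-1) 0 0 0 0)"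
  "lie_curve h2 (mk3 0 0 0 0 1 0 0 0 (-1))"
  unfolding lie_curve_def e21_def[abs_def] e32_def[abs_def] e31_def[abs_def] e12_def[abs_def] e23_def[abs_def]
    h1_def[abs_def] h2_def[abs_def]
  by (auto intro!: mk3_has_vector_derivative derivative_eq_intros simp: mat_1_mk3 SL3_def det_mk3 exp_add[symmetric])

abbreviation "GX \<equiv> Rd e21"
abbreviation "GY \<equiv> Rd e32"
abbreviation "GZ \<equiv> Rd e31"

interpretation G: sl3_ops cm smoothG GX GY GZ "Rd e12" "Rd e23" "Rd h1" "Rd h2"
proof -
  have br: "Rd \<gamma> (Rd \<delta> f) = Rd \<delta> (Rd \<gamma> f) + cm (of_real c) (Rd \<eta> f)"
    if "lie_curve \<gamma> A" "lie_curve \<delta> B" "lie_curve \<eta> C" "A ** B - B ** A = c *\<^sub>R C" "f \<in> smoothG" for \<gamma> \<delta> \<eta> A B C c f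
  proof
    fix g
    show "Rd \<gamma> (Rd \<delta> f) g = (Rd \<delta> (Rd \<gamma> f) + cm (of_real c) (Rd \<eta> f)) g"
    proof (cases "g \<in> SL3")
      case True
      then show ?thesis using Rd_bracket[OF that(1,2,5) True that(3,4)] by simp
    qed (simp add: Rd_def)
  qed
  have com: "Rd \<gamma> (Rd \<delta> f) = Rd \<delta> (Rd \<gamma> f)"
    if "lie_curve \<gamma> A" "lie_curve \<delta> B" "A ** B = B ** A" "f \<in> smoothG" for \<gamma> \<delta> A B f
    using br[OF that(1,2,1) _ that(4), of 0] that(3) by simp
  note L = lie_curves
  note ev = mk3_mult mk3_diff mk3_scaleR
  show "sl3_ops cm smoothG GX GY GZ (Rd e12) (Rd e23) (Rd h1) (Rd h2)"
  proof (unfold_locales)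
    show "fn.subspace smoothG" by (rule subspace_smoothG)
    show "fn.lin_op smoothG GX" "fn.lin_op smoothG GY" "fn.lin_op smoothG GZ" "fn.lin_op smoothG (Rd e12)"
      "fn.lin_op smoothG (Rd e23)" "fn.lin_op smoothG (Rd h1)" "fn.lin_op smoothG (Rd h2)"
      by (rule lin_op_Rd[OF L(1)] lin_op_Rd[OF L(2)] lin_op_Rd[OF L(3)] lin_op_Rd[OF L(4)] lin_op_Rd[OF L(5)]
          lin_op_Rd[OF L(6)] lin_op_Rd[OF L(7)])+
    fix f assume f: "f \<in> smoothG"
    have one: "cm (of_real 1) h = h" for h :: "mat3 \<Rightarrow> complex" by (simp add: fun_eq_iff)
    show "GY (GX f) = GX (GY f) + GZ f"
      using br[OF L(2,1,3) _ f, of 1] unfolding one by (simp add: ev)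
    show "GZ (GX f) = GX (GZ f)" by (rule com[OF L(3,1) _ f]) (simp add: ev)
    show "GZ (GY f) = GY (GZ f)" by (rule com[OF L(3,2) _ f]) (simp add: ev)
    show "Rd e12 (GX f) = GX (Rd e12 f) + Rd h1 f"
      using br[OF L(4,1,6) _ f, of 1] unfolding one by (simp add: ev)
    show "Rd e12 (GY f) = GY (Rd e12 f)" by (rule com[OF L(4,2) _ f]) (simp add: ev)
    show "Rd e12 (GZ f) = GZ (Rd e12 f) + cm (-1) (GY f)"
      using br[OF L(4,3,2) _ f, of "-1"] by (simp add: ev)
    show "Rd e23 (GX f) = GX (Rd e23 f)" by (rule com[OF L(5,1) _ f]) (simp add: ev)
    show "Rd e23 (GY f) = GY (Rd e23 f) + Rd h2 f"
      using br[OF L(5,2,7) _ f, of 1] unfolding one by (simp add: ev)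
    show "Rd e23 (GZ f) = GZ (Rd e23 f) + GX f"
      using br[OF L(5,3,1) _ f, of 1] unfolding one by (simp add: ev)
    show "Rd h1 (GX f) = GX (Rd h1 f) + cm (-2) (GX f)"
      using br[OF L(6,1,1) _ f, of "-2"] by (simp add: ev)
    show "Rd h1 (GY f) = GY (Rd h1 f) + cm 1 (GY f)"
      using br[OF L(6,2,2) _ f, of 1] by (simp add: ev)
    show "Rd h1 (GZ f) = GZ (Rd h1 f) + cm (-1) (GZ f)"
      using br[OF L(6,3,3) _ f, of "-1"] by (simp add: ev)
    show "Rd h2 (GY f) = GY (Rd h2 f) + cm (-2) (GY f)"
      using br[OF L(7,2,2) _ f, of "-2"] by (simp add: ev)
    show "Rd h2 (GZ f) = GZ (Rd h2 f) + cm (-1) (GZ f)"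
      using br[OF L(7,3,3) _ f, of "-1"] by (simp add: ev)
  qed
qed

abbreviation monG :: "nat \<times> nat \<times> nat \<Rightarrow> (mat3 \<Rightarrow> complex) \<Rightarrow> mat3 \<Rightarrow> complex" where
  "monG t \<equiv> (case t of (i, j, k) \<Rightarrow> fn.pbw GX GY GZ i j k)"

lemma monG_smoothG: "f \<in> smoothG \<Longrightarrow> monG t f \<in> smoothG"
  by (cases t) (simp add: G.pbw_closed)

lemma smooth_on_nbar: "smooth_on UNIV nbar"
proof (rule smooth_on_componentwise[OF open_UNIV])
  fix b :: mat3 assume "b \<in> Basis"
  then obtain i j where b: "b = axis i (axis j 1)" by (auto simp: Basis_vec_def)
  have nth: "smooth_on UNIV (\<lambda>x::real^3. x $ i)" for i
    by (intro smooth_on_linear open_UNIV bounded_linear_vec_nth)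
  have c: "smooth_on UNIV (\<lambda>x::real^3. x $ 3 + x $ 1 * x $ 2 * (1/2))"
    by (intro smooth_on_add smooth_on_mult smooth_on_const nth open_UNIV)
  have "(\<lambda>x. nbar x \<bullet> b) = (\<lambda>x. nbar x $ i $ j)"
    by (simp add: b inner_axis)
  moreover have "smooth_on UNIV (\<lambda>x. nbar x $ i $ j)"
    using exhaust_3[of i] exhaust_3[of j] nth c by (auto simp: nbar_def smooth_on_const)
  ultimately show "smooth_on UNIV (\<lambda>x. nbar x \<bullet> b)" by simp
qed

lemma res_smooth3:
  assumes "smooth_on_G f"
  shows "res f \<in> smooth3"
proof -
  obtain U F where F: "open U" "SL3 \<subseteq> U" "smooth_on U F" "\<And>g. g \<in> SL3 \<Longrightarrow> F g = f g"
    using smooth_on_G_ext[OF assms SL3_one] by blast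
  have "smooth_on UNIV (\<lambda>x. F (nbar x))"
    using F nbar_SL3 by (intro smooth_on_compose[OF open_UNIV F(1) smooth_on_nbar _ F(3)]) auto
  then show ?thesis
    by (simp add: smooth3_def res_def F(4) nbar_SL3)
qed

text \<open>Right multiplication by the lower unitriangular curves stays in the cell and moves the
  coordinates along the straight line x + t \<open>fld i x\<close>; the halves in the fields come
  from the product x1 x2/2 in \<open>nbar\<close>.\<close>

lemma res_Rd:
  assumes f: "smooth_on_G f"
  shows "Dop1 (res f) = res (GX f)" "Dop2 (res f) = res (GY f)" "Dop3 (res f) = res (GZ f)"
proof -
  have main: "Dop i (res f) = res (Rd \<gamma> f)"
    if \<gamma>: "\<And>x t. nbar x ** \<gamma> t = nbar (x + t *\<^sub>R fld i x)" for i \<gamma>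
  proof
    fix x
    have sm: "res f \<in> smooth3" by (rule res_smooth3[OF f])
    have "((\<lambda>t. x + t *\<^sub>R fld i x) has_vector_derivative fld i x) (at 0)"
      by (auto intro!: derivative_eq_intros)
    moreover have "(res f has_derivative frechet_derivative (res f) (at x)) (at (x + 0 *\<^sub>R fld i x))"
      using smooth3_differentiable[OF sm] by (simp add: frechet_derivative_works)
    ultimately have "((res f \<circ> (\<lambda>t. x + t *\<^sub>R fld i x)) has_vector_derivative
        frechet_derivative (res f) (at x) (fld i x)) (at 0)"
      by (intro vector_derivative_diff_chain_within) (auto intro: has_derivative_at_withinI)
    from vector_derivative_at[OF this]
    have "frechet_derivative (res f) (at x) (fld i x) = res (Rd \<gamma> f) x"
      by (simp add: res_def Rd_def nbar_SL3 \<gamma> o_def)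
    then show "Dop i (res f) x = res (Rd \<gamma> f) x"
      by (simp only: Dop_along[OF sm] along_def)
  qed
  have d: "Dop 1 = Dop1" "Dop 2 = Dop2" "Dop 3 = Dop3" by (simp_all add: Dop_def fun_eq_iff)
  have n: "nbar x ** e21 t = nbar (x + t *\<^sub>R fld 1 x)" "nbar x ** e32 t = nbar (x + t *\<^sub>R fld 2 x)"
    "nbar x ** e31 t = nbar (x + t *\<^sub>R fld 3 x)" for x t
    unfolding nbar_def e21_def e32_def e31_def mk3_mult mat3_eq_iff
    by (simp_all add: fld_def axis_def field_simps)
  show "Dop1 (res f) = res (GX f)" "Dop2 (res f) = res (GY f)" "Dop3 (res f) = res (GZ f)"
    using main[OF n(1)] main[OF n(2)] main[OF n(3)] unfolding d by auto
qed

lemma mon3_res: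
  assumes "f \<in> smoothG"
  shows "mon3 t (res f) = res (monG t f)"
proof -
  obtain i j k where t: "t = (i, j, k)" by (cases t)
  have pw: "(Dop1 ^^ n) (res h) = res ((GX ^^ n) h)" "(Dop2 ^^ n) (res h) = res ((GY ^^ n) h)"
    "(Dop3 ^^ n) (res h) = res ((GZ ^^ n) h)" if "h \<in> smoothG" for n h
  proof -
    have sm: "smooth_on_G ((GX ^^ n) h)" "smooth_on_G ((GY ^^ n) h)" "smooth_on_G ((GZ ^^ n) h)" for n
      using G.pow_closed[OF that] by (auto simp: smoothG_def)
    show "(Dop1 ^^ n) (res h) = res ((GX ^^ n) h)" by (induction n) (simp_all add: res_Rd sm)
    show "(Dop2 ^^ n) (res h) = res ((GY ^^ n) h)" by (induction n) (simp_all add: res_Rd sm)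
    show "(Dop3 ^^ n) (res h) = res ((GZ ^^ n) h)" by (induction n) (simp_all add: res_Rd sm)
  qed
  show ?thesis
    unfolding t by (simp add: fn.pbw_def pw G.pow_closed assms)
qed

lemma Lact_Rd: "g \<in> SL3 \<Longrightarrow> Lact g (Rd \<gamma> f) = Rd \<gamma> (Lact g f)"
  using SL3_inverse(3) by (simp add: fun_eq_iff Lact_def Rd_def SL3_mult_left_iff matrix_mul_assoc)

lemma Lact_smooth_on_G:
  assumes "g \<in> SL3" "smooth_on_G f"
  shows "smooth_on_G (Lact g f)"
proof -
  obtain U F where F: "open U" "SL3 \<subseteq> U" "smooth_on U F" "\<And>g. g \<in> SL3 \<Longrightarrow> F g = f g"
    using smooth_on_G_ext[OF assms(2) SL3_one] by blast
  let ?L = "\<lambda>h. matrix_inv g ** h"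
  have o: "open (?L -` U)"
    using F(1) linear_continuous_on[OF bounded_linear_mat3_mult(2)] continuous_open_vimage
    by (metis continuous_on_eq_continuous_at open_UNIV UNIV_I)
  have "smooth_on (?L -` U) (\<lambda>h. F (?L h))"
    by (rule smooth_on_compose[OF o F(1) smooth_on_mat3_mult(2)[OF o] _ F(3)]) auto
  moreover have "SL3 \<subseteq> ?L -` U" using F(2) SL3_mult SL3_inverse(3)[OF assms(1)] by auto
  ultimately show ?thesis
    unfolding smooth_on_G_def using o F(4) SL3_mult SL3_inverse(3)[OF assms(1)]
    by (intro exI[of _ "?L -` U"] exI[of _ "\<lambda>h. F (?L h)"]) (auto simp: Lact_def)
qed

lemma Lact_smoothG: "g \<in> SL3 \<Longrightarrow> f \<in> smoothG \<Longrightarrow> Lact g f \<in> smoothG"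
  using Lact_smooth_on_G SL3_inverse(3) by (auto simp: smoothG_def Lact_def SL3_mult_left_iff)

lemma Lact_monG: "g \<in> SL3 \<Longrightarrow> Lact g (monG t f) = monG t (Lact g f)"
proof -
  assume g: "g \<in> SL3"
  have pw: "Lact g ((Rd \<gamma> ^^ n) h) = (Rd \<gamma> ^^ n) (Lact g h)" for \<gamma> n h
    by (induction n) (simp_all add: Lact_Rd[OF g])
  show ?thesis by (cases t) (simp add: fn.pbw_def pw)
qed

lemma Lact_at: "g \<in> SL3 \<Longrightarrow> Lact (matrix_inv g) f h = f (g ** h)"
proof -
  assume g: "g \<in> SL3"
  note i = SL3_inverse[OF g] and ii = SL3_inverse[OF SL3_inverse(3)[OF g]]
  have "matrix_inv (matrix_inv g) = (g ** matrix_inv g) ** matrix_inv (matrix_inv g)"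
    by (simp add: i)
  also have "\<dots> = g" unfolding matrix_mul_assoc[symmetric] ii by simp
  finally show ?thesis by (simp add: Lact_def)
qed

section \<open>Principal series and their jets at the identity\<close>

text \<open>\<open>Ind\<close> does not constrain a function off \<open>SL3\<close>. Masking chooses
  a representative in \<open>smoothG\<close> with the same restriction to the cell.\<close>

definition maskG :: "(mat3 \<Rightarrow> complex) \<Rightarrow> mat3 \<Rightarrow> complex" where
  "maskG f g = (if g \<in> SL3 then f g else 0)"

lemma maskG_smoothG: "smooth_on_G f \<Longrightarrow> maskG f \<in> smoothG"
  unfolding smoothG_def smooth_on_G_def maskG_def by fastforce

lemma res_maskG: "res (maskG f) = res f"
  by (simp add: res_def maskG_def nbar_SL3)

lemma Lact_maskG: "g \<in> SL3 \<Longrightarrow> Lact g (maskG f) = maskG (Lact g f)"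
  using SL3_inverse(3) by (simp add: fun_eq_iff Lact_def maskG_def SL3_mult_left_iff)

definition chi :: "complex \<times> complex \<Rightarrow> pm \<times> pm \<Rightarrow> real \<Rightarrow> real \<Rightarrow> real \<Rightarrow> real \<Rightarrow> complex" where
  "chi lam eps b1 b3 t1 t2 = inverse (chiM eps b1 b3) * inverse (chiA lam t1 t2)"

definition signs :: "real \<Rightarrow> real \<Rightarrow> real \<Rightarrow> bool" where
  "signs b1 b2 b3 \<longleftrightarrow> b1 \<in> {-1, 1} \<and> b2 \<in> {-1, 1} \<and> b3 \<in> {-1, 1} \<and> b1 * b2 * b3 = 1"

definition torus :: "real \<Rightarrow> real \<Rightarrow> real \<Rightarrow> real \<Rightarrow> real \<Rightarrow> mat3" where
  "torus b1 b2 b3 t1 t2 = diag3 b1 b2 b3 ** Aelt t1 t2"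

lemma torus_mk3: "torus b1 b2 b3 t1 t2 = mk3 (b1 * exp t1) 0 0 0 (b2 * exp (t2 - t1)) 0 0 0 (b3 * exp (- t2))"
  by (simp add: torus_def diag3_def Aelt_def mk3_mult)

lemma torus_SL3: "signs b1 b2 b3 \<Longrightarrow> torus b1 b2 b3 t1 t2 \<in> SL3"
  by (auto simp: torus_mk3 SL3_def det_mk3 signs_def exp_add[symmetric] algebra_simps)

lemma Nplus_SL3: "Nplus a b c \<in> SL3"
  by (simp add: Nplus_def SL3_def det_mk3)

lemma Ind_iff: "f \<in> Ind lam eps \<longleftrightarrow> smooth_on_G f \<and> (\<forall>g\<in>SL3. \<forall>b1 b2 b3 t1 t2 a b c. signs b1 b2 b3 \<longrightarrow>
    f (g ** torus b1 b2 b3 t1 t2 ** Nplus a b c) = chi lam eps b1 b3 t1 t2 * f g)"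
  by (simp add: Ind_def signs_def chi_def torus_def matrix_mul_assoc)

lemma IndD:
  assumes "f \<in> Ind lam eps"
  shows "smooth_on_G f" and "g \<in> SL3 \<Longrightarrow> signs b1 b2 b3 \<Longrightarrow>
    f (g ** torus b1 b2 b3 t1 t2 ** Nplus a b c) = chi lam eps b1 b3 t1 t2 * f g"
  using assms by (auto simp: Ind_iff)

lemma signs_1: "signs 1 1 1"
  by (simp add: signs_def)

lemma abs_pm_1: "abs_pm e 1 = 1"
  by (cases e) auto

lemma chi_1: "chi lam eps 1 1 0 0 = 1"
  by (simp add: chi_def chiM_def chiA_def abs_pm_1)

lemma torus_1: "torus 1 1 1 0 0 = mat 1"
  by (simp add: torus_mk3 mat_1_mk3)

lemma Nplus_0: "Nplus 0 0 0 = mat 1"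
  by (simp add: Nplus_def mat_1_mk3)

lemma Ind_torus: "f \<in> Ind lam eps \<Longrightarrow> g \<in> SL3 \<Longrightarrow> signs b1 b2 b3 \<Longrightarrow>
    f (g ** torus b1 b2 b3 t1 t2) = chi lam eps b1 b3 t1 t2 * f g"
  using IndD(2)[of f lam eps g b1 b2 b3 t1 t2 0 0 0] by (simp add: Nplus_0)

lemma Ind_Nplus: "f \<in> Ind lam eps \<Longrightarrow> g \<in> SL3 \<Longrightarrow> f (g ** Nplus a b c) = f g"
  using IndD(2)[of f lam eps g 1 1 1 0 0 a b c] by (simp add: signs_1 chi_1 torus_1)

lemma Ind_maskG: "f \<in> Ind lam eps \<Longrightarrow> maskG f \<in> Ind lam eps"
  using maskG_smoothG[of f] unfolding Ind_iff
  by (auto simp: maskG_def SL3_mult torus_SL3 Nplus_SL3 smoothG_def)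

lemma Ind_Lact:
  assumes "g \<in> SL3" "f \<in> Ind lam eps"
  shows "Lact g f \<in> Ind lam eps"
  unfolding Ind_iff
proof (intro conjI ballI allI impI)
  show "smooth_on_G (Lact g f)" using Lact_smooth_on_G assms IndD(1) by blast
  fix h b1 b2 b3 t1 t2 a b c assume h: "h \<in> SL3" and s: "signs b1 b2 b3"
  have "matrix_inv g ** h \<in> SL3" by (intro SL3_mult SL3_inverse assms h)
  from IndD(2)[OF assms(2) this s]
  show "Lact g f (h ** torus b1 b2 b3 t1 t2 ** Nplus a b c) = chi lam eps b1 b3 t1 t2 * Lact g f h"
    by (simp add: Lact_def matrix_mul_assoc)
qed

text \<open>Covariance differentiated at the identity: for the right derivatives a member of
  \<open>Ind\<close> is a highest weight vector of weight \<open>-lam\<close>. This is where the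
  minus signs in the later recursions come from.\<close>

lemma Ind_infinitesimal:
  assumes f: "f \<in> Ind lam eps" "f \<in> smoothG"
  shows "Rd e12 f = 0" "Rd e23 f = 0" "Rd h1 f = cm (- fst lam) f" "Rd h2 f = cm (- snd lam) f"
proof -
  have n: "e12 t = Nplus t 0 0" "e23 t = Nplus 0 t 0" for t
    by (simp_all add: e12_def e23_def Nplus_def)
  have h: "h1 t = torus 1 1 1 t 0" "h2 t = torus 1 1 1 0 t" for t
    by (simp_all add: h1_def h2_def torus_mk3)
  show "Rd e12 f = 0" "Rd e23 f = 0"
    by (auto simp: fun_eq_iff Rd_def n Ind_Nplus[OF f(1)])
  have v: "vector_derivative (\<lambda>t. exp (- (c * complex_of_real t)) * y) (at 0) = - c * y" for c y
  proof (rule vector_derivative_at, rule has_vector_derivative_mult_left)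
    have "((\<lambda>t. (- c) * complex_of_real t) has_vector_derivative (- c) * complex_of_real 1) (at 0)"
      by (intro has_vector_derivative_mult_right has_vector_derivative_of_real DERIV_ident)
    from field_vector_diff_chain_at[OF this DERIV_exp]
    show "((\<lambda>t. exp (- (c * complex_of_real t))) has_vector_derivative - c) (at 0)"
      by (simp add: o_def)
  qed
  have "Rd h1 f g = - fst lam * f g" "Rd h2 f g = - snd lam * f g" for g
    using f(2) by (auto simp: Rd_def h Ind_torus[OF f(1) _ signs_1] chi_def chiM_def chiA_def abs_pm_1
        exp_minus[symmetric] v smoothG_def)
  then show "Rd h1 f = cm (- fst lam) f" "Rd h2 f = cm (- snd lam) f"
    by (auto simp: fun_eq_iff)
qed

text \<open>Moving the curve past \<open>b\<close> rescales its time by \<open>w\<close>, so that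
  each derivative contributes one factor \<open>w\<close>.\<close>

lemma Rd_right_translate:
  assumes \<gamma>: "lie_curve \<gamma> A" and f: "smooth_on_G f" and b: "b \<in> SL3"
    and eq: "\<And>g. g \<in> SL3 \<Longrightarrow> f (g ** b) = c * f g"
    and w: "\<And>t. b ** \<gamma> t = \<gamma> (w * t) ** b" and g: "g \<in> SL3"
  shows "Rd \<gamma> f (g ** b) = c * complex_of_real w * Rd \<gamma> f g"
proof -
  have \<gamma>S: "\<gamma> t \<in> SL3" for t using \<gamma> by (simp add: lie_curve_def)
  have "f (g ** b ** \<gamma> t) = c * f (g ** \<gamma> (w * t))" for t
  proof -
    have "g ** b ** \<gamma> t = (g ** \<gamma> (w * t)) ** b"
      by (simp add: w matrix_mul_assoc[symmetric])
    then show ?thesis using eq[OF SL3_mult[OF g \<gamma>S]] by simp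
  qed
  moreover have "((\<lambda>t. c * f (g ** \<gamma> (w * t))) has_vector_derivative c * (w *\<^sub>R Rd \<gamma> f g)) (at 0)"
  proof (rule has_vector_derivative_mult_right)
    have "((\<lambda>t. w * t) has_vector_derivative w) (at 0)"
      by (auto intro!: derivative_eq_intros)
    from vector_diff_chain_at[OF this, of "\<lambda>t. f (g ** \<gamma> t)"] Rd_has_vector_derivative[OF \<gamma> g f]
    show "((\<lambda>t. f (g ** \<gamma> (w * t))) has_vector_derivative w *\<^sub>R Rd \<gamma> f g) (at 0)"
      by (simp add: o_def)
  qed
  ultimately have "vector_derivative (\<lambda>t. f (g ** b ** \<gamma> t)) (at 0) = c * (w *\<^sub>R Rd \<gamma> f g)"
    by (simp add: vector_derivative_at)
  then show ?thesis
    using SL3_mult[OF g b] by (simp add: Rd_def[of \<gamma> f "g ** b"] scaleR_conv_of_real)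
qed

text \<open>The weights of $E_{21}$ and $E_{32}$ under the torus.\<close>

definition wt1 :: "real \<Rightarrow> real \<Rightarrow> real \<Rightarrow> real" where "wt1 b3 t1 t2 = b3 * exp (t2 - 2 * t1)"
definition wt2 :: "real \<Rightarrow> real \<Rightarrow> real \<Rightarrow> real" where "wt2 b1 t1 t2 = b1 * exp (t1 - 2 * t2)"

lemma torus_conj:
  assumes "signs b1 b2 b3"
  shows "torus b1 b2 b3 t1 t2 ** e21 t = e21 (wt1 b3 t1 t2 * t) ** torus b1 b2 b3 t1 t2"
    "torus b1 b2 b3 t1 t2 ** e32 t = e32 (wt2 b1 t1 t2 * t) ** torus b1 b2 b3 t1 t2"
    "torus b1 b2 b3 t1 t2 ** e31 t = e31 (wt1 b3 t1 t2 * wt2 b1 t1 t2 * t) ** torus b1 b2 b3 t1 t2"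
proof -
  have e: "exp (t2 - t1) = exp (t2 - 2 * t1) * exp t1" "exp (- t2) = exp (t1 - 2 * t2) * exp (t2 - t1)"
    "exp (- t2) = exp (t2 - 2 * t1) * (exp (t1 - 2 * t2) * exp t1)"
    by (simp_all add: exp_add[symmetric])
  \<comment> \<open>Signs are their own inverses and have product 1, so the quotient of two of them
    is the third. Hence the weight of \<open>e21\<close> carries \<open>b3\<close> and that of
    \<open>e32\<close> carries \<open>b1\<close>.\<close>
  have b: "b2 = b3 * b1" "b3 = b1 * b2" "b1 * b1 = 1" using assms by (auto simp: signs_def)
  show "torus b1 b2 b3 t1 t2 ** e21 t = e21 (wt1 b3 t1 t2 * t) ** torus b1 b2 b3 t1 t2"
    using b(1) e(1) by (simp add: torus_mk3 e21_def mk3_mult mat3_eq_iff wt1_def)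
  show "torus b1 b2 b3 t1 t2 ** e32 t = e32 (wt2 b1 t1 t2 * t) ** torus b1 b2 b3 t1 t2"
    unfolding torus_mk3 e32_def mk3_mult mat3_eq_iff wt2_def using b(2) e(2) by simp
  show "torus b1 b2 b3 t1 t2 ** e31 t = e31 (wt1 b3 t1 t2 * wt2 b1 t1 t2 * t) ** torus b1 b2 b3 t1 t2"
    unfolding torus_mk3 e31_def mk3_mult mat3_eq_iff wt1_def wt2_def using b(3) e(3) by simp
qed

lemma monG_torus:
  assumes f: "f \<in> smoothG" and s: "signs b1 b2 b3" and g: "g \<in> SL3"
    and eq: "\<And>g. g \<in> SL3 \<Longrightarrow> f (g ** torus b1 b2 b3 t1 t2) = c * f g"
  shows "monG (i, j, k) f (g ** torus b1 b2 b3 t1 t2)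
    = c * of_real (wt1 b3 t1 t2) ^ (i + k) * of_real (wt2 b1 t1 t2) ^ (j + k) * monG (i, j, k) f g"
proof -
  let ?b = "torus b1 b2 b3 t1 t2"
  note b = torus_SL3[OF s, of t1 t2]
  have pw: "(Rd \<gamma> ^^ n) h (g ** ?b) = c * of_real w ^ n * (Rd \<gamma> ^^ n) h g"
    if \<gamma>: "lie_curve \<gamma> A" and h: "h \<in> smoothG" "\<And>g. g \<in> SL3 \<Longrightarrow> h (g ** ?b) = c * h g"
      and w: "\<And>t. ?b ** \<gamma> t = \<gamma> (w * t) ** ?b" and g: "g \<in> SL3" for \<gamma> A h c w n g
    using g
  proof (induction n arbitrary: g)
    case 0
    then show ?case using h(2) by simp
  next
    case (Suc n)
    have sm: "smooth_on_G ((Rd \<gamma> ^^ n) h)"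
      using fn.lin_opD(1)[OF fn.lin_op_funpow[OF lin_op_Rd[OF \<gamma>]] h(1)] by (simp add: smoothG_def)
    show ?case
      using Rd_right_translate[OF \<gamma> sm b Suc.IH w Suc.prems] by (simp add: mult_ac)
  qed
  note L = lie_curves and T = torus_conj[OF s]
  have z: "(GZ ^^ k) f (g ** ?b) = c * of_real (wt1 b3 t1 t2 * wt2 b1 t1 t2) ^ k * (GZ ^^ k) f g" if "g \<in> SL3" for g
    by (rule pw[OF L(3) f eq T(3) that])
  have y: "(GY ^^ j) ((GZ ^^ k) f) (g ** ?b) = c * of_real (wt1 b3 t1 t2 * wt2 b1 t1 t2) ^ k * of_real (wt2 b1 t1 t2) ^ j
      * (GY ^^ j) ((GZ ^^ k) f) g" if "g \<in> SL3" for g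
    by (rule pw[OF L(2) G.pow_closed(3)[OF f] z T(2) that])
  have "(GX ^^ i) ((GY ^^ j) ((GZ ^^ k) f)) (g ** ?b) = c * of_real (wt1 b3 t1 t2 * wt2 b1 t1 t2) ^ k * of_real (wt2 b1 t1 t2) ^ j
      * of_real (wt1 b3 t1 t2) ^ i * (GX ^^ i) ((GY ^^ j) ((GZ ^^ k) f)) g"
    by (rule pw[OF L(1) G.pow_closed(2)[OF G.pow_closed(3)[OF f]] y T(1) g])
  then show ?thesis
    by (simp add: fn.pbw_def power_add power_mult_distrib mult_ac)
qed

text \<open>The group law of the curve turns the derivative at time s into a derivative at time 0 at
  the translated point, where it vanishes by assumption.\<close>

lemma Rd_zero_invariant:
  assumes \<gamma>: "lie_curve \<gamma> A" and f: "smooth_on_G f" and zero: "\<And>g. g \<in> SL3 \<Longrightarrow> Rd \<gamma> f g = 0"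
    and add: "\<And>s t. \<gamma> (s + t) = \<gamma> s ** \<gamma> t" and g: "g \<in> SL3"
  shows "f (g ** \<gamma> t) = f g"
proof -
  have \<gamma>': "\<gamma> 0 = mat 1" "\<gamma> t \<in> SL3" for t using \<gamma> by (auto simp: lie_curve_def)
  have "((\<lambda>t. f (g ** \<gamma> t)) has_vector_derivative 0) (at s within UNIV)" for s
  proof -
    have gs: "g ** \<gamma> s \<in> SL3" by (intro SL3_mult g \<gamma>')
    have "((\<lambda>t. f (g ** \<gamma> s ** \<gamma> t)) has_vector_derivative 0) (at (s - s))"
      using Rd_has_vector_derivative[OF \<gamma> gs f] zero[OF gs] by simp
    moreover have "((\<lambda>t. t - s) has_vector_derivative 1) (at s)"
      by (auto intro!: derivative_eq_intros)
    ultimately have "((\<lambda>t. f (g ** \<gamma> s ** \<gamma> t)) \<circ> (\<lambda>t. t - s) has_vector_derivative 1 *\<^sub>R 0) (at s)"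
      by (intro vector_diff_chain_at)
    moreover have "g ** \<gamma> s ** \<gamma> (t - s) = g ** \<gamma> t" for t
      using add[of s "t - s"] by (simp add: matrix_mul_assoc)
    ultimately show ?thesis by (simp add: o_def)
  qed
  then obtain c where "\<And>t. f (g ** \<gamma> t) = c"
    using has_vector_derivative_zero_constant[of UNIV "\<lambda>t. f (g ** \<gamma> t)"] by auto
  then show ?thesis by (metis \<gamma>'(1) matrix_mul_rid)
qed

text \<open>The last four factors are a group commutator, equal to the elementary matrix with corner
  entry c - a b; the first two already produce a b there. Thus the two simple root subgroups
  generate.\<close>

lemma Nplus_factor: "Nplus a b c = e12 a ** e23 b ** e12 1 ** e23 (c - a * b) ** e12 (-1) ** e23 (- (c - a * b))"
  by (simp add: Nplus_def e12_def e23_def mk3_mult mat3_eq_iff algebra_simps)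

text \<open>Converse of \<open>Ind_infinitesimal\<close>. The unipotent part is generated by
  one-parameter groups, so infinitesimal invariance suffices for it; the torus includes a group of
  signs and is therefore treated at group level.\<close>

lemma Ind_I:
  assumes f: "f \<in> smoothG" and zero: "Rd e12 f = 0" "Rd e23 f = 0"
    and torus: "\<And>g b1 b2 b3 t1 t2. g \<in> SL3 \<Longrightarrow> signs b1 b2 b3 \<Longrightarrow>
       f (g ** torus b1 b2 b3 t1 t2) = chi lam eps b1 b3 t1 t2 * f g"
  shows "f \<in> Ind lam eps"
proof -
  have sm: "smooth_on_G f" using f by (simp add: smoothG_def)
  have S: "e12 t \<in> SL3" "e23 t \<in> SL3" for t by (simp_all add: e12_def e23_def SL3_def det_mk3)
  have add: "e12 (s + t) = e12 s ** e12 t" "e23 (s + t) = e23 s ** e23 t" for s t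
    by (simp_all add: e12_def e23_def mk3_mult add.commute)
  have e: "f (g ** e12 t) = f g" "f (g ** e23 t) = f g" if "g \<in> SL3" for g t
    using Rd_zero_invariant[OF lie_curves(4) sm _ add(1) that] Rd_zero_invariant[OF lie_curves(5) sm _ add(2) that]
    by (simp_all add: zero)
  have "f (g ** Nplus a b c) = f g" if "g \<in> SL3" for g a b c
    using that unfolding Nplus_factor matrix_mul_assoc by (simp add: e S SL3_mult)
  then show ?thesis
    unfolding Ind_iff using sm torus by (simp add: SL3_mult torus_SL3)
qed

section \<open>Explicit members of the principal series\<close>

lemma smooth_on_cpow: "smooth_on {0<..} (\<lambda>t::real. exp (\<alpha> * complex_of_real (ln t)))"
proof (rule smooth_onI)
  fix k
  \<comment> \<open>With a free factor and a free exponent the family is closed under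
    differentiation.\<close>
  have "Ck k {0<..} (\<lambda>t::real. c * exp (\<alpha> * complex_of_real (ln t)))" for c
  proof (induction k arbitrary: c \<alpha>)
    case 0
    show ?case by (auto intro!: continuous_intros)
  next
    case (Suc k)
    show ?case
    proof (rule Ck_SucI)
      fix t :: real assume "t \<in> {0<..}"
      then have t: "0 < t" by simp
      have ex: "exp ((\<alpha> - 1) * complex_of_real (ln t)) = exp (\<alpha> * complex_of_real (ln t)) / complex_of_real t"
        using t by (simp add: left_diff_distrib exp_diff exp_of_real)
      have "((\<lambda>t. c * exp (\<alpha> * complex_of_real (ln t))) has_vector_derivative
          c * (\<alpha> * complex_of_real (1 / t) * exp (\<alpha> * complex_of_real (ln t)))) (at t)"
      proof (rule has_vector_derivative_mult_right)
        have "((\<lambda>t. \<alpha> * complex_of_real (ln t)) has_vector_derivative \<alpha> * complex_of_real (1 / t)) (at t)"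
          using t by (intro has_vector_derivative_mult_right has_vector_derivative_of_real)
            (auto intro!: derivative_eq_intros simp: has_real_derivative_iff_has_vector_derivative[symmetric])
        from field_vector_diff_chain_at[OF this DERIV_exp]
        show "((\<lambda>t. exp (\<alpha> * complex_of_real (ln t))) has_vector_derivative
            \<alpha> * complex_of_real (1 / t) * exp (\<alpha> * complex_of_real (ln t))) (at t)"
          by (simp add: o_def)
      qed
      then show "((\<lambda>t. c * exp (\<alpha> * complex_of_real (ln t))) has_derivative
          (\<lambda>v. of_real v * c * \<alpha> * exp ((\<alpha> - 1) * complex_of_real (ln t)))) (at t)"
        unfolding has_vector_derivative_def ex by (simp add: scaleR_conv_of_real mult_ac divide_inverse)
    next
      show "Ck k {0<..} (\<lambda>t. of_real v * c * \<alpha> * exp ((\<alpha> - 1) * complex_of_real (ln t)))" for v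
        by (rule Suc)
    qed simp
  qed
  from this[of 1] show "Ck k {0<..} (\<lambda>t::real. exp (\<alpha> * complex_of_real (ln t)))" by simp
qed

text \<open>Up to a sign in one coordinate, \<open>w\<close> is the cross product of the first two columns.  Right
  translation by a torus element multiplies the first column by $b_1e^{t_1}$ and \<open>w\<close> by $b_3e^{t_2}$.\<close>

definition minor1 :: "mat3 \<Rightarrow> real" where "minor1 g = g$2$1 * g$3$2 - g$3$1 * g$2$2"
definition minor2 :: "mat3 \<Rightarrow> real" where "minor2 g = g$1$1 * g$3$2 - g$3$1 * g$1$2"
definition minor3 :: "mat3 \<Rightarrow> real" where "minor3 g = g$1$1 * g$2$2 - g$2$1 * g$1$2"
definition colnorm :: "mat3 \<Rightarrow> real" where "colnorm g = (g$1$1)\<^sup>2 + (g$2$1)\<^sup>2 + (g$3$1)\<^sup>2"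
definition minornorm :: "mat3 \<Rightarrow> real" where "minornorm g = (minor1 g)\<^sup>2 + (minor2 g)\<^sup>2 + (minor3 g)\<^sup>2"

definition cpow :: "real \<Rightarrow> complex \<Rightarrow> complex" where
  "cpow t \<alpha> = exp (\<alpha> * complex_of_real (ln t))"

lemma cpow_scale: "0 < t \<Longrightarrow> cpow ((b * exp r)\<^sup>2 * t) \<alpha> = exp (2 * \<alpha> * complex_of_real r) * cpow t \<alpha>" if "b \<in> {-1, 1}"
proof -
  assume t: "0 < t"
  have "(b * exp r)\<^sup>2 = exp (2 * r)" using that by (auto simp: power_mult_distrib exp_double[symmetric])
  then have "ln ((b * exp r)\<^sup>2 * t) = 2 * r + ln t" using t by (simp add: ln_mult)
  then show ?thesis by (simp add: cpow_def exp_add[symmetric] algebra_simps)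
qed

text \<open>The complex powers supply the homogeneity, the monomials supply the jets. On the cell
  the entries (2,1) and (3,1) are \<open>x1\<close> and \<open>z31\<close>, \<open>minor2\<close> is
  \<open>x2\<close>, while the entry (1,1) and \<open>minor3\<close> are 1: the exponents
  \<open>p\<close> and \<open>q\<close> are invisible there and serve to adjust parities.\<close>

definition indfun :: "complex \<Rightarrow> complex \<Rightarrow> nat \<Rightarrow> nat \<Rightarrow> nat \<Rightarrow> nat \<Rightarrow> nat \<Rightarrow> mat3 \<Rightarrow> complex" where
  "indfun \<alpha> \<beta> p i k q j g = cpow (colnorm g) \<alpha> * cpow (minornorm g) \<beta> *
     complex_of_real ((g$1$1) ^ p * (g$2$1) ^ i * (g$3$1) ^ k * minor3 g ^ q * minor2 g ^ j)"

lemma norms_pos: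
  assumes "g \<in> SL3"
  shows "0 < colnorm g" "0 < minornorm g"
proof -
  \<comment> \<open>Expansion of the determinant along the third column: the minors cannot all
    vanish, and hence the first column cannot either.\<close>
  have d: "g$1$3 * minor1 g - g$2$3 * minor2 g + g$3$3 * minor3 g = 1"
    using assms by (simp add: SL3_def det_3 minor1_def minor2_def minor3_def algebra_simps)
  show "0 < minornorm g"
  proof (rule ccontr)
    assume "\<not> 0 < minornorm g"
    then have "minor1 g = 0 \<and> minor2 g = 0 \<and> minor3 g = 0"
      unfolding minornorm_def by (smt (verit) zero_le_power2 power2_eq_iff_nonneg zero_eq_power2)
    then show False using d by simp
  qed
  then show "0 < colnorm g"
    unfolding colnorm_def minornorm_def minor1_def minor2_def minor3_def
    by (smt (verit) zero_le_power2 zero_eq_power2 mult_eq_0_iff)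
qed

lemma indfun_smooth: "smooth_on_G (indfun \<alpha> \<beta> p i k q j)"
proof -
  let ?U = "colnorm -` {0<..} \<inter> minornorm -` {0<..}"
  have nth: "smooth_on U (\<lambda>g::mat3. g $ a $ b)" if "open U" for a b U
    by (rule smooth_on_linear[OF that bounded_linear_compose[OF bounded_linear_vec_nth bounded_linear_vec_nth]])
  have m: "smooth_on U minor1" "smooth_on U minor2" "smooth_on U minor3" if "open U" for U
    unfolding minor1_def[abs_def] minor2_def[abs_def] minor3_def[abs_def]
    by (intro smooth_on_diff smooth_on_mult nth that)+
  have N: "smooth_on U colnorm" "smooth_on U minornorm" if "open U" for U
    unfolding colnorm_def[abs_def] minornorm_def[abs_def]
    by (intro smooth_on_add smooth_on_power nth m that)+
  have o: "open ?U"
    using smooth_on_continuous[OF N(1)[OF open_UNIV]] smooth_on_continuous[OF N(2)[OF open_UNIV]]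
    by (intro open_Int open_vimage) auto
  have c: "smooth_on ?U (\<lambda>g. cpow (colnorm g) \<alpha>)" "smooth_on ?U (\<lambda>g. cpow (minornorm g) \<beta>)"
    unfolding cpow_def
    by (rule smooth_on_compose[OF o _ N(1)[OF o] _ smooth_on_cpow]; auto)
       (rule smooth_on_compose[OF o _ N(2)[OF o] _ smooth_on_cpow]; auto)
  have "smooth_on ?U (indfun \<alpha> \<beta> p i k q j)"
    unfolding indfun_def[abs_def]
    by (intro smooth_on_mult[OF o] smooth_on_of_real[OF o] smooth_on_power[OF o] c nth[OF o] m[OF o])
  then show ?thesis
    unfolding smooth_on_G_def using o norms_pos by (intro exI[of _ ?U] exI[of _ "indfun \<alpha> \<beta> p i k q j"]) auto
qed

text \<open>Upper unitriangular right factors change neither the first column nor the minors. Twice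
  \<open>\<alpha>\<close> plus the degree in the first column is \<open>- fst lam\<close>, and
  similarly for \<open>\<beta>\<close> and the minors, which gives the positive character; the
  parities of these degrees give the signs.\<close>

lemma indfun_Ind:
  assumes \<alpha>: "\<alpha> = - (fst lam + of_nat (p + i + k)) / 2" and \<beta>: "\<beta> = - (snd lam + of_nat (q + j)) / 2"
    and par: "even (p + i + k) \<longleftrightarrow> fst eps = Pos" "even (q + j) \<longleftrightarrow> snd eps = Pos"
  shows "indfun \<alpha> \<beta> p i k q j \<in> Ind lam eps"
  unfolding Ind_iff
proof (intro conjI indfun_smooth ballI allI impI)
  fix g b1 b2 b3 t1 t2 a b c assume g: "g \<in> SL3" and s: "signs b1 b2 b3"
  let ?h = "g ** torus b1 b2 b3 t1 t2 ** Nplus a b c"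
  define r where "r = b1 * exp t1"
  define r' where "r' = b3 * exp t2"
  have rr: "r' = r * (b2 * exp (t2 - t1))"
  proof -
    have "b3 = b1 * b2" using s by (auto simp: signs_def)
    moreover have "exp t2 = exp t1 * exp (t2 - t1)" by (simp add: exp_add[symmetric])
    ultimately show ?thesis by (simp add: r_def r'_def)
  qed
  have col: "?h $ m $ 1 = r * g $ m $ 1" for m
    by (simp add: mat3_mult_nth torus_mk3 Nplus_def r_def)
  have col2: "?h $ m $ 2 = b2 * exp (t2 - t1) * g $ m $ 2 + a * r * g $ m $ 1" for m
    by (simp add: mat3_mult_nth torus_mk3 Nplus_def r_def)
  have min: "minor1 ?h = r' * minor1 g" "minor2 ?h = r' * minor2 g" "minor3 ?h = r' * minor3 g"
    unfolding minor1_def minor2_def minor3_def col col2 rr by (simp_all add: algebra_simps)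
  have cn: "colnorm ?h = r\<^sup>2 * colnorm g" "minornorm ?h = r'\<^sup>2 * minornorm g"
    unfolding colnorm_def minornorm_def col min by (simp_all add: power_mult_distrib algebra_simps)
  have bs: "b1 \<in> {-1, 1}" "b3 \<in> {-1, 1}" using s by (auto simp: signs_def)
  have sg: "b ^ n = inverse (abs_pm e b)" if "b \<in> {-1, 1}" "even n \<longleftrightarrow> e = Pos" for b n e
    using that by (cases e) auto
  have sg': "complex_of_real (b1 ^ (p + i + k)) * complex_of_real (b3 ^ (q + j)) = inverse (chiM eps b1 b3)"
    unfolding sg[OF bs(1) par(1)] sg[OF bs(2) par(2)] by (simp add: chiM_def)
  have ex: "exp (2 * \<alpha> * complex_of_real t1) * exp (2 * \<beta> * complex_of_real t2)
      * complex_of_real (exp t1 ^ (p + i + k)) * complex_of_real (exp t2 ^ (q + j)) = inverse (chiA lam t1 t2)"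
  proof -
    have en: "complex_of_real (exp t ^ n) = exp (of_nat n * complex_of_real t)" for t n
      by (simp add: exp_of_nat_mult[symmetric] exp_of_real[symmetric])
    have ab: "2 * \<alpha> = - (fst lam + of_nat (p + i + k))" "2 * \<beta> = - (snd lam + of_nat (q + j))"
      by (simp_all add: \<alpha> \<beta>)
    show ?thesis
      unfolding chiA_def exp_minus[symmetric] ab en by (simp add: exp_add[symmetric] algebra_simps)
  qed
  have "indfun \<alpha> \<beta> p i k q j ?h = cpow (r\<^sup>2 * colnorm g) \<alpha> * cpow (r'\<^sup>2 * minornorm g) \<beta> *
     complex_of_real (r ^ (p + i + k) * r' ^ (q + j)) *
     complex_of_real ((g$1$1) ^ p * (g$2$1) ^ i * (g$3$1) ^ k * minor3 g ^ q * minor2 g ^ j)"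
    unfolding indfun_def cn col min by (simp add: power_add power_mult_distrib mult_ac)
  also have "\<dots> = (exp (2 * \<alpha> * complex_of_real t1) * exp (2 * \<beta> * complex_of_real t2)
      * complex_of_real (exp t1 ^ (p + i + k)) * complex_of_real (exp t2 ^ (q + j))) *
     (complex_of_real (b1 ^ (p + i + k)) * complex_of_real (b3 ^ (q + j))) * indfun \<alpha> \<beta> p i k q j g"
    unfolding r_def r'_def cpow_scale[OF bs(1) norms_pos(1)[OF g]] cpow_scale[OF bs(2) norms_pos(2)[OF g]] indfun_def
    by (simp add: power_mult_distrib mult_ac)
  also have "\<dots> = chi lam eps b1 b3 t1 t2 * indfun \<alpha> \<beta> p i k q j g"
    unfolding ex sg' chi_def by (simp add: mult_ac)
  finally show "indfun \<alpha> \<beta> p i k q j ?h = chi lam eps b1 b3 t1 t2 * indfun \<alpha> \<beta> p i k q j g" .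
qed

lemma Ind_test_functions: "\<exists>Q\<in>smooth3. Q 0 \<noteq> 0 \<and> test_fun Q t \<in> res ` Ind lam eps"
proof -
  obtain i j k where t: "t = (i, j, k)" by (cases t)
  \<comment> \<open>Parity corrections, realised by factors that equal 1 on the cell.\<close>
  define p where "p = (if even (i + k) = (fst eps = Pos) then 0 else 1 :: nat)"
  define q where "q = (if even j = (snd eps = Pos) then 0 else 1 :: nat)"
  have par: "even (p + i + k) \<longleftrightarrow> fst eps = Pos" "even (q + j) \<longleftrightarrow> snd eps = Pos"
    by (auto simp: p_def q_def)
  define \<alpha> where "\<alpha> = - (fst lam + of_nat (p + i + k)) / 2"
  define \<beta> where "\<beta> = - (snd lam + of_nat (q + j)) / 2"
  define Q where "Q = res (indfun \<alpha> \<beta> 0 0 0 0 0)"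
  have "res (indfun \<alpha> \<beta> p i k q j) = test_fun Q t"
    by (simp add: fun_eq_iff t test_fun_def Q_def res_def indfun_def nbar_def minor2_def minor3_def x1_def x2_def z31_def)
  then have "test_fun Q t \<in> res ` Ind lam eps"
    using indfun_Ind[OF \<alpha>_def \<beta>_def par] by (metis imageI)
  moreover have "Q \<in> smooth3" unfolding Q_def by (rule res_smooth3[OF indfun_smooth])
  moreover have "Q 0 \<noteq> 0" by (simp add: Q_def res_def indfun_def cpow_def)
  ultimately show ?thesis by blast
qed

lemma monG_independent:
  assumes I: "finite I" and t: "t \<in> I"
    and zero: "\<And>f. f \<in> Ind lam eps \<Longrightarrow> f \<in> smoothG \<Longrightarrow> (\<Sum>t\<in>I. b t * monG t f (mat 1)) = 0"
  shows "b t = 0"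
proof (rule mon3_independent[OF I Ind_test_functions _ t])
  fix F assume "F \<in> res ` Ind lam eps"
  then obtain f where f: "f \<in> Ind lam eps" "F = res f" by blast
  have m: "maskG f \<in> smoothG" using f IndD(1) maskG_smoothG by blast
  have "mon3 t F 0 = monG t (maskG f) (mat 1)" for t
    unfolding f(2) res_maskG[symmetric, of f] mon3_res[OF m] by (simp add: res_def nbar_0)
  then show "(\<Sum>t\<in>I. b t * mon3 t F 0) = 0"
    using zero[OF Ind_maskG[OF f(1)] m] by simp
qed

section \<open>Classification of the singular vectors\<close>

text \<open>The operator shifts the parameter by \<open>k\<close> times the first plus \<open>l\<close> times the second simple root.\<close>

definition weights :: "complex \<times> complex \<Rightarrow> pm \<times> pm \<Rightarrow> complex \<times> complex \<Rightarrow> pm \<times> pm \<Rightarrow> nat \<Rightarrow> nat \<Rightarrow> bool" where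
  "weights lam eps nu del k l \<longleftrightarrow>
     nu = (fst lam + 2 * of_nat k - of_nat l, snd lam + 2 * of_nat l - of_nat k) \<and>
     del = (pm_mult (fst eps) (sgn_pow (int l)), pm_mult (snd eps) (sgn_pow (int k)))"

text \<open>The value of m at which the linear factor in \<open>G.E_nform\<close> vanishes, once the
  highest weight is set to \<open>- fst lam\<close>.\<close>

definition sing_par :: "complex \<times> complex \<Rightarrow> nat \<Rightarrow> nat \<Rightarrow> complex" where
  "sing_par lam k l = 1 - fst lam + of_nat l - of_nat k"

text \<open>The coefficients are supported on $n \<le> \min(k, l)$ and satisfy the recursion coming from $E_{23}$;
  the one coming from $E_{12}$ holds by construction.\<close>

definition singular :: "complex \<times> complex \<Rightarrow> nat \<Rightarrow> nat \<Rightarrow> bool" where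
  "singular lam k l \<longleftrightarrow> (\<forall>n. n > min k l \<longrightarrow> sing_coef k (sing_par lam k l) n = 0) \<and>
     (\<forall>m. m < l \<and> m \<le> k \<longrightarrow> of_nat (Suc m) * sing_coef k (sing_par lam k l) (Suc m)
        + of_nat (l - m) * (- snd lam - of_nat l + of_nat m + 1) * sing_coef k (sing_par lam k l) m = 0)"

text \<open>The Cartan matrix of type A2 has determinant 3, so the shift of the parameter determines
  both multiplicities.\<close>

lemma weights_unique:
  assumes "weights lam eps nu del k l" "weights lam eps nu del k' l'"
  shows "k = k'" "l = l'"
proof -
  have e: "2 * of_nat k - of_nat l = 2 * of_nat k' - (of_nat l' :: complex)"
    "2 * of_nat l - of_nat k = 2 * of_nat l' - (of_nat k' :: complex)"
    using assms by (auto simp: weights_def algebra_simps)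
  have "(3 * of_nat k :: complex) = 2 * (2 * of_nat k - of_nat l) + (2 * of_nat l - of_nat k)" by simp
  also have "\<dots> = 3 * of_nat k'" unfolding e by simp
  finally show k: "k = k'" by simp
  have "(3 * of_nat l :: complex) = 2 * (2 * of_nat l - of_nat k) + (2 * of_nat k - of_nat l)" by simp
  also have "\<dots> = 3 * of_nat l'" unfolding e by simp
  finally show "l = l'" by simp
qed

lemma abs_pm_mult_sgn_pow:
  assumes "b \<in> {-1, 1}"
  shows "abs_pm (pm_mult e (sgn_pow (int n))) b = abs_pm e b * b ^ n"
  using assms by (cases e) (auto simp: sgn_pow_def)

lemma chi_weights:
  assumes w: "weights lam eps nu del k l" and s: "signs b1 b2 b3"
  shows "chi lam eps b1 b3 t1 t2 * of_real (wt1 b3 t1 t2) ^ k * of_real (wt2 b1 t1 t2) ^ l = chi nu del b1 b3 t1 t2"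
proof -
  have b: "b1 \<in> {-1, 1}" "b3 \<in> {-1, 1}" using s by (auto simp: signs_def)
  have inv: "inverse (x ^ n) = x ^ n" if "x \<in> {-1, 1}" for x :: complex and n
    using that by (cases "even n") auto
  have cb: "complex_of_real b1 \<in> {-1, 1}" "complex_of_real b3 \<in> {-1, 1}" using b by auto
  have "chiM del b1 b3 = chiM eps b1 b3 * of_real b3 ^ k * of_real b1 ^ l"
    using w by (simp add: weights_def chiM_def abs_pm_mult_sgn_pow[OF b(1)] abs_pm_mult_sgn_pow[OF b(2)] mult_ac)
  then have M: "inverse (chiM del b1 b3) = inverse (chiM eps b1 b3) * of_real b3 ^ k * of_real b1 ^ l"
    by (simp only: inverse_mult_distrib inv[OF cb(1)] inv[OF cb(2)])
  have en: "complex_of_real (exp t) ^ n = exp (of_nat n * complex_of_real t)" for t n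
    by (simp add: exp_of_nat_mult[symmetric] exp_of_real[symmetric])
  have nu: "fst nu = fst lam + 2 * of_nat k - of_nat l" "snd nu = snd lam + 2 * of_nat l - of_nat k"
    using w by (simp_all add: weights_def)
  have A: "inverse (chiA nu t1 t2) = inverse (chiA lam t1 t2) * of_real (exp (t2 - 2 * t1)) ^ k * of_real (exp (t1 - 2 * t2)) ^ l"
    unfolding chiA_def en exp_minus[symmetric] exp_add[symmetric] nu by (simp add: algebra_simps)
  show ?thesis
    unfolding chi_def M A wt1_def wt2_def by (simp add: power_mult_distrib mult_ac)
qed

lemma exp_line_inj:
  assumes "\<And>t::real. exp (a * complex_of_real t) = exp (b * complex_of_real t)"
  shows "a = b"
proof -
  have d: "((\<lambda>t. exp (c * complex_of_real t)) has_vector_derivative c) (at 0)" for c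
  proof -
    have "((\<lambda>t. c * complex_of_real t) has_vector_derivative c * complex_of_real 1) (at 0)"
      by (intro has_vector_derivative_mult_right has_vector_derivative_of_real DERIV_ident)
    from field_vector_diff_chain_at[OF this DERIV_exp] show ?thesis by (simp add: o_def)
  qed
  show ?thesis
    using vector_derivative_unique_at[OF d[of a]] d[of b] unfolding assms by metis
qed

text \<open>Trivial signs and the two coordinate lines of the torus determine \<open>nu\<close>; the
  finite sign group at time zero determines \<open>del\<close>.\<close>

lemma weights_of_chi:
  assumes eq: "\<And>b1 b2 b3 t1 t2. signs b1 b2 b3 \<Longrightarrow>
    chi lam eps b1 b3 t1 t2 * of_real (wt1 b3 t1 t2) ^ k * of_real (wt2 b1 t1 t2) ^ l = chi nu del b1 b3 t1 t2"
  shows "weights lam eps nu del k l"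
proof -
  have en: "complex_of_real (exp t) ^ n = exp (of_nat n * complex_of_real t)" for t n
    by (simp add: exp_of_nat_mult[symmetric] exp_of_real[symmetric])
  have A: "exp (- (fst lam * of_real t1 + snd lam * of_real t2) + of_nat k * of_real (t2 - 2 * t1) + of_nat l * of_real (t1 - 2 * t2))
      = exp (- (fst nu * of_real t1 + snd nu * of_real t2))" for t1 t2 :: real
    using eq[OF signs_1, of t1 t2]
    unfolding chi_def chiM_def chiA_def wt1_def wt2_def abs_pm_1 mult_1 en by (simp add: exp_add exp_minus exp_diff divide_inverse)
  have "- fst lam - 2 * of_nat k + of_nat l = - fst nu"
    by (rule exp_line_inj) (use A[of _ 0] in \<open>simp add: algebra_simps\<close>)
  then have nu1: "fst nu = - (- fst lam - 2 * of_nat k + of_nat l)" by simp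
  have "- snd lam + of_nat k - 2 * of_nat l = - snd nu"
    by (rule exp_line_inj) (use A[of 0] in \<open>simp add: algebra_simps\<close>)
  then have nu2: "snd nu = - (- snd lam + of_nat k - 2 * of_nat l)" by simp
  have nu: "nu = (fst lam + 2 * of_nat k - of_nat l, snd lam + 2 * of_nat l - of_nat k)"
    by (simp add: prod_eq_iff nu1 nu2)
  have abs_inv: "inverse (abs_pm e b) = abs_pm e b" if "b \<in> {-1, 1}" for e b
    using that by (cases e) auto
  have M: "abs_pm (fst eps) b1 * abs_pm (snd eps) b3 * b3 ^ k * b1 ^ l = abs_pm (fst del) b1 * abs_pm (snd del) b3"
    if s: "signs b1 b2 b3" for b1 b2 b3
  proof -
    have b: "b1 \<in> {-1, 1}" "b3 \<in> {-1, 1}" using s by (auto simp: signs_def)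
    have "complex_of_real (abs_pm (fst eps) b1 * abs_pm (snd eps) b3 * b3 ^ k * b1 ^ l)
        = complex_of_real (abs_pm (fst del) b1 * abs_pm (snd del) b3)"
      using eq[OF s, of 0 0]
      by (simp add: chi_def chiM_def chiA_def wt1_def wt2_def of_real_inverse[symmetric] abs_inv[OF b(1)] abs_inv[OF b(2)]
          del: of_real_inverse)
    then show ?thesis using of_real_eq_iff by blast
  qed
  have inj: "e = e'" if "abs_pm e (-1) = abs_pm e' (-1)" for e e'
    using that by (cases e; cases e') auto
  \<comment> \<open>The first triple makes only \<open>b1\<close> negative among \<open>b1\<close>
    and \<open>b3\<close>, the second only \<open>b3\<close>; \<open>b2\<close> restores the
    product.\<close>
  have "signs (-1) (-1) 1" "signs 1 (-1) (-1)" by (simp_all add: signs_def)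
  from M[OF this(1)] M[OF this(2)] have "fst del = pm_mult (fst eps) (sgn_pow (int l))" "snd del = pm_mult (snd eps) (sgn_pow (int k))"
    by (intro inj; simp add: abs_pm_mult_sgn_pow abs_pm_1)+
  then show ?thesis using nu by (simp add: weights_def prod_eq_iff)
qed

lemma nform_G_apply: "G.nform k l a f g = (\<Sum>n\<le>min k l. a n * monG (k - n, l - n, n) f g)"
  by (simp add: G.nform_def sum_fun_apply)

lemma monG_Ind_torus:
  assumes f: "f \<in> Ind lam eps" "f \<in> smoothG" and s: "signs b1 b2 b3" and g: "g \<in> SL3"
  shows "fn.pbw GX GY GZ i j k f (g ** torus b1 b2 b3 t1 t2)
    = chi lam eps b1 b3 t1 t2 * of_real (wt1 b3 t1 t2) ^ (i + k) * of_real (wt2 b1 t1 t2) ^ (j + k)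
      * fn.pbw GX GY GZ i j k f g"
proof -
  have "monG (i, j, k) f (g ** torus b1 b2 b3 t1 t2)
    = chi lam eps b1 b3 t1 t2 * of_real (wt1 b3 t1 t2) ^ (i + k) * of_real (wt2 b1 t1 t2) ^ (j + k)
      * monG (i, j, k) f g"
    by (rule monG_torus[OF f(2) s g]) (rule Ind_torus[OF f(1) _ s])
  then show ?thesis by simp
qed

lemma nform_torus:
  assumes f: "f \<in> Ind lam eps" "f \<in> smoothG" and w: "weights lam eps nu del k l"
    and g: "g \<in> SL3" and s: "signs b1 b2 b3"
  shows "G.nform k l a f (g ** torus b1 b2 b3 t1 t2) = chi nu del b1 b3 t1 t2 * G.nform k l a f g"
proof -
  have "monG (k - n, l - n, n) f (g ** torus b1 b2 b3 t1 t2) = chi nu del b1 b3 t1 t2 * monG (k - n, l - n, n) f g"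
    if "n \<le> min k l" for n
  proof -
    have kl: "k - n + n = k" "l - n + n = l" using that by auto
    show ?thesis
      unfolding prod.case monG_Ind_torus[OF f s g] kl chi_weights[OF w s] ..
  qed
  then show ?thesis
    unfolding nform_G_apply sum_distrib_left by (intro sum.cong refl) simp
qed

lemma sing_coef_Suc:
  "of_nat (Suc m) * sing_coef k \<tau> (Suc m) = of_nat (k - m) * (\<tau> - of_nat m) * sing_coef k \<tau> m"
proof -
  have "Suc m * (k choose Suc m) = (k - m) * (k choose m)"
    by (cases k) (use binomial_absorption[of m k] binomial_absorb_comp[of k m] in simp_all)
  then have "of_nat (Suc m) * of_nat (k choose Suc m) = (of_nat (k - m) * of_nat (k choose m) :: complex)"
    by (metis of_nat_mult)
  then show ?thesis
    unfolding sing_coef_def falling_Suc mult.assoc[symmetric] by (simp add: mult_ac)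
qed

lemma nform_Ind:
  assumes w: "weights lam eps nu del k l" and sing: "singular lam k l"
    and f: "f \<in> Ind lam eps" "f \<in> smoothG"
  shows "G.nform k l (sing_coef k (sing_par lam k l)) f \<in> Ind nu del"
proof (rule Ind_I)
  let ?a = "sing_coef k (sing_par lam k l)"
  note inf = Ind_infinitesimal[OF f]
  show "G.nform k l ?a f \<in> smoothG" by (rule G.nform_closed[OF f(2)])
  have a: "?a n = 0" if "n > min k l" for n using sing that by (simp add: singular_def)
  have "of_nat (k - m) * (- fst lam + of_nat l - of_nat k + 1 - of_nat m) * ?a m - of_nat (Suc m) * ?a (Suc m) = 0" for m
    unfolding sing_coef_Suc by (simp add: sing_par_def algebra_simps)
  then show "Rd e12 (G.nform k l ?a f) = 0"
    by (simp only: G.E_nform[OF f(2) inf a] fn.scale_zero_left sum.neutral_const)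
  let ?b = "\<lambda>m. of_nat (Suc m) * ?a (Suc m) + of_nat (l - m) * (- snd lam - of_nat l + of_nat m + 1) * ?a m"
  have "?b m = 0" if "m < l" "m \<le> k" for m
    using sing that by (simp add: singular_def)
  then have "(\<Sum>m | m < l \<and> m \<le> k. cm (?b m) (M m)) = 0" for M :: "nat \<Rightarrow> mat3 \<Rightarrow> complex"
    by (intro sum.neutral ballI) (simp only: mem_Collect_eq fn.scale_zero_left)
  then show "Rd e23 (G.nform k l ?a f) = 0"
    by (simp only: G.E'_nform[OF f(2) inf a])
qed (rule nform_torus[OF f w])

lemma Ind_scale: "f \<in> Ind lam eps \<Longrightarrow> (\<lambda>g. c * f g) \<in> Ind lam eps"
  unfolding Ind_iff by (auto simp: smooth_on_G_mult_const)

lemma Lact_apply: "Lact g f h = f (matrix_inv g ** h)"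
  by (simp add: Lact_def)

lemma res_apply: "res f x = f (nbar x)"
  by (simp add: res_def)

lemma nform_Lact:
  assumes g: "g \<in> SL3"
  shows "G.nform k l a (Lact g f) = Lact g (G.nform k l a f)"
proof -
  have "fn.pbw GX GY GZ i j n (Lact g f) = Lact g (fn.pbw GX GY GZ i j n f)" for i j n
    using Lact_monG[OF g, of "(i, j, n)" f] by simp
  then show ?thesis by (simp add: fun_eq_iff nform_G_apply Lact_apply)
qed

lemma nform_res:
  assumes f: "f \<in> smoothG"
  shows "R3.nform k l a (res f) = res (G.nform k l a f)"
proof -
  have "fn.pbw Dop1 Dop2 Dop3 i j n (res f) = res (fn.pbw GX GY GZ i j n f)" for i j n
    using mon3_res[OF f, of "(i, j, n)"] by simp
  then show ?thesis by (simp add: fun_eq_iff nform_apply nform_G_apply res_apply)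
qed

lemma DiffG_I:
  assumes D: "is_diffop D" "\<And>F. F \<in> smooth3 \<Longrightarrow> D F = (\<lambda>x. c * R3.nform k l a F x)"
    and ind: "\<And>f. f \<in> Ind lam eps \<Longrightarrow> f \<in> smoothG \<Longrightarrow> G.nform k l a f \<in> Ind nu del"
  shows "D \<in> DiffG lam eps nu del"
proof -
  have "\<exists>h\<in>Ind nu del. D (res f) = res h \<and> (\<forall>g\<in>SL3. D (res (Lact g f)) = res (Lact g h))" if f: "f \<in> Ind lam eps" for f
  proof -
    have m: "maskG f \<in> smoothG" by (rule maskG_smoothG[OF IndD(1)[OF f]])
    define h where "h = (\<lambda>g. c * G.nform k l a (maskG f) g)"
    have h: "h \<in> Ind nu del" unfolding h_def by (intro Ind_scale ind Ind_maskG f m)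
    have D': "D (res f') = (\<lambda>x. c * res (G.nform k l a f') x)" if "f' \<in> smoothG" for f'
      using that D(2)[OF res_smooth3, of f'] nform_res[OF that] by (simp add: smoothG_def)
    have "D (res f) = res h"
      unfolding res_maskG[symmetric, of f] D'[OF m] by (simp add: h_def res_def)
    moreover have "D (res (Lact g f)) = res (Lact g h)" if g: "g \<in> SL3" for g
    proof -
      have "D (res (Lact g f)) = D (res (Lact g (maskG f)))"
        by (simp add: Lact_maskG[OF g] res_maskG)
      also have "\<dots> = res (Lact g h)"
        unfolding D'[OF Lact_smoothG[OF g m]] nform_Lact[OF g] by (simp add: h_def res_def Lact_def)
      finally show ?thesis .
    qed
    ultimately show ?thesis using h by blast
  qed
  then show ?thesis using D(1) by (simp add: DiffG_def)
qed

text \<open>Equivariance under the lower unitriangular group forces the coefficients of the normal form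
  to be constant.\<close>

lemma DiffG_constant_coefficients:
  assumes D: "D \<in> DiffG lam eps nu del"
  shows "\<exists>I a. finite I \<and> (\<forall>F x. F \<in> smooth3 \<longrightarrow> D F x = (\<Sum>t\<in>I. a t * mon3 t F x)) \<and>
    (\<forall>f. f \<in> Ind lam eps \<and> f \<in> smoothG \<longrightarrow> (\<lambda>g. \<Sum>t\<in>I. a t * monG t f g) \<in> Ind nu del)"
proof -
  obtain I A where I: "finite I" and A: "\<And>F x. F \<in> smooth3 \<Longrightarrow> D F x = (\<Sum>t\<in>I. A t x * mon3 t F x)"
    using is_diffop_normal_form[of D] D by (auto simp: DiffG_def)
  define a where "a t = A t 0" for t
  have Dres: "D (res f) x = (\<Sum>t\<in>I. A t x * monG t f (nbar x))" if "f \<in> smoothG" for f x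
    using that A[OF res_smooth3, of f x] by (simp add: smoothG_def mon3_res[OF that] res_apply)
  have im: "\<exists>h\<in>Ind nu del. D (res f) = res h \<and> (\<forall>g\<in>SL3. h g = (\<Sum>t\<in>I. a t * monG t f g))"
    if f: "f \<in> Ind lam eps" "f \<in> smoothG" for f
  proof -
    obtain h where h: "h \<in> Ind nu del" "D (res f) = res h" "\<And>g. g \<in> SL3 \<Longrightarrow> D (res (Lact g f)) = res (Lact g h)"
      using D f(1) unfolding DiffG_def by blast
    have "h g = (\<Sum>t\<in>I. a t * monG t f g)" if g: "g \<in> SL3" for g
    proof -
      note gi = SL3_inverse(3)[OF g]
      \<comment> \<open>Translating \<open>g\<close> to the identity reads off \<open>h\<close> at
        every group element, also outside the big cell, from the value at the origin alone.\<close>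
      have "h g = D (res (Lact (matrix_inv g) f)) 0"
        unfolding h(3)[OF gi] by (simp add: res_def nbar_0 Lact_at[OF g])
      also have "\<dots> = (\<Sum>t\<in>I. a t * monG t f g)"
        unfolding Dres[OF Lact_smoothG[OF gi f(2)]] Lact_monG[OF gi, symmetric] a_def
        by (simp add: nbar_0 Lact_at[OF g])
      finally show ?thesis .
    qed
    then show ?thesis using h by blast
  qed
  have const: "A t x = a t" if t: "t \<in> I" for t x
  proof -
    have "A t x - a t = 0"
    proof (rule monG_independent[OF I t, of lam eps "\<lambda>t. A t x - a t"])
      fix f assume f: "f \<in> Ind lam eps" "f \<in> smoothG"
      note n = nbar_SL3[of x]
      let ?f = "Lact (nbar x) f"
      have f': "?f \<in> Ind lam eps" "?f \<in> smoothG" using Ind_Lact[OF n f(1)] Lact_smoothG[OF n f(2)] by auto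
      have mon: "monG t ?f (nbar x) = monG t f (mat 1)" for t
        unfolding Lact_monG[OF n, symmetric] by (simp add: Lact_def SL3_inverse(2)[OF n])
      obtain h where "D (res ?f) = res h" "\<And>g. g \<in> SL3 \<Longrightarrow> h g = (\<Sum>t\<in>I. a t * monG t ?f g)"
        using im[OF f'] by blast
      then have "(\<Sum>t\<in>I. A t x * monG t ?f (nbar x)) = (\<Sum>t\<in>I. a t * monG t ?f (nbar x))"
        using Dres[OF f'(2), of x] n by (simp add: res_def)
      then show "(\<Sum>t\<in>I. (A t x - a t) * monG t f (mat 1)) = 0"
        unfolding mon by (simp add: left_diff_distrib sum_subtractf)
    qed
    then show ?thesis by simp
  qed
  show ?thesis
  proof (intro exI[of _ I] exI[of _ a] conjI allI impI I)
    show "D F x = (\<Sum>t\<in>I. a t * mon3 t F x)" if "F \<in> smooth3" for F x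
      using A[OF that] const by simp
    show "(\<lambda>g. \<Sum>t\<in>I. a t * monG t f g) \<in> Ind nu del" if "f \<in> Ind lam eps \<and> f \<in> smoothG" for f
    proof -
      have f: "f \<in> Ind lam eps" "f \<in> smoothG" using that by auto
      obtain h where h: "h \<in> Ind nu del" "\<And>g. g \<in> SL3 \<Longrightarrow> h g = (\<Sum>t\<in>I. a t * monG t f g)"
        using im[OF f] by blast
      have "monG t f g = 0" if "g \<notin> SL3" for t g
        using monG_smoothG[OF f(2), of t] that by (simp add: smoothG_def)
      then have "(\<lambda>g. \<Sum>t\<in>I. a t * monG t f g) = maskG h"
        using h(2) by (auto simp: maskG_def fun_eq_iff)
      then show ?thesis using Ind_maskG[OF h(1)] by simp
    qed
  qed
qed

text \<open>The image transforms under the torus by the target character, each monomial by a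
  character of its own; independence of jets compares the two term by term.\<close>

lemma DiffG_weights:
  assumes I: "finite I" and t: "(i, j, k) \<in> I" "a (i, j, k) \<noteq> 0"
    and ind: "\<And>f. f \<in> Ind lam eps \<Longrightarrow> f \<in> smoothG \<Longrightarrow> (\<lambda>g. \<Sum>t\<in>I. a t * monG t f g) \<in> Ind nu del"
  shows "weights lam eps nu del (i + k) (j + k)"
proof (rule weights_of_chi)
  fix b1 b2 b3 t1 t2 assume s: "signs b1 b2 b3"
  define w where "w t = (case t of (i, j, k) \<Rightarrow>
    chi lam eps b1 b3 t1 t2 * of_real (wt1 b3 t1 t2) ^ (i + k) * of_real (wt2 b1 t1 t2) ^ (j + k))" for t :: "nat \<times> nat \<times> nat"
  have "a (i, j, k) * (w (i, j, k) - chi nu del b1 b3 t1 t2) = 0"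
  proof (rule monG_independent[OF I t(1), of lam eps])
    fix f assume f: "f \<in> Ind lam eps" "f \<in> smoothG"
    have "monG t f (mat 1 ** torus b1 b2 b3 t1 t2) = w t * monG t f (mat 1)" for t
    proof -
      obtain p q r where t: "t = (p, q, r)" by (cases t)
      show ?thesis
        unfolding t prod.case monG_Ind_torus[OF f s SL3_one] by (simp add: w_def)
    qed
    then have "(\<Sum>t\<in>I. a t * (w t * monG t f (mat 1))) = chi nu del b1 b3 t1 t2 * (\<Sum>t\<in>I. a t * monG t f (mat 1))"
      using Ind_torus[OF ind[OF f] SL3_one s, of t1 t2] by (simp del: prod.case matrix_mul_lid)
    then show "(\<Sum>t\<in>I. a t * (w t - chi nu del b1 b3 t1 t2) * monG t f (mat 1)) = 0"
      by (simp add: algebra_simps sum_subtractf sum_distrib_left)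
  qed
  then show "chi lam eps b1 b3 t1 t2 * of_real (wt1 b3 t1 t2) ^ (i + k) * of_real (wt2 b1 t1 t2) ^ (j + k) = chi nu del b1 b3 t1 t2"
    using t(2) by (simp add: w_def)
qed

lemma sum_weight_space:
  fixes M :: "nat \<times> nat \<times> nat \<Rightarrow> complex"
  assumes I: "finite I" and a: "\<And>i j n. (i, j, n) \<in> I \<Longrightarrow> a (i, j, n) \<noteq> 0 \<Longrightarrow> i + n = k \<and> j + n = l"
  shows "(\<Sum>t\<in>I. a t * M t)
    = (\<Sum>n\<le>min k l. (if (k - n, l - n, n) \<in> I then a (k - n, l - n, n) else 0) * M (k - n, l - n, n))"
proof -
  let ?\<iota> = "\<lambda>n. (k - n, l - n, n)"
  let ?W = "?\<iota> ` {..min k l}"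
  have inj: "inj_on ?\<iota> {..min k l}" by (auto simp: inj_on_def)
  have "(\<Sum>n\<le>min k l. (if ?\<iota> n \<in> I then a (?\<iota> n) else 0) * M (?\<iota> n)) = (\<Sum>t\<in>?W. (if t \<in> I then a t else 0) * M t)"
    by (simp add: sum.reindex[OF inj] o_def)
  also have "\<dots> = (\<Sum>t\<in>?W \<inter> I. a t * M t)"
    by (simp add: sum.inter_restrict if_distrib[of "\<lambda>x. x * _"] cong: if_cong)
  also have "\<dots> = (\<Sum>t\<in>I. a t * M t)"
  proof (rule sum.mono_neutral_left[OF I])
    show "\<forall>t\<in>I - ?W \<inter> I. a t * M t = 0"
    proof
      fix t assume t: "t \<in> I - ?W \<inter> I"
      obtain i j n where ijn: "t = (i, j, n)" by (cases t)
      have "a t = 0"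
      proof (rule ccontr)
        assume "a t \<noteq> 0"
        then have "i + n = k" "j + n = l" using a t ijn by auto
        then have "t = ?\<iota> n" "n \<le> min k l" using ijn by auto
        then show False using t by blast
      qed
      then show "a t * M t = 0" by simp
    qed
  qed auto
  finally show ?thesis ..
qed

text \<open>The image is again killed by both simple root vectors. \<open>G.E_nform\<close> and
  \<open>G.E'_nform\<close> express this by ordered monomials, whose coefficients vanish by
  independence of jets at the identity.\<close>

lemma nform_coefficients:
  assumes a: "\<And>n. n > min k l \<Longrightarrow> a n = 0"
    and ind: "\<And>f. f \<in> Ind lam eps \<Longrightarrow> f \<in> smoothG \<Longrightarrow> G.nform k l a f \<in> Ind nu del"
  shows "m < k \<Longrightarrow> m \<le> l \<Longrightarrow>
      of_nat (Suc m) * a (Suc m) = of_nat (k - m) * (sing_par lam k l - of_nat m) * a m" (is "_ \<Longrightarrow> _ \<Longrightarrow> ?E")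
    and "m < l \<Longrightarrow> m \<le> k \<Longrightarrow>
      of_nat (Suc m) * a (Suc m) + of_nat (l - m) * (- snd lam - of_nat l + of_nat m + 1) * a m = 0" (is "_ \<Longrightarrow> _ \<Longrightarrow> ?E'")
proof -
  have zero: "Rd e12 (G.nform k l a f) = 0" "Rd e23 (G.nform k l a f) = 0" if f: "f \<in> Ind lam eps" "f \<in> smoothG" for f
    using Ind_infinitesimal[OF ind[OF f] G.nform_closed[OF f(2)]] by auto
  \<comment> \<open>Independence is indexed by exponent triples, the recursions by m; the third
    exponent recovers m from the triple.\<close>
  have indep: "\<beta> m = 0"
    if P: "finite P" "m \<in> P" and \<iota>: "inj_on \<iota> P" "\<And>m. m \<in> P \<Longrightarrow> snd (snd (\<iota> m)) = m"
      and z: "\<And>f. f \<in> Ind lam eps \<Longrightarrow> f \<in> smoothG \<Longrightarrow> (\<Sum>m\<in>P. \<beta> m * monG (\<iota> m) f (mat 1)) = 0"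
    for \<beta> :: "nat \<Rightarrow> complex" and \<iota> P m
  proof -
    have "\<beta> (snd (snd (\<iota> m))) = 0"
    proof (rule monG_independent[of "\<iota> ` P" "\<iota> m" lam eps "\<lambda>t. \<beta> (snd (snd t))"])
      show "finite (\<iota> ` P)" "\<iota> m \<in> \<iota> ` P" using P by auto
      fix f assume f: "f \<in> Ind lam eps" "f \<in> smoothG"
      have "(\<Sum>t\<in>\<iota> ` P. \<beta> (snd (snd t)) * monG t f (mat 1)) = (\<Sum>m\<in>P. \<beta> m * monG (\<iota> m) f (mat 1))"
        unfolding sum.reindex[OF \<iota>(1)] o_def by (intro sum.cong refl) (simp add: \<iota>(2) del: prod.case)
      then show "(\<Sum>t\<in>\<iota> ` P. \<beta> (snd (snd t)) * monG t f (mat 1)) = 0" using z[OF f] by simp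
    qed
    then show ?thesis using \<iota>(2)[OF P(2)] by simp
  qed
  show ?E if m: "m < k" "m \<le> l"
  proof -
    let ?P = "{m. m < k \<and> m \<le> l}"
    let ?b = "\<lambda>m. of_nat (k - m) * (- fst lam + of_nat l - of_nat k + 1 - of_nat m) * a m - of_nat (Suc m) * a (Suc m)"
    have "?b m = 0"
    proof (rule indep[of ?P m "\<lambda>m. (k - 1 - m, l - m, m)" ?b])
      show "finite ?P" by (rule finite_subset[of _ "{..<k}"]) auto
      fix f assume f: "f \<in> Ind lam eps" "f \<in> smoothG"
      show "(\<Sum>m\<in>?P. ?b m * monG (k - 1 - m, l - m, m) f (mat 1)) = 0"
        using fun_cong[OF zero(1)[OF f], of "mat 1"] 
        by (simp only: G.E_nform[OF f(2) Ind_infinitesimal[OF f] a] sum_fun_apply cm_apply prod.case zero_fun_apply)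
    qed (use m in \<open>auto simp: inj_on_def\<close>)
    then show ?thesis by (simp add: sing_par_def algebra_simps)
  qed
  show ?E' if m: "m < l" "m \<le> k"
  proof -
    let ?P = "{m. m < l \<and> m \<le> k}"
    let ?b = "\<lambda>m. of_nat (Suc m) * a (Suc m) + of_nat (l - m) * (- snd lam - of_nat l + of_nat m + 1) * a m"
    show "?b m = 0"
    proof (rule indep[of ?P m "\<lambda>m. (k - m, l - 1 - m, m)" ?b])
      show "finite ?P" by (rule finite_subset[of _ "{..<l}"]) auto
      fix f assume f: "f \<in> Ind lam eps" "f \<in> smoothG"
      show "(\<Sum>m\<in>?P. ?b m * monG (k - m, l - 1 - m, m) f (mat 1)) = 0"
        using fun_cong[OF zero(2)[OF f], of "mat 1"] 
        by (simp only: G.E'_nform[OF f(2) Ind_infinitesimal[OF f] a] sum_fun_apply cm_apply prod.case zero_fun_apply)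
    qed (use m in \<open>auto simp: inj_on_def\<close>)
  qed
qed

lemma DiffG_cases:
  assumes D: "D \<in> DiffG lam eps nu del"
  shows "(\<forall>F\<in>smooth3. D F = (\<lambda>x. 0)) \<or> (\<exists>k l c. weights lam eps nu del k l \<and> singular lam k l \<and>
     (\<forall>F\<in>smooth3. D F = (\<lambda>x. c * R3.nform k l (sing_coef k (sing_par lam k l)) F x)))"
proof -
  obtain I a where I: "finite I" and D: "\<And>F x. F \<in> smooth3 \<Longrightarrow> D F x = (\<Sum>t\<in>I. a t * mon3 t F x)"
    and ind: "\<And>f. f \<in> Ind lam eps \<Longrightarrow> f \<in> smoothG \<Longrightarrow> (\<lambda>g. \<Sum>t\<in>I. a t * monG t f g) \<in> Ind nu del"
    using DiffG_constant_coefficients[OF D] by blast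
  show ?thesis
  proof (cases "\<forall>t\<in>I. a t = 0")
    case True
    then show ?thesis using D by (simp add: fun_eq_iff)
  next
    case False
    then obtain i j n where t: "(i, j, n) \<in> I" "a (i, j, n) \<noteq> 0" by auto
    define k where "k = i + n"
    define l where "l = j + n"
    have w: "weights lam eps nu del k l" unfolding k_def l_def by (rule DiffG_weights[OF I t ind])
    \<comment> \<open>All occurring monomials induce the same shift of parameters, so they lie in a
      single weight space.\<close>
    have kl: "i' + n' = k \<and> j' + n' = l" if "(i', j', n') \<in> I" "a (i', j', n') \<noteq> 0" for i' j' n'
      using weights_unique[OF DiffG_weights[OF I that ind] w] by simp
    define \<alpha> where "\<alpha> m = (if m \<le> min k l \<and> (k - m, l - m, m) \<in> I then a (k - m, l - m, m) else 0)" for m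
    have sum: "(\<Sum>t\<in>I. a t * M t) = (\<Sum>m\<le>min k l. \<alpha> m * M (k - m, l - m, m))" for M
    proof -
      have "(\<Sum>t\<in>I. a t * M t)
        = (\<Sum>m\<le>min k l. (if (k - m, l - m, m) \<in> I then a (k - m, l - m, m) else 0) * M (k - m, l - m, m))"
        by (rule sum_weight_space[OF I]) (rule kl)
      also have "\<dots> = (\<Sum>m\<le>min k l. \<alpha> m * M (k - m, l - m, m))"
        by (intro sum.cong refl) (simp add: \<alpha>_def)
      finally show ?thesis .
    qed
    have \<alpha>0: "\<alpha> m = 0" if "m > min k l" for m
    proof -
      have "\<not> m \<le> min k l" using that by linarith
      then show ?thesis unfolding \<alpha>_def by (simp only: simp_thms if_False)
    qed
    have DF: "D F = R3.nform k l \<alpha> F" if "F \<in> smooth3" for F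
      by (rule ext) (simp only: D[OF that] nform_apply sum)
    have ind': "G.nform k l \<alpha> f \<in> Ind nu del" if f: "f \<in> Ind lam eps" "f \<in> smoothG" for f
    proof -
      have "G.nform k l \<alpha> f = (\<lambda>g. \<Sum>t\<in>I. a t * monG t f g)"
        by (rule ext) (simp only: nform_G_apply sum)
      then show ?thesis using ind[OF f] by simp
    qed
    have rec: "of_nat (Suc m) * \<alpha> (Suc m) = of_nat (k - m) * (sing_par lam k l - of_nat m) * \<alpha> m"
      if "m < k" "m \<le> l" for m
      by (rule nform_coefficients(1)[OF \<alpha>0 ind' that])
    have rec': "of_nat (Suc m) * \<alpha> (Suc m) + of_nat (l - m) * (- snd lam - of_nat l + of_nat m + 1) * \<alpha> m = 0"
      if "m < l" "m \<le> k" for m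
      by (rule nform_coefficients(2)[OF \<alpha>0 ind' that])
    let ?s = "sing_coef k (sing_par lam k l)"
    have rec_zero: "?s (Suc m) = 0" if "?s m = 0" for m
      using sing_coef_Suc[of m k "sing_par lam k l"] that by (simp del: of_nat_Suc)
    have \<alpha>n: "\<alpha> n \<noteq> 0" using t by (simp add: \<alpha>_def k_def l_def)
    \<comment> \<open>Beyond the range of the recursion the claim relies on
      \<open>\<alpha> 0\<close> being nonzero: there a vanishing \<open>\<alpha> m\<close> forces
      \<open>?s m\<close> to vanish, and zeros of \<open>?s\<close> propagate. Hence the
      disjunction.\<close>
    have \<alpha>s: "\<alpha> m = \<alpha> 0 * ?s m" if "\<alpha> 0 \<noteq> 0 \<or> m \<le> min k l" for m
      using that
    proof (induction m)
      case 0
      then show ?case by (simp add: sing_coef_def)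
    next
      case (Suc m)
      then have IH: "\<alpha> m = \<alpha> 0 * ?s m" by auto
      consider "k \<le> m" | "m < k" "m \<le> l" | "m < k" "l < m" by linarith
      then show ?case
      proof cases
        case 1
        then show ?thesis by (simp add: \<alpha>0 sing_coef_def binomial_eq_0)
      next
        case 2
        have "of_nat (Suc m) * \<alpha> (Suc m) = \<alpha> 0 * (of_nat (Suc m) * ?s (Suc m))"
          unfolding rec[OF 2] IH sing_coef_Suc by (simp add: mult_ac)
        then show ?thesis by (simp del: of_nat_Suc)
      next
        case 3
        then have "\<alpha> m = 0" "\<alpha> (Suc m) = 0" by (simp_all add: \<alpha>0)
        moreover have "\<alpha> 0 \<noteq> 0" using Suc.prems 3 by auto
        ultimately show ?thesis using IH rec_zero by auto
      qed
    qed
    \<comment> \<open>The index \<open>n\<close> of the known nonzero coefficient lies in the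
      support, where the formula already holds; this unlocks it for all indices.\<close>
    have nz: "\<alpha> 0 \<noteq> 0" using \<alpha>s[of n] \<alpha>n by (auto simp: k_def l_def)
    note \<alpha>s = \<alpha>s[OF disjI1[OF nz]]
    have "singular lam k l"
      unfolding singular_def
    proof (intro conjI allI impI)
      show "?s m = 0" if "min k l < m" for m using \<alpha>s[of m] \<alpha>0[OF that] nz by simp
      fix m assume m: "m < l \<and> m \<le> k"
      have "\<alpha> 0 * (of_nat (Suc m) * ?s (Suc m) + of_nat (l - m) * (- snd lam - of_nat l + of_nat m + 1) * ?s m) = 0"
        using rec'[of m] m unfolding \<alpha>s[of m] \<alpha>s[of "Suc m"] by (simp add: algebra_simps)
      then show "of_nat (Suc m) * ?s (Suc m) + of_nat (l - m) * (- snd lam - of_nat l + of_nat m + 1) * ?s m = 0"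
        using nz by (simp only: mult_eq_0_iff simp_thms)
    qed
    moreover have "D F = (\<lambda>x. \<alpha> 0 * R3.nform k l ?s F x)" if "F \<in> smooth3" for F
      unfolding DF[OF that] by (rule ext) (simp only: nform_apply sum_distrib_left mult.assoc[symmetric] \<alpha>s[symmetric])
    ultimately show ?thesis using w by blast
  qed
qed

text \<open>The coefficient at n = 0 is 1, and every other monomial contains fewer than k factors
  \<open>Dop1\<close>, so it vanishes on the test function of (k, l, 0).\<close>

lemma nform_nonzero: "\<exists>F\<in>smooth3. R3.nform k l (sing_coef k \<tau>) F \<noteq> (\<lambda>x. 0)"
proof -
  let ?F = "test_fun (\<lambda>x. 1) (k, l, 0)"
  have sm: "?F \<in> smooth3"
    unfolding test_fun_def[abs_def] by (simp add: smooth3_mult smooth3_power smooth3_const coord_smooth3)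
  have "mon3 (k - n, l - n, n) ?F 0 = 0" if "n \<in> {..min k l} - {0}" for n
    using that by (intro mon3_test_fun_less smooth3_const) auto
  then have "(\<Sum>n\<in>{..min k l} - {0}. sing_coef k \<tau> n * mon3 (k - n, l - n, n) ?F 0) = 0"
    by (intro sum.neutral ballI) (simp del: prod.case)
  then have "R3.nform k l (sing_coef k \<tau>) ?F 0 = mon3 (k, l, 0) ?F 0"
    unfolding nform_apply by (subst sum.remove[of _ 0]) (simp_all add: sing_coef_def del: prod.case)
  moreover have "mon3 (k, l, 0) ?F 0 \<noteq> 0" by (rule mon3_test_fun_eq) (simp_all add: smooth3_const)
  ultimately show ?thesis using sm by metis
qed

text \<open>One-dimensionality combines two uniqueness facts: the parameters fix k and l, and the
  recursion fixes the coefficients up to the one at 0.\<close>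

lemma DiffG_singular:
  assumes w: "weights lam eps nu del k l" and sing: "singular lam k l" and Op: "is_diffop Op"
    and eq: "\<And>F. F \<in> smooth3 \<Longrightarrow> Op F = R3.nform k l (sing_coef k (sing_par lam k l)) F"
  shows "DiffG lam eps nu del = Cline Op \<and> Op \<in> DiffG lam eps nu del \<and> (\<exists>F. smooth_on UNIV F \<and> Op F \<noteq> (\<lambda>x. 0))"
proof (intro conjI)
  have mem: "D \<in> DiffG lam eps nu del" if "D \<in> Cline Op" for D
  proof -
    have dif: "is_diffop D" and "\<exists>c. \<forall>F. smooth_on UNIV F \<longrightarrow> D F = (\<lambda>x. c * Op F x)"
      using that by (simp_all add: Cline_def)
    from this(2) obtain c where c: "\<forall>F. smooth_on UNIV F \<longrightarrow> D F = (\<lambda>x. c * Op F x)"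
      by (rule exE)
    have "D F = (\<lambda>x. c * R3.nform k l (sing_coef k (sing_par lam k l)) F x)" if "F \<in> smooth3" for F
      using c eq[OF that] that by (simp add: smooth3_def)
    then show ?thesis
      using DiffG_I[OF dif _ nform_Ind[OF w sing]] by blast
  qed
  have "D \<in> Cline Op" if D: "D \<in> DiffG lam eps nu del" for D
  proof -
    have "is_diffop D" using D by (simp add: DiffG_def)
    moreover have "\<exists>c. \<forall>F\<in>smooth3. D F = (\<lambda>x. c * Op F x)"
      using DiffG_cases[OF D]
    proof
      assume "\<forall>F\<in>smooth3. D F = (\<lambda>x. 0)"
      then show ?thesis by (intro exI[of _ 0]) simp
    next
      assume "\<exists>k l c. weights lam eps nu del k l \<and> singular lam k l \<and>
        (\<forall>F\<in>smooth3. D F = (\<lambda>x. c * R3.nform k l (sing_coef k (sing_par lam k l)) F x))"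
      then obtain k' l' c where k': "weights lam eps nu del k' l'"
        "\<And>F. F \<in> smooth3 \<Longrightarrow> D F = (\<lambda>x. c * R3.nform k' l' (sing_coef k' (sing_par lam k' l')) F x)" by blast
      then show ?thesis using weights_unique[OF k'(1) w] eq by (intro exI[of _ c]) simp
    qed
    ultimately show ?thesis by (auto simp: Cline_def smooth3_def)
  qed
  with mem show "DiffG lam eps nu del = Cline Op" by blast
  have "Op \<in> Cline Op" unfolding Cline_def using Op by (auto intro!: exI[of _ 1])
  then show "Op \<in> DiffG lam eps nu del" by (rule mem)
  show "\<exists>F. smooth_on UNIV F \<and> Op F \<noteq> (\<lambda>x. 0)"
    using nform_nonzero[of k l "sing_par lam k l"] eq by (auto simp: smooth3_def)
qed

lemma DiffG_trivial:
  assumes "\<And>k l. weights lam eps nu del k l \<Longrightarrow> \<not> singular lam k l"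
  shows "DiffG lam eps nu del = Cline (\<lambda>F x. 0)"
proof (intro equalityI subsetI)
  fix D assume D: "D \<in> DiffG lam eps nu del"
  then have "\<forall>F\<in>smooth3. D F = (\<lambda>x. 0)" using DiffG_cases[OF D] assms by blast
  with D show "D \<in> Cline (\<lambda>F x. 0)" by (simp add: Cline_def DiffG_def smooth3_def)
next
  fix D assume D: "D \<in> Cline (\<lambda>F x. 0)"
  \<comment> \<open>The zero operator is presented as a normal form with zero coefficients; its
    image lies in every \<open>Ind\<close>, so \<open>DiffG_I\<close> applies for all
    parameters.\<close>
  have "G.nform 0 0 (\<lambda>_. 0) f \<in> Ind nu del" for f
  proof -
    have "G.nform 0 0 (\<lambda>_. 0) f = (\<lambda>g. 0)" by (simp add: fun_eq_iff nform_G_apply)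
    moreover have "(\<lambda>g. 0) \<in> Ind nu del" by (simp add: Ind_iff smooth_on_G_zero)
    ultimately show ?thesis by simp
  qed
  with D show "D \<in> DiffG lam eps nu del"
    by (intro DiffG_I[of D 1 0 0 "\<lambda>_. 0"]) (auto simp: Cline_def smooth3_def nform_apply fun_eq_iff)
qed

lemma is_diffop_symm: "is_diffop (symm p q r)"
proof -
  have "spanned pds (\<lambda>F x. \<Sum>w\<in>words p q r. (1 / of_nat (card (words p q r))) * word_op w F x)"
    using is_diffop_word_op by (intro spanned_sum finite_words spanned_mult smooth3_const) (simp add: is_diffop_spanned)
  moreover have "(\<lambda>F x. \<Sum>w\<in>words p q r. (1 / of_nat (card (words p q r))) * word_op w F x) = symm p q r"
    by (simp add: fun_eq_iff symm_def sum_divide_distrib)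
  ultimately show ?thesis by (simp add: is_diffop_spanned)
qed

lemma is_diffop_ops: "is_diffop id" "is_diffop (Dpow i k)" "is_diffop (Dpm pos k l)" "is_diffop (Dc s k)"
proof -
  show "is_diffop id" using is_diffop_ident by (simp add: id_def)
  show "is_diffop (Dpow i k)" unfolding Dpow_def by (rule is_diffop_word_op)
  show "is_diffop (Dpm pos k l)" "is_diffop (Dc s k)"
    unfolding Dpm_def[abs_def] Dc_def[abs_def] is_diffop_spanned
    by (intro spanned_sum spanned_mult smooth3_const is_diffop_symm[unfolded is_diffop_spanned] finite_atLeastAtMost)+
qed

text \<open>Substituting \<open>sing_coef_Suc\<close> for the next coefficient turns the recursion
  of the second root vector into a factor, linear in m, times the m-th coefficient.\<close>

lemma singularI:
  assumes "\<And>n. n > min k l \<Longrightarrow> sing_coef k (sing_par lam k l) n = 0"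
    and "\<And>m. m < l \<Longrightarrow> m \<le> k \<Longrightarrow>
      (of_nat (k - m) * (sing_par lam k l - of_nat m) + of_nat (l - m) * (- snd lam - of_nat l + of_nat m + 1))
        * sing_coef k (sing_par lam k l) m = 0"
  shows "singular lam k l"
  unfolding singular_def sing_coef_Suc using assms by (simp add: distrib_right)

lemma sing_coef_gt: "k < n \<Longrightarrow> sing_coef k \<tau> n = 0"
  by (simp add: sing_coef_def binomial_eq_0)

lemma falling_zero: "0 < n \<Longrightarrow> falling 0 n = 0"
  by (cases n) (auto simp: falling_def prod.lessThan_Suc_shift)

lemma cond_id: "del = eps \<and> nu = lam \<Longrightarrow> weights lam eps nu del 0 0 \<and> singular lam 0 0"
proof -
  have "pm_mult e Pos = e" for e by (cases e) auto
  then show "del = eps \<and> nu = lam \<Longrightarrow> weights lam eps nu del 0 0 \<and> singular lam 0 0"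
    by (auto simp: weights_def sgn_pow_def prod_eq_iff intro!: singularI sing_coef_gt)
qed

lemma pm_mult_Pos: "pm_mult e (sgn_pow 0) = e"
  by (cases e) (auto simp: sgn_pow_def)

lemma cond_a_singular:
  assumes "cond_a eps del lam nu n1"
  shows "weights lam eps nu del (nat (1 - n1)) 0 \<and> singular lam (nat (1 - n1)) 0"
proof -
  have n: "n1 \<le> 0" "fst lam = of_int n1" "nu = (2 - fst lam, fst lam + snd lam - 1)"
    "del = (fst eps, pm_mult (snd eps) (sgn_pow (1 - n1)))"
    using assms by (auto simp: cond_a_def)
  obtain k where k: "n1 = 1 - int k" "0 < k" using n(1) by (intro that[of "nat (1 - n1)"]) auto
  have "sing_par lam k 0 = 0" by (simp add: sing_par_def n(2) k)
  then show ?thesis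
    using n k by (auto simp: weights_def pm_mult_Pos intro!: singularI simp: sing_coef_def falling_zero)
qed

lemma cond_a'_singular:
  assumes "cond_a' eps del lam nu n2"
  shows "weights lam eps nu del 0 (nat (1 - n2)) \<and> singular lam 0 (nat (1 - n2))"
proof -
  have n: "n2 \<le> 0" "snd lam = of_int n2" "nu = (fst lam + snd lam - 1, 2 - snd lam)"
    "del = (pm_mult (fst eps) (sgn_pow (1 - n2)), snd eps)"
    using assms by (auto simp: cond_a'_def)
  obtain l where l: "n2 = 1 - int l" "0 < l" using n(1) by (intro that[of "nat (1 - n2)"]) auto
  show ?thesis
    using n l by (auto simp: weights_def pm_mult_Pos sing_coef_gt intro!: singularI)
qed

text \<open>Here \<tau> = l: the falling factorial of l provides the support beyond l, and the
  compatibility factor is (l - m) times (k - m) + (m - k), which is zero.\<close>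

lemma cond_b_singular:
  assumes "cond_b eps del lam nu k l"
  shows "weights lam eps nu del k l" "singular lam k l" "sing_par lam k l = of_nat l"
proof -
  have n: "1 \<le> k" "1 \<le> l" "lam = (of_int (1 - int k), of_int (1 - int l + int k))" "nu = (snd lam, 3 - fst lam - snd lam)"
    "del = (pm_mult (fst eps) (sgn_pow (2 - (1 - int k) - (1 - int l + int k))), pm_mult (snd eps) (sgn_pow (1 - (1 - int k))))"
    using assms by (auto simp: cond_b_def Let_def)
  have "2 - (1 - int k) - (1 - int l + int k) = int l" "1 - (1 - int k) = int k" by auto
  then show "weights lam eps nu del k l"
    using n by (simp add: weights_def)
  show p: "sing_par lam k l = of_nat l" by (simp add: sing_par_def n(3))
  show "singular lam k l"
  proof (rule singularI)
    show "sing_coef k (sing_par lam k l) n = 0" if "min k l < n" for n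
      using that by (auto simp: p sing_coef_def falling_of_nat binomial_eq_0 min_less_iff_disj)
    show "(of_nat (k - m) * (sing_par lam k l - of_nat m) + of_nat (l - m) * (- snd lam - of_nat l + of_nat m + 1))
        * sing_coef k (sing_par lam k l) m = 0" if "m < l" "m \<le> k" for m
      using that unfolding p by (simp add: n(3) of_nat_diff algebra_simps)
  qed
qed

text \<open>Here \<tau> = 0, so only the coefficient at 0 survives, and compatibility at m = 0 is
  the condition 1 - l - \<open>snd lam\<close> = 0.\<close>

lemma cond_b'_singular:
  assumes "cond_b' eps del lam nu k l"
  shows "weights lam eps nu del k l" "singular lam k l" "sing_par lam k l = 0"
proof -
  have n: "1 \<le> k" "1 \<le> l" "lam = (of_int (1 - int k + int l), of_int (1 - int l))" "nu = (3 - fst lam - snd lam, fst lam)"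
    "del = (pm_mult (fst eps) (sgn_pow (1 - (1 - int l))), pm_mult (snd eps) (sgn_pow (2 - (1 - int k + int l) - (1 - int l))))"
    using assms by (auto simp: cond_b'_def Let_def)
  have "2 - (1 - int k + int l) - (1 - int l) = int k" "1 - (1 - int l) = int l" by auto
  then show "weights lam eps nu del k l"
    using n by (simp add: weights_def)
  show p: "sing_par lam k l = 0" by (simp add: sing_par_def n(3))
  show "singular lam k l"
  proof (rule singularI)
    show "sing_coef k (sing_par lam k l) n = 0" if "min k l < n" for n
      using that by (simp add: p sing_coef_def falling_zero)
    show "(of_nat (k - m) * (sing_par lam k l - of_nat m) + of_nat (l - m) * (- snd lam - of_nat l + of_nat m + 1))
        * sing_coef k (sing_par lam k l) m = 0" if "m < l" "m \<le> k" for m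
      unfolding p by (cases "m = 0") (simp_all add: n(3) sing_coef_def falling_zero)
  qed
qed

text \<open>For k = l the factor k - m is common to both terms, and the rest is independent of m; it
  vanishes on the line \<open>fst lam + snd lam\<close> = 2 - k, on which s is the free
  parameter.\<close>

lemma cond_c_singular:
  assumes "cond_c eps del lam nu k s"
  shows "weights lam eps nu del k k" "singular lam k k" "sing_par lam k k = (of_nat k + s) / 2"
proof -
  have n: "lam = ((2 - of_nat k - s) / 2, (2 - of_nat k + s) / 2)" "nu = (2 - snd lam, 2 - fst lam)"
    "del = (pm_mult (fst eps) (sgn_pow (int k)), pm_mult (snd eps) (sgn_pow (int k)))"
    using assms by (auto simp: cond_c_def)
  show "weights lam eps nu del k k"
    unfolding weights_def n by (simp add: field_simps)
  show p: "sing_par lam k k = (of_nat k + s) / 2" by (simp add: sing_par_def n(1) field_simps)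
  show "singular lam k k"
  proof (rule singularI)
    show "sing_coef k (sing_par lam k k) n = 0" if "min k k < n" for n
      using that by (simp add: sing_coef_gt)
    have "sing_par lam k k - of_nat m + (- snd lam - of_nat k + of_nat m + 1) = 0" for m
      unfolding p by (simp add: n(1) field_simps)
    then show "(of_nat (k - m) * (sing_par lam k k - of_nat m) + of_nat (k - m) * (- snd lam - of_nat k + of_nat m + 1))
        * sing_coef k (sing_par lam k k) m = 0" for m
      by (simp only: distrib_left[symmetric] mult_zero_right mult_zero_left)
  qed
qed

text \<open>With k, l and \<tau> nonzero, the coefficients at 0 and 1 are nonzero, so compatibility
  at these two steps can be used in full; only l = 1, where step 1 is missing, draws on the support
  condition instead.\<close>

lemma singular_classification:
  assumes w: "weights lam eps nu del k l" and sing: "singular lam k l"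
  shows "(del = eps \<and> nu = lam) \<or> (\<exists>n1. cond_a eps del lam nu n1) \<or> (\<exists>n2. cond_a' eps del lam nu n2)
     \<or> (\<exists>k l. cond_b eps del lam nu k l) \<or> (\<exists>k l. cond_b' eps del lam nu k l) \<or> (\<exists>k s. cond_c eps del lam nu k s)"
proof -
  obtain x y where lam: "lam = (x, y)" by (cases lam)
  let ?\<tau> = "sing_par lam k l"
  let ?a = "sing_coef k ?\<tau>"
  have \<tau>: "?\<tau> = 1 - x + of_nat l - of_nat k" by (simp add: sing_par_def lam)
  have nu: "nu = (x + 2 * of_nat k - of_nat l, y + 2 * of_nat l - of_nat k)"
    and del: "del = (pm_mult (fst eps) (sgn_pow (int l)), pm_mult (snd eps) (sgn_pow (int k)))"
    using w by (auto simp: weights_def lam)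
  have vanish: "?a n = 0" if "n > min k l" for n using sing that by (simp add: singular_def)
  have rel: "(of_nat (k - m) * (?\<tau> - of_nat m) + of_nat (l - m) * (- y - of_nat l + of_nat m + 1)) * ?a m = 0"
    if "m < l" "m \<le> k" for m
    using sing that unfolding singular_def sing_coef_Suc by (simp add: lam distrib_right)
  have a0: "?a 0 = 1" "?a 1 = of_nat k * ?\<tau>" by (simp_all add: sing_coef_def falling_def)
  show ?thesis
  proof (cases "l = 0")
    case l0: True
    show ?thesis
    proof (cases "k = 0")
      case True
      then show ?thesis using l0 nu del lam by (simp add: pm_mult_Pos prod_eq_iff)
    next
      case False
      then have "?\<tau> = 0" using vanish[of 1] l0 a0 by simp
      then have x: "x = of_int (1 - int k)" using \<tau> l0 by (simp add: algebra_simps)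
      have "cond_a eps del lam nu (1 - int k)"
        using False l0 by (simp add: cond_a_def lam nu del x pm_mult_Pos)
      then show ?thesis by blast
    qed
  next
    case l: False
    have rel0: "of_nat k * ?\<tau> + of_nat l * (- y - of_nat l + 1) = 0"
      using rel[of 0] l a0 by simp
    show ?thesis
    proof (cases "k = 0")
      case True
      then have "- y - of_nat l + 1 = 0" using rel0 l by simp
      then have y: "y = of_int (1 - int l)" by (simp add: algebra_simps)
      have "cond_a' eps del lam nu (1 - int l)"
        using True l by (simp add: cond_a'_def lam nu del y pm_mult_Pos)
      then show ?thesis by blast
    next
      case k: False
      show ?thesis
      proof (cases "?\<tau> = 0")
        case True
        then have "- y - of_nat l + 1 = 0" using rel0 l by simp
        then have y: "y = of_int (1 - int l)" by (simp add: algebra_simps)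
        have x: "x = of_int (1 - int k + int l)" using True \<tau> by (simp add: algebra_simps)
        have "cond_b' eps del lam nu k l"
          using k l by (simp add: cond_b'_def Let_def lam nu del x y)
        then show ?thesis by blast
      next
        case False
        then have a1: "?a 1 \<noteq> 0" using a0 k by simp
        have key: "(k = l \<and> x + y = 2 - of_nat l) \<or> (x = 1 - of_nat k \<and> y = 1 - of_nat l + of_nat k)"
        proof (cases "l = 1")
          case l1: True
          show ?thesis
          proof (cases "k = 1")
            case True
            then show ?thesis using rel0 l1 \<tau> by (simp add: algebra_simps)
          next
            case False
            \<comment> \<open>Now k is at least 2, so the recursion reaches index 2, which lies
              outside the support; the factor \<tau> - 1 has to vanish.\<close>
            have "of_nat (Suc 1) * ?a (Suc 1) = 0" using vanish[of 2] l1 k by (simp add: numeral_2_eq_2)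
            then have "?\<tau> = 1"
              unfolding sing_coef_Suc using a1 False k by simp
            then show ?thesis using rel0 l1 \<tau> by (simp add: algebra_simps)
          qed
        next
          case l1: False
          have "of_nat (k - 1) * (?\<tau> - 1) + of_nat (l - 1) * (- y - of_nat l + 1 + 1) = 0"
            using rel[of 1] l l1 k a1 by simp
          then have rel1: "(of_nat k - 1) * (?\<tau> - 1) + (of_nat l - 1) * (- y - of_nat l + 2) = 0"
            using k l by (simp add: of_nat_diff algebra_simps)
          \<comment> \<open>The compatibility factor is linear in m; its value at 0 minus its value
            at 1 is the negative of its slope.\<close>
          have "2 - x - y - of_nat l = (of_nat k * ?\<tau> + of_nat l * (- y - of_nat l + 1))
            - ((of_nat k - 1) * (?\<tau> - 1) + (of_nat l - 1) * (- y - of_nat l + 2))"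
            unfolding \<tau> by (simp add: algebra_simps)
          then have xy: "2 - x - y - of_nat l = 0" unfolding rel0 rel1 by simp
          then have y: "y = 2 - x - of_nat l" by (simp add: algebra_simps)
          \<comment> \<open>Once the slope vanishes, the constant term factors: k = l leads to
            family c, the other root to family b.\<close>
          have "(of_nat k - of_nat l) * (1 - x - of_nat k) = of_nat k * ?\<tau> + of_nat l * (- y - of_nat l + 1)"
            unfolding \<tau> y by (simp add: algebra_simps)
          then have "(of_nat k - of_nat l) * (1 - x - of_nat k) = 0" unfolding rel0 .
          then have "of_nat k - (of_nat l :: complex) = 0 \<or> 1 - x - of_nat k = 0"
            by (simp only: mult_eq_0_iff)
          then have "k = l \<or> x = 1 - of_nat k" by (auto simp: algebra_simps)
          then show ?thesis using y by auto
        qed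
        then show ?thesis
        proof
          assume c: "k = l \<and> x + y = 2 - of_nat l"
          then have y: "y = 2 - of_nat k - x" by (simp add: algebra_simps)
          have kl: "l = k" using c by simp
          have s: "(2 - of_nat k - (y - x)) / 2 = x" "(2 - of_nat k + (y - x)) / 2 = y"
            unfolding y by (simp_all add: field_simps)
          have n: "x + 2 * of_nat k - of_nat l = 2 - y" "y + 2 * of_nat l - of_nat k = 2 - x"
            unfolding kl y by simp_all
          have "cond_c eps del lam nu k (y - x)"
            unfolding cond_c_def lam nu del fst_conv snd_conv s n unfolding kl using k by simp
          then show ?thesis by blast
        next
          assume b: "x = 1 - of_nat k \<and> y = 1 - of_nat l + of_nat k"
          have "cond_b eps del lam nu k l"
            using k l b by (simp add: cond_b_def Let_def lam nu del)
          then show ?thesis by blast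
        qed
      qed
    qed
  qed
qed

text \<open>The families overlap: for equal k and l, family b is family c with s = k, and family b'
  is family c with s = -k. The clauses remain consistent because the operators then have the same
  normal form on smooth functions.\<close>

theorem theorem4p3:
  fixes eps del :: "pm \<times> pm" and lam nu :: "complex \<times> complex"
  shows
   "(del = eps \<and> nu = lam \<longrightarrow>
       DiffG lam eps nu del = Cline (id::op3) \<and> (id::op3) \<in> DiffG lam eps nu del
       \<and> (\<exists>F::real^3 \<Rightarrow> complex. smooth_on UNIV F \<and> id F \<noteq> (\<lambda>x. 0)))
  \<and> (\<forall>n1. cond_a eps del lam nu n1 \<longrightarrow>
       DiffG lam eps nu del = Cline (Dpow 1 (nat (1 - n1))) \<and> Dpow 1 (nat (1 - n1)) \<in> DiffG lam eps nu del
       \<and> (\<exists>F. smooth_on UNIV F \<and> Dpow 1 (nat (1 - n1)) F \<noteq> (\<lambda>x. 0)))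
  \<and> (\<forall>n2. cond_a' eps del lam nu n2 \<longrightarrow>
       DiffG lam eps nu del = Cline (Dpow 2 (nat (1 - n2))) \<and> Dpow 2 (nat (1 - n2)) \<in> DiffG lam eps nu del
       \<and> (\<exists>F. smooth_on UNIV F \<and> Dpow 2 (nat (1 - n2)) F \<noteq> (\<lambda>x. 0)))
  \<and> (\<forall>k l. cond_b eps del lam nu k l \<longrightarrow>
       DiffG lam eps nu del = Cline (Dpm True k l) \<and> Dpm True k l \<in> DiffG lam eps nu del
       \<and> (\<exists>F. smooth_on UNIV F \<and> Dpm True k l F \<noteq> (\<lambda>x. 0)))
  \<and> (\<forall>k l. cond_b' eps del lam nu k l \<longrightarrow>
       DiffG lam eps nu del = Cline (Dpm False k l) \<and> Dpm False k l \<in> DiffG lam eps nu del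
       \<and> (\<exists>F. smooth_on UNIV F \<and> Dpm False k l F \<noteq> (\<lambda>x. 0)))
  \<and> (\<forall>k s. cond_c eps del lam nu k s \<longrightarrow>
       DiffG lam eps nu del = Cline (Dc s k) \<and> Dc s k \<in> DiffG lam eps nu del
       \<and> (\<exists>F. smooth_on UNIV F \<and> Dc s k F \<noteq> (\<lambda>x. 0)))
  \<and> (\<not> (del = eps \<and> nu = lam) \<and> \<not> (\<exists>n1. cond_a eps del lam nu n1) \<and> \<not> (\<exists>n2. cond_a' eps del lam nu n2)
     \<and> \<not> (\<exists>k l. cond_b eps del lam nu k l) \<and> \<not> (\<exists>k l. cond_b' eps del lam nu k l)
     \<and> \<not> (\<exists>k s. cond_c eps del lam nu k s) \<longrightarrow>
       DiffG lam eps nu del = Cline (\<lambda>F x. 0))"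
proof -
  let ?line = "\<lambda>Op. DiffG lam eps nu del = Cline Op \<and> Op \<in> DiffG lam eps nu del \<and> (\<exists>F. smooth_on UNIV F \<and> Op F \<noteq> (\<lambda>x. 0))"
  have id: "?line (id::op3)" if "del = eps \<and> nu = lam"
    using cond_id[OF that] by (intro DiffG_singular[of _ _ _ _ 0 0] is_diffop_ops) (auto simp: id_nform[symmetric])
  have a: "?line (Dpow 1 (nat (1 - n1)))" if "cond_a eps del lam nu n1" for n1
    using cond_a_singular[OF that]
    by (intro DiffG_singular[of _ _ _ _ "nat (1 - n1)" 0] is_diffop_ops Dpow_nform) auto
  have a': "?line (Dpow 2 (nat (1 - n2)))" if "cond_a' eps del lam nu n2" for n2
    using cond_a'_singular[OF that]
    by (intro DiffG_singular[of _ _ _ _ 0 "nat (1 - n2)"] is_diffop_ops Dpow_nform) auto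
  have b: "?line (Dpm True k l)" if "cond_b eps del lam nu k l" for k l
    using cond_b_singular[OF that] by (intro DiffG_singular[of _ _ _ _ k l] is_diffop_ops) (auto simp: Dpm_nform)
  have b': "?line (Dpm False k l)" if "cond_b' eps del lam nu k l" for k l
    using cond_b'_singular[OF that] by (intro DiffG_singular[of _ _ _ _ k l] is_diffop_ops) (auto simp: Dpm_nform)
  have c: "?line (Dc s k)" if "cond_c eps del lam nu k s" for k s
    using cond_c_singular(1,2)[OF that]
    by (intro DiffG_singular[of _ _ _ _ k k] is_diffop_ops) (simp_all add: Dc_nform cond_c_singular(3)[OF that])
  have otherwise: "DiffG lam eps nu del = Cline (\<lambda>F x. 0)"
    if "\<not> (del = eps \<and> nu = lam) \<and> \<not> (\<exists>n1. cond_a eps del lam nu n1) \<and> \<not> (\<exists>n2. cond_a' eps del lam nu n2)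
     \<and> \<not> (\<exists>k l. cond_b eps del lam nu k l) \<and> \<not> (\<exists>k l. cond_b' eps del lam nu k l)
     \<and> \<not> (\<exists>k s. cond_c eps del lam nu k s)"
    using that singular_classification by (intro DiffG_trivial) blast
  show ?thesis
    by (rule conjI, rule impI, erule id, rule conjI, intro allI impI, erule a, rule conjI, intro allI impI, erule a',
        rule conjI, intro allI impI, erule b, rule conjI, intro allI impI, erule b',
        rule conjI, intro allI impI, erule c, rule impI, erule otherwise)
qed

end
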